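(* Let $B$ be a finitely generated band and let $K$ be a field. Then \[ \dim X_{B,K} \;\le\; \dim \Sigma_B , \] where $X_{B,K}=\operatorname{Spec}(\rho_K(B))$ and $\Sigma_B=\operatorname{Hom}(B,\mathbb T)$. In particular, if $\operatorname{Hom}(B,\mathbb T)$ consists of a single point (written $\{0\}$), then $\dim\Sigma_B=0$, and therefore the set $X_{B,K}(K)=\operatorname{Hom}(B,K)$ is finite for every field $K$.
   Context: A pointed monoid is a commutative multiplicative monoid $A$ with identity $1$ and an element $0$ such that $0\cdot a=0$ for all $a$. Its ambient semiring $A^+=\mathbb N[A]/\langle 0\rangle$ consists of the finite formal sums $\sum a_i$ of nonzero elements of $A$, with $0$ identified with the empty sum. An ideal of $A^+$ is a subset containing $0$ that is closed under addition and under multiplication by elements of $A^+$. A band is a pointed monoid $B$ together with an ideal $N_B$ of $B^+$ (the nullset) such that for every $a\in B$ there is a unique $b\in B$ with $a+b\in N_B$. A band homomorphism $f:B\to C$ is a multiplicative map with $f(0)=0$ and $f(1)=1$ such that $\sum a_i\in N_B$ implies $\sum f(a_i)\in N_C$. A band is finitely generated if it is finitely generated as a monoid. Every ring $R$ is a band, with $N_R$ the set of formal sums $\sum a_i$ such that $\sum a_i=0$ in $R$. The tropical hyperfield $\mathbb T$ is the band whose underlying monoid is $\mathbb R_{\ge 0}$ under multiplication. Its nullset consists of $0$ together with all formal sums $a_1+\dots+a_n$ in which the maximum of $a_1,\dots,a_n$ is attained at least twice. $\operatorname{Hom}(B,C)$ denotes the set of band homomorphisms. For a field $K$, the associated $K$-algebra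 is $\rho_K(B)=K[B]/\langle N_B\rangle$. Here $K[B]$ is the monoid algebra, i.e. the $K$-vector space with basis $B\setminus\{0\}$ and multiplication induced by that of $B$, with $0\in B$ sent to $0$. The elements $\sum a_i\in N_B$ are regarded as elements of $K[B]$, and $\langle N_B\rangle$ is the ideal they generate. Set $X_{B,K}=\operatorname{Spec}(\rho_K(B))$; its dimension is the Krull dimension. One has $X_{B,K}(K)=\operatorname{Hom}_{K\text{-alg}}(\rho_K(B),K)=\operatorname{Hom}(B,K)$. To define $\dim\Sigma_B$, choose generators $a_1,\dots,a_n$ of $B$ and embed $\Sigma_B=\operatorname{Hom}(B,\mathbb T)$ into $\mathbb T^n=\mathbb R_{\ge0}^n$ via $\varphi\mapsto(\varphi(a_1),\dots,\varphi(a_n))$. Give it the subspace topology, with $\mathbb R_{\ge 0}$ carrying its usual order topology. Then $\dim\Sigma_B$ is the Lebesgue covering dimension of this space, and it is independent of the choice of generators. *)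

theory Defs
  imports
    "HOL-Library.Multiset"
    "HOL-Analysis.Analysis"
    "HOL-Algebra.QuotRing"
begin

section \<open>Pointed monoids and their ambient semirings\<close>

record 'a pmonoid = "'a monoid" +
  pzero :: 'a

locale pointed_monoid = comm_monoid A for A (structure) +
  assumes pzero_closed: "pzero A \<in> carrier A"
    and pzero_mult: "a \<in> carrier A \<Longrightarrow> pzero A \<otimes> a = pzero A"

text \<open>
  A finite formal sum of nonzero elements of \<open>A\<close> is a finite multiset of nonzero elements.
  Dropping the occurrences of zero maps an element of \<open>\<nat>[A]\<close> to its class in
  \<open>\<nat>[A]/\<langle>0\<rangle>\<close>.
\<close>

definition formal_sum :: "('a, 'm) pmonoid_scheme \<Rightarrow> 'a multiset \<Rightarrow> 'a multiset" where
  "formal_sum A M = filter_mset (\<lambda>a. a \<noteq> pzero A) M"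

definition ambient_semiring :: "('a, 'm) pmonoid_scheme \<Rightarrow> 'a multiset ring" where
  "ambient_semiring A =
    \<lparr>carrier = {M. set_mset M \<subseteq> carrier A - {pzero A}},
     mult = (\<lambda>M N. formal_sum A (\<Sum>\<^sub># (image_mset (\<lambda>a. image_mset (\<lambda>b. a \<otimes>\<^bsub>A\<^esub> b) N) M))),
     one = formal_sum A {#\<one>\<^bsub>A\<^esub>#},
     zero = {#},
     add = (+)\<rparr>"

definition semiring_ideal :: "'a set \<Rightarrow> ('a, 'm) ring_scheme \<Rightarrow> bool" where
  "semiring_ideal I S \<longleftrightarrow>
     I \<subseteq> carrier S \<and> \<zero>\<^bsub>S\<^esub> \<in> I \<and>
     (\<forall>x\<in>I. \<forall>y\<in>I. x \<oplus>\<^bsub>S\<^esub> y \<in> I) \<and>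
     (\<forall>s\<in>carrier S. \<forall>x\<in>I. s \<otimes>\<^bsub>S\<^esub> x \<in> I)"


section \<open>Bands\<close>

record 'a band = "'a pmonoid" +
  nullset :: "'a multiset set"

locale band = pointed_monoid B for B (structure) +
  assumes nullset_ideal: "semiring_ideal (nullset B) (ambient_semiring B)"
    and unique_weak_inverse:
      "a \<in> carrier B \<Longrightarrow> \<exists>!b. b \<in> carrier B \<and> formal_sum B {#a, b#} \<in> nullset B"

text \<open>Homomorphisms are taken to be extensional, so that equality in the set of homomorphisms
  is equality on the carrier.\<close>

definition band_Hom ::
    "('a, 'm) band_scheme \<Rightarrow> ('b, 'n) band_scheme \<Rightarrow> ('a \<Rightarrow> 'b) set" where
  "band_Hom B C =
    {f \<in> hom B C \<inter> extensional (carrier B).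
       f (pzero B) = pzero C \<and> f \<one>\<^bsub>B\<^esub> = \<one>\<^bsub>C\<^esub> \<and>
       (\<forall>M\<in>nullset B. formal_sum C (image_mset f M) \<in> nullset C)}"

text \<open>As \<open>B\<close> is a pointed monoid, its zero need not be listed among the generators.\<close>

definition generators :: "('a, 'm) pmonoid_scheme \<Rightarrow> 'a list \<Rightarrow> bool" where
  "generators B as \<longleftrightarrow>
     set as \<subseteq> carrier B \<and>
     (\<forall>H. submonoid H B \<longrightarrow> pzero B \<in> H \<longrightarrow> set as \<subseteq> H \<longrightarrow> H = carrier B)"

definition finitely_generated :: "('a, 'm) pmonoid_scheme \<Rightarrow> bool" where
  "finitely_generated B \<longleftrightarrow> (\<exists>as. generators B as)"

definition ring_band :: "('k, 'm) ring_scheme \<Rightarrow> 'k band" where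
  "ring_band R =
    \<lparr>carrier = carrier R, mult = mult R, one = \<one>\<^bsub>R\<^esub>, pzero = \<zero>\<^bsub>R\<^esub>,
     nullset = {M. set_mset M \<subseteq> carrier R - {\<zero>\<^bsub>R\<^esub>} \<and>
                   (\<Oplus>\<^bsub>R\<^esub>a\<in>set_mset M. [count M a] \<cdot>\<^bsub>R\<^esub> a) = \<zero>\<^bsub>R\<^esub>}\<rparr>"

definition tropical :: "real band" where
  "tropical =
    \<lparr>carrier = {0..}, mult = (*), one = 1, pzero = 0,
     nullset = {M. set_mset M \<subseteq> {0<..} \<and>
                   (M = {#} \<or> 2 \<le> count M (Max (set_mset M)))}\<rparr>"


section \<open>The associated algebra\<close>

definition scalar ::
    "('k, 'm) ring_scheme \<Rightarrow> ('a, 'n) pmonoid_scheme \<Rightarrow> 'k \<Rightarrow> ('a \<Rightarrow> 'k)" where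
  "scalar K B c = (\<lambda>x. if x = \<one>\<^bsub>B\<^esub> \<and> x \<noteq> pzero B then c else \<zero>\<^bsub>K\<^esub>)"

text \<open>The basis of the monoid algebra is the set of nonzero elements of \<open>B\<close>; a product of basis
  elements that is zero in \<open>B\<close> contributes to no coefficient.\<close>

definition monoid_algebra ::
    "('k, 'm) ring_scheme \<Rightarrow> ('a, 'n) pmonoid_scheme \<Rightarrow> ('a \<Rightarrow> 'k) ring" where
  "monoid_algebra K B =
    \<lparr>carrier = {f. (\<forall>x. f x \<in> carrier K) \<and> (\<forall>x. x \<notin> carrier B - {pzero B} \<longrightarrow> f x = \<zero>\<^bsub>K\<^esub>) \<and>
                   finite {x. f x \<noteq> \<zero>\<^bsub>K\<^esub>}},
     mult = (\<lambda>f g x. if x \<in> carrier B - {pzero B}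
               then \<Oplus>\<^bsub>K\<^esub>p\<in>{p. f (fst p) \<noteq> \<zero>\<^bsub>K\<^esub> \<and> g (snd p) \<noteq> \<zero>\<^bsub>K\<^esub> \<and> fst p \<otimes>\<^bsub>B\<^esub> snd p = x}.
                      f (fst p) \<otimes>\<^bsub>K\<^esub> g (snd p)
               else \<zero>\<^bsub>K\<^esub>),
     one = scalar K B \<one>\<^bsub>K\<^esub>,
     zero = (\<lambda>x. \<zero>\<^bsub>K\<^esub>),
     add = (\<lambda>f g x. f x \<oplus>\<^bsub>K\<^esub> g x)\<rparr>"

definition formal_sum_in_algebra ::
    "('k, 'm) ring_scheme \<Rightarrow> 'a multiset \<Rightarrow> ('a \<Rightarrow> 'k)" where
  "formal_sum_in_algebra K M = (\<lambda>x. [count M x] \<cdot>\<^bsub>K\<^esub> \<one>\<^bsub>K\<^esub>)"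

definition null_ideal ::
    "('k, 'm) ring_scheme \<Rightarrow> ('a, 'n) band_scheme \<Rightarrow> ('a \<Rightarrow> 'k) set" where
  "null_ideal K B = Idl\<^bsub>monoid_algebra K B\<^esub> (formal_sum_in_algebra K ` nullset B)"

definition rho ::
    "('k, 'm) ring_scheme \<Rightarrow> ('a, 'n) band_scheme \<Rightarrow> ('a \<Rightarrow> 'k) set ring" where
  "rho K B = monoid_algebra K B Quot null_ideal K B"

text \<open>The \<open>K\<close>-algebra homomorphisms from \<open>rho K B\<close> to \<open>K\<close>, again extensional.\<close>

definition rational_points ::
    "('k, 'm) ring_scheme \<Rightarrow> ('a, 'n) band_scheme \<Rightarrow> (('a \<Rightarrow> 'k) set \<Rightarrow> 'k) set" where
  "rational_points K B =
    {h \<in> ring_hom (rho K B) K \<inter> extensional (carrier (rho K B)).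
       \<forall>c\<in>carrier K. h (null_ideal K B +>\<^bsub>monoid_algebra K B\<^esub> scalar K B c) = c}"


section \<open>Dimensions\<close>

definition Spec :: "('a, 'm) ring_scheme \<Rightarrow> 'a set set" where
  "Spec R = {P. primeideal P R}"

text \<open>The supremum of the lengths \<open>n\<close> of chains \<open>P\<^sub>0 \<subset> \<dots> \<subset> P\<^sub>n\<close>; it is \<open>-\<infinity>\<close> if there are no
  primes.\<close>

definition krull_dim :: "'a set set \<Rightarrow> ereal" where
  "krull_dim X =
     Sup {ereal (real n) | n.
            \<exists>P. (\<forall>i\<le>n. P i \<in> X) \<and> (\<forall>i<n. P i \<subset> P (Suc i))}"

definition covering_dim_le :: "'a topology \<Rightarrow> int \<Rightarrow> bool" where
  "covering_dim_le X n \<longleftrightarrow>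
     (\<forall>\<U>. (\<forall>U\<in>\<U>. openin X U) \<and> \<Union>\<U> = topspace X \<longrightarrow>
       (\<exists>\<V>. (\<forall>V\<in>\<V>. openin X V) \<and> \<Union>\<V> = topspace X \<and>
            (\<forall>V\<in>\<V>. \<exists>U\<in>\<U>. V \<subseteq> U) \<and>
            (\<forall>x\<in>topspace X. finite {V\<in>\<V>. x \<in> V} \<and> int (card {V\<in>\<V>. x \<in> V}) \<le> n + 1)))"

text \<open>The empty space has dimension \<open>-1\<close>.\<close>

definition covering_dim :: "'a topology \<Rightarrow> ereal" where
  "covering_dim X = Inf {ereal (real_of_int n) | n. -1 \<le> n \<and> covering_dim_le X n}"

definition Sigma_space :: "('a, 'm) band_scheme \<Rightarrow> 'a list \<Rightarrow> (nat \<Rightarrow> real) topology" where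
  "Sigma_space B as =
     subtopology (product_topology (\<lambda>_. top_of_set {0::real..}) {..<length as})
       ((\<lambda>\<phi>. \<lambda>i\<in>{..<length as}. \<phi> (as ! i)) ` band_Hom B tropical)"

end

theory Submission
  imports Defs "HOL-Algebra.Finite_Extensions"
begin

text \<open>
  A chain of primes \<open>P\<^sub>0 \<subset> \<dots> \<subset> P\<^sub>d\<close> of \<open>\<rho>\<^sub>K(B)\<close> yields \<open>d\<close> of the generators whose images in the residue field
  \<open>L\<close> of \<open>P\<^sub>0\<close> are algebraically independent over \<open>K\<close>; enlarge them to a transcendence basis
  \<open>(u\<^sub>i)\<close>, \<open>i \<in> I\<close>, among the generators. For weights \<open>l \<in> \<real>\<^sup>I\<close>, Chevalley's theorem gives
  a valuation of \<open>L\<close>, trivial on \<open>K\<close>, with \<open>v(u\<^sub>i) = l\<^sub>i\<close>, and \<open>b \<mapsto> exp (- v(b))\<close> is a point of \<open>\<Sigma>\<close>.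
  The remaining generators are algebraic over the \<open>u\<^sub>i\<close>, so for \<open>l\<close> outside finitely many
  hyperplanes their valuations lie among finitely many linear forms in \<open>l\<close>. As \<open>\<Sigma>\<close> is closed, the
  weights for which a given choice of linear forms defines a point of \<open>\<Sigma>\<close> form a closed set;
  together with the hyperplanes finitely many such sets cover \<open>\<real>\<^sup>I\<close>, so one of them has interior
  points, \<open>\<Sigma>\<close> retracts onto a cube of dimension \<open>|I|\<close>, and \<open>d \<le> |I| \<le> dim \<Sigma>\<close>. If \<open>\<Sigma>\<close> is a point,
  then every generator takes only finitely many values on \<open>K\<close>-points, since a generator with
  infinitely many values is transcendental in some residue field.\<close>


section \<open>Covering dimension\<close>

text \<open>A valuation gives a tropical point because in a vanishing sum no nonzero term can have a
  value strictly below those of all other terms. The obstacle is that Chevalley's theorem leads to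
  an arbitrary ordered value group, whereas tropical points need real values. This is the reason for
  enlarging the independent generators to a maximal set: for generic weights, a positive power of
  every other nonzero generator is, up to a unit of the valuation ring, a quotient of monomials in
  the \<open>u i\<close>, and its real value is read off from the weights. So only the divisibility
  preorder of the valuation ring is used, and no value group is constructed. The second obstacle is
  that nothing is known about how the valuation chosen for a weight \<open>l\<close> varies with
  \<open>l\<close>. No polyhedral structure of the space of tropical points is used either. All that
  remains is that every generic weight admits at least one of finitely many tuples of continuous
  coordinate formulas; closedness and the covering argument then produce one tuple that is valid on
  a whole box of weights.\<close>

definition unit_cube :: "nat \<Rightarrow> (nat \<Rightarrow> real) set" where
  "unit_cube r = {x. (\<forall>i<r. 0 \<le> x i \<and> x i \<le> 1) \<and> (\<forall>i\<ge>r. x i = 0)}"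

text \<open>Freezing the coordinates from \<open>r\<close> on at 0 makes the cube a product over all
  of \<open>nat\<close> with compact factors, so Tychonoff's theorem applies.\<close>

lemma compact_unit_cube: "compact (unit_cube r)"
proof -
  have "unit_cube r = PiE UNIV (\<lambda>i. if i < r then {0..1} else {0})"
    by (force simp: unit_cube_def PiE_iff split: if_splits)
  moreover have "compactin (product_topology (\<lambda>_. euclidean) UNIV)
      (PiE UNIV (\<lambda>i::nat. if i < r then {0..1::real} else {0}))"
    by (subst compactin_PiE) auto
  ultimately show ?thesis
    by (simp add: euclidean_product_topology)
qed

lemma open_coordinate_box:
  fixes x :: "'a \<Rightarrow> real"
  assumes "finite I"
  shows "open {y. \<forall>i\<in>I. \<bar>y i - x i\<bar> < \<epsilon>}"
proof -
  have "{y. \<forall>i\<in>I. \<bar>y i - x i\<bar> < \<epsilon>} = (\<Inter>i\<in>I. {y. \<bar>y i - x i\<bar> < \<epsilon>})"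
    by auto
  also have "open \<dots>"
    using assms by (intro open_INT ballI open_Collect_less continuous_intros) auto
  finally show ?thesis .
qed

lemma dist_le_of_coordinates:
  fixes \<delta> :: real
  assumes "\<delta> > 0"
  obtains \<epsilon> where "\<epsilon> > 0"
    "\<And>x y :: nat \<Rightarrow> real. (\<And>i. \<bar>x i - y i\<bar> \<le> \<epsilon>) \<Longrightarrow> dist x y < \<delta>"
proof -
  obtain N where N: "(1/2::real) ^ N < \<delta> / 2"
    using real_arch_pow_inv[of "\<delta> / 2" "1/2"] assms by auto
  \<comment> \<open>The first \<open>N\<close> terms enter the distance estimate with factor 2 and
    the tail costs at most \<open>(1/2) ^ N < \<delta> / 2\<close>; hence the bound
    \<open>\<delta> / 4\<close>.\<close>
  have "dist x y < \<delta>" if "\<And>i. \<bar>x i - y i\<bar> \<le> \<delta> / 4" for x y :: "nat \<Rightarrow> real"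
  proof -
    have "Max {dist (x (from_nat n)) (y (from_nat n)) |n. n \<le> N} \<le> \<delta> / 4"
      using that by (subst Max_le_iff) (auto simp: dist_real_def)
    with dist_fun_le_dist_first_terms[of x y N] N show ?thesis
      by linarith
  qed
  with assms show thesis
    by (intro that[of "\<delta> / 4"]) auto
qed

lemma covering_dim_leD:
  assumes "covering_dim_le T n" and "\<And>U. U \<in> \<U> \<Longrightarrow> openin T U" and "\<Union>\<U> = topspace T"
  shows "\<exists>\<V>. (\<forall>V\<in>\<V>. openin T V) \<and> \<Union>\<V> = topspace T \<and> (\<forall>V\<in>\<V>. \<exists>U\<in>\<U>. V \<subseteq> U) \<and>
      (\<forall>x\<in>topspace T. finite {V\<in>\<V>. x \<in> V} \<and> int (card {V\<in>\<V>. x \<in> V}) \<le> n + 1)"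
  using assms(2,3) by (intro assms(1)[unfolded covering_dim_le_def, THEN spec, THEN mp]) simp

text \<open>The colour of a member \<open>V\<close> of a fine cover is the least \<open>k < r\<close> such that \<open>V\<close> meets
  the face \<open>x\<^sub>k = 0\<close>, and \<open>r\<close> if there is none. Kuhn's combinatorial lemma provides a
  small simplex whose vertices lie well inside members of all \<open>r + 1\<close> colours; any of its
  vertices then belongs to \<open>r + 1\<close> different members.\<close>

theorem covering_dim_le_unit_cube:
  assumes "covering_dim_le (top_of_set (unit_cube r)) n"
  shows "int r \<le> n"
proof -
  let ?Q = "unit_cube r"
  \<comment> \<open>Two points of one such box differ by less than 1 in each coordinate below
    \<open>r\<close>, so no member of a refinement meets two opposite faces; this is
    \<open>opp\<close>.\<close>
  define \<U> where "\<U> = (\<lambda>x. ?Q \<inter> {y. \<forall>i\<in>{..<r}. \<bar>y i - x i\<bar> < 1/2}) ` ?Q"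
  have "openin (top_of_set ?Q) U" if "U \<in> \<U>" for U
    using that open_coordinate_box[of "{..<r}"] unfolding \<U>_def by (blast intro: openin_open_Int)
  moreover have "\<Union>\<U> = topspace (top_of_set ?Q)"
    unfolding \<U>_def by fastforce
  ultimately have "\<exists>\<V>. (\<forall>V\<in>\<V>. openin (top_of_set ?Q) V) \<and> \<Union>\<V> = topspace (top_of_set ?Q) \<and>
      (\<forall>V\<in>\<V>. \<exists>U\<in>\<U>. V \<subseteq> U) \<and> (\<forall>x\<in>topspace (top_of_set ?Q).
        finite {V\<in>\<V>. x \<in> V} \<and> int (card {V\<in>\<V>. x \<in> V}) \<le> n + 1)"
    by (rule covering_dim_leD[OF assms])
  then obtain \<V> where "\<forall>V\<in>\<V>. openin (top_of_set ?Q) V" "\<Union>\<V> = ?Q"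
      "\<forall>V\<in>\<V>. \<exists>U\<in>\<U>. V \<subseteq> U"
      "\<forall>x\<in>?Q. finite {V\<in>\<V>. x \<in> V} \<and> int (card {V\<in>\<V>. x \<in> V}) \<le> n + 1"
    unfolding topspace_euclidean_subtopology by (elim exE conjE) (rule that)
  note \<V> = this[rule_format]
  have opp: False if V: "V \<in> \<V>" "x \<in> V" "y \<in> V" "i < r" "x i = 0" "y i = 1" for V x y i
  proof -
    obtain z where "\<bar>x i - z i\<bar> < 1/2" "\<bar>y i - z i\<bar> < 1/2"
      using \<V>(3)[OF V(1)] V(2-4) by (auto simp: \<U>_def subset_iff)
    with V(5,6) show False
      by linarith
  qed

  \<comment> \<open>A Lebesgue number of the cover: each ball of radius \<delta> in the cube lies in
    one member, which is then fixed as \<open>W x\<close>.\<close>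
  obtain \<delta> where \<delta>: "\<delta> > 0" "\<And>x. x \<in> ?Q \<Longrightarrow> \<exists>V\<in>\<V>. ball x \<delta> \<inter> ?Q \<subseteq> V"
  proof -
    have "?Q \<subseteq> \<Union>{T. open T \<and> ?Q \<inter> T \<in> \<V>}"
    proof
      fix x assume "x \<in> ?Q"
      then obtain V where "V \<in> \<V>" "x \<in> V"
        using \<V>(2) by blast
      moreover from \<open>V \<in> \<V>\<close> obtain T where "open T" "V = ?Q \<inter> T"
        using \<V>(1) by (metis openin_open)
      ultimately show "x \<in> \<Union>{T. open T \<and> ?Q \<inter> T \<in> \<V>}"
        by (intro UnionI[of T]) auto
    qed
    then obtain \<delta> where "\<delta> > 0"
        "\<And>x. x \<in> ?Q \<Longrightarrow> \<exists>T\<in>{T. open T \<and> ?Q \<inter> T \<in> \<V>}. ball x \<delta> \<subseteq> T"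
      by (rule Heine_Borel_lemma[OF compact_unit_cube]) auto
    then have "\<exists>V\<in>\<V>. ball x \<delta> \<inter> ?Q \<subseteq> V" if "x \<in> ?Q" for x
      using that by (metis (no_types, lifting) Int_commute Int_mono mem_Collect_eq order_refl)
    with \<open>\<delta> > 0\<close> show thesis
      by (rule that)
  qed
  then obtain W where W: "\<And>x. x \<in> ?Q \<Longrightarrow> W x \<in> \<V> \<and> ball x \<delta> \<inter> ?Q \<subseteq> W x"
    by metis
  obtain \<epsilon> where \<epsilon>: "\<epsilon> > 0"
      "\<And>x y :: nat \<Rightarrow> real. (\<And>i. \<bar>x i - y i\<bar> \<le> \<epsilon>) \<Longrightarrow> dist x y < \<delta>"
    using dist_le_of_coordinates[OF \<delta>(1)] by metis
  obtain p :: nat where p: "p > 0" "1 / p < \<epsilon>"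
    by (metis \<epsilon>(1) nat_approx_posE zero_less_Suc)

  \<comment> \<open>The grid is read backwards, with \<open>a j = p\<close> on the face where
    coordinate \<open>j\<close> vanishes. Kuhn's lemma demands label 1 there, and on that face the
    colour is at most \<open>j\<close>; on the opposite face, where label 0 is demanded, the colour
    cannot be \<open>j\<close> by \<open>opp\<close>.\<close>
  define pt :: "(nat \<Rightarrow> nat) \<Rightarrow> nat \<Rightarrow> real"
    where "pt a = (\<lambda>i. if i < r then 1 - a i / p else 0)" for a
  define col where "col V = (LEAST i. i = r \<or> (\<exists>y\<in>V. y i = 0))" for V :: "(nat \<Rightarrow> real) set"
  define c where "c a = col (W (pt a))" for a
  \<comment> \<open>\<open>reduced\<close> returns the first index with nonzero label, so the entry
    at \<open>c a\<close> makes it the colour. The later entries do not affect it and are set only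
    to satisfy the boundary condition at \<open>a j = p\<close>.\<close>
  define lab :: "(nat \<Rightarrow> nat) \<Rightarrow> nat \<Rightarrow> nat"
    where "lab a j = (if j = c a \<or> c a < j \<and> a j = p then 1 else 0)" for a j
  have pt: "pt a \<in> ?Q" if "\<forall>j. a j \<le> p" for a
    using that p(1) by (auto simp: pt_def unit_cube_def)
  have mem: "pt a \<in> W (pt a)" if "\<forall>j. a j \<le> p" for a
    using W[OF pt[OF that]] pt[OF that] \<delta>(1) by auto
  have col_le: "col V \<le> r" for V
    unfolding col_def by (rule Least_le) simp
  have col_zero: "\<exists>y\<in>V. y (col V) = 0" if "col V < r" for V
    using LeastI[of "\<lambda>i. i = r \<or> (\<exists>y\<in>V. y i = 0)" r] that unfolding col_def[symmetric] by auto
  have "odd (card {s. ksimplex p r s \<and> (reduced r \<circ> lab) ` s = {..r}})"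
  proof (rule kuhn_combinatorial[OF p(1)]; intro allI impI; elim conjE)
    fix a j assume a: "\<forall>j. a j \<le> p" "j < r" "a j = 0"
    have "j \<noteq> c a"
    proof
      assume "j = c a"
      then obtain y where "y \<in> W (pt a)" "y j = 0"
        using col_zero a(2) by (auto simp: c_def)
      moreover have "pt a j = 1"
        using a by (simp add: pt_def)
      ultimately show False
        using opp[of "W (pt a)" y "pt a" j] W[OF pt] mem a by blast
    qed
    then show "lab a j = 0"
      using a p by (simp add: lab_def)
  next
    fix a j assume a: "\<forall>j. a j \<le> p" "j < r" "a j = p"
    have "pt a j = 0"
      using a p by (simp add: pt_def)
    then have "c a \<le> j"
      unfolding c_def col_def using mem[of a] a by (intro Least_le) auto
    then show "lab a j = 1"
      using a by (auto simp: lab_def)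
  qed
  then obtain s where s: "ksimplex p r s" "(reduced r \<circ> lab) ` s = {..r}"
    using odd_card_imp_not_empty by blast
  have red: "reduced r (lab a) = c a" for a
    unfolding reduced_def
  proof (rule Least_equality)
    show "c a = r \<or> lab a (c a) \<noteq> 0"
      by (simp add: lab_def)
    fix k assume "k = r \<or> lab a k \<noteq> 0"
    then show "c a \<le> k"
      using col_le by (auto simp: lab_def c_def split: if_splits)
  qed
  from s(1) obtain b u where "kuhn_simplex p r b u s"
    by (auto elim: ksimplex.cases)
  then interpret kuhn_simplex p r b u s .
  have "\<forall>k\<in>{..r}. \<exists>a\<in>s. c a = k"
    using s(2) red by (metis (mono_tags, lifting) comp_apply imageE)
  then obtain a where a: "\<And>k. k \<le> r \<Longrightarrow> a k \<in> s" "\<And>k. k \<le> r \<Longrightarrow> c (a k) = k"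
    by (metis atMost_iff)
  define x where "x = pt (a 0)"
  have le_p: "a k j \<le> p" if "k \<le> r" for k j
    using s_le_p a(1) that by blast
  \<comment> \<open>Vertices of a Kuhn simplex differ by at most 1 in each grid coordinate, hence by
    at most \<open>1 / p < \<epsilon>\<close> in the cube, which puts \<open>x\<close> into the
    \<delta>-ball around each vertex.\<close>
  have "x \<in> W (pt (a k))" if "k \<le> r" for k
  proof -
    have "\<bar>pt (a k) i - x i\<bar> \<le> \<epsilon>" for i
    proof (cases "i < r")
      case True
      have "\<bar>real (a k i) - real (a 0 i)\<bar> \<le> 1"
        using base_le[OF a(1)[OF that], of i] le_Suc_base[OF a(1)[OF that], of i]
          base_le[OF a(1)[of 0], of i] le_Suc_base[OF a(1)[of 0], of i] by linarith
      moreover have "pt (a k) i - x i = (real (a 0 i) - real (a k i)) / p"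
        using True by (simp add: pt_def x_def diff_divide_distrib)
      ultimately have "\<bar>pt (a k) i - x i\<bar> \<le> 1 / p"
        by (simp add: abs_divide divide_right_mono abs_minus_commute)
      with p(2) show ?thesis
        by linarith
    qed (use \<epsilon> in \<open>simp add: pt_def x_def\<close>)
    then have "x \<in> ball (pt (a k)) \<delta> \<inter> ?Q"
      using \<epsilon>(2) pt[of "a 0"] le_p[of 0] by (auto simp: x_def)
    then show ?thesis
      using W[OF pt] le_p[OF that] by blast
  qed
  then have "(\<lambda>k. W (pt (a k))) ` {..r} \<subseteq> {V\<in>\<V>. x \<in> V}"
    using W[OF pt] le_p by auto
  moreover have "inj_on (\<lambda>k. W (pt (a k))) {..r}"
    by (rule inj_onI) (metis a(2) atMost_iff c_def)
  moreover have "x \<in> ?Q"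
    unfolding x_def using le_p[of 0] by (intro pt) auto
  ultimately have "Suc r \<le> card {V\<in>\<V>. x \<in> V}"
    using \<V>(4) card_mono[of "{V\<in>\<V>. x \<in> V}" "(\<lambda>k. W (pt (a k))) ` {..r}"] by (auto simp: card_image)
  with \<V>(4)[OF \<open>x \<in> ?Q\<close>] show ?thesis
    by linarith
qed

text \<open>Pull a cover of \<open>Y\<close> back along \<open>g\<close>, refine it in
  \<open>T\<close>, and pull the refinement back along \<open>f\<close>. As
  \<open>g (f y) = y\<close>, the result refines the given cover, and \<open>y\<close> lies in at
  most as many members as \<open>f y\<close>.\<close>

lemma covering_dim_le_retract:
  assumes "covering_dim_le T n" and "continuous_map T Y g" "continuous_map Y T f"
    and "\<And>y. y \<in> topspace Y \<Longrightarrow> g (f y) = y"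
  shows "covering_dim_le Y n"
  unfolding covering_dim_le_def
proof (intro allI impI, elim conjE)
  fix \<U> assume \<U>: "\<forall>U\<in>\<U>. openin Y U" "\<Union>\<U> = topspace Y"
  define pre where "pre U = {x \<in> topspace T. g x \<in> U}" for U
  have "openin T U" if "U \<in> pre ` \<U>" for U
    using that \<U>(1) assms(2) by (auto simp: pre_def openin_continuous_map_preimage)
  moreover have "\<Union>(pre ` \<U>) = topspace T"
    using \<U>(2) continuous_map_image_subset_topspace[OF assms(2)] by (fastforce simp: pre_def)
  ultimately have "\<exists>\<V>. (\<forall>V\<in>\<V>. openin T V) \<and> \<Union>\<V> = topspace T \<and>
      (\<forall>V\<in>\<V>. \<exists>U\<in>pre ` \<U>. V \<subseteq> U) \<and>
      (\<forall>x\<in>topspace T. finite {V\<in>\<V>. x \<in> V} \<and> int (card {V\<in>\<V>. x \<in> V}) \<le> n + 1)"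
    by (rule covering_dim_leD[OF assms(1)])
  then obtain \<V> where "\<forall>V\<in>\<V>. openin T V" "\<Union>\<V> = topspace T"
      "\<forall>V\<in>\<V>. \<exists>U\<in>pre ` \<U>. V \<subseteq> U"
      "\<forall>x\<in>topspace T. finite {V\<in>\<V>. x \<in> V} \<and> int (card {V\<in>\<V>. x \<in> V}) \<le> n + 1"
    by (elim exE conjE) (rule that)
  note \<V> = this[rule_format]
  define pre' where "pre' V = {y \<in> topspace Y. f y \<in> V}" for V
  have fy: "f y \<in> topspace T" if "y \<in> topspace Y" for y
    using that continuous_map_image_subset_topspace[OF assms(3)] by blast
  show "\<exists>\<V>. (\<forall>V\<in>\<V>. openin Y V) \<and> \<Union>\<V> = topspace Y \<and> (\<forall>V\<in>\<V>. \<exists>U\<in>\<U>. V \<subseteq> U) \<and>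
      (\<forall>x\<in>topspace Y. finite {V\<in>\<V>. x \<in> V} \<and> int (card {V\<in>\<V>. x \<in> V}) \<le> n + 1)"
  proof (intro exI[of _ "pre' ` \<V>"] conjI ballI)
    fix V assume "V \<in> pre' ` \<V>"
    then obtain V' where V': "V' \<in> \<V>" "V = pre' V'"
      by blast
    show "openin Y V"
      unfolding V'(2) pre'_def using V'(1) \<V>(1) assms(3) by (simp add: openin_continuous_map_preimage)
    obtain U where "U \<in> \<U>" "V' \<subseteq> pre U"
      using \<V>(3) V'(1) by blast
    then show "\<exists>U\<in>\<U>. V \<subseteq> U"
      using assms(4) unfolding V'(2) pre'_def pre_def by (intro bexI[of _ U]) force+
  next
    show "\<Union>(pre' ` \<V>) = topspace Y"
      using fy \<V>(2) by (fastforce simp: pre'_def)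
  next
    fix y assume y: "y \<in> topspace Y"
    have sub: "{V \<in> pre' ` \<V>. y \<in> V} \<subseteq> pre' ` {V\<in>\<V>. f y \<in> V}"
      by (auto simp: pre'_def)
    have fin: "finite {V\<in>\<V>. f y \<in> V}" "int (card {V\<in>\<V>. f y \<in> V}) \<le> n + 1"
      using \<V>(4)[OF fy[OF y]] by auto
    show "finite {V \<in> pre' ` \<V>. y \<in> V}"
      using sub fin(1) finite_subset by blast
    have "card {V \<in> pre' ` \<V>. y \<in> V} \<le> card {V\<in>\<V>. f y \<in> V}"
      using sub fin(1) by (meson card_image_le card_mono finite_imageI le_trans)
    with fin(2) show "int (card {V \<in> pre' ` \<V>. y \<in> V}) \<le> n + 1"
      by linarith
  qed
qed

lemma covering_dim_le_singleton:
  assumes "topspace T = {x}"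
  shows "covering_dim_le T n \<longleftrightarrow> 0 \<le> n"
proof
  assume dim: "covering_dim_le T n"
  obtain \<V> where "\<Union>\<V> = topspace T"
      "\<forall>x\<in>topspace T. finite {V\<in>\<V>. x \<in> V} \<and> int (card {V\<in>\<V>. x \<in> V}) \<le> n + 1"
    using covering_dim_leD[OF dim, of "{topspace T}"] by auto
  then have \<V>: "\<Union>\<V> = {x}" "finite {V\<in>\<V>. x \<in> V}" "int (card {V\<in>\<V>. x \<in> V}) \<le> n + 1"
    by (simp_all add: assms)
  then have "card {V\<in>\<V>. x \<in> V} > 0"
    by (subst card_gt_0_iff) blast
  with \<V>(3) show "0 \<le> n"
    by linarith
next
  assume n: "0 \<le> n"
  show "covering_dim_le T n"
    unfolding covering_dim_le_def assms
  proof (intro allI impI, elim conjE)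
    fix \<U> assume \<U>: "\<forall>U\<in>\<U>. openin T U" "\<Union>\<U> = {x}"
    then obtain U where "U \<in> \<U>" "x \<in> U"
      by blast
    moreover have "openin T {x}"
      using openin_topspace[of T] by (simp only: assms)
    moreover have "{V \<in> {{x}}. x \<in> V} = {{x}}"
      by auto
    ultimately show "\<exists>\<V>. (\<forall>V\<in>\<V>. openin T V) \<and> \<Union>\<V> = {x} \<and> (\<forall>V\<in>\<V>. \<exists>U\<in>\<U>. V \<subseteq> U) \<and>
        (\<forall>x\<in>{x}. finite {V \<in> \<V>. x \<in> V} \<and> int (card {V \<in> \<V>. x \<in> V}) \<le> n + 1)"
      using n by (intro exI[of _ "{{x}}"]) auto
  qed
qed

lemma covering_dim_singleton: "topspace T = {x} \<Longrightarrow> covering_dim T = 0"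
  unfolding covering_dim_def
  by (intro antisym Inf_lower Inf_greatest) (auto simp: covering_dim_le_singleton zero_ereal_def)


section \<open>Tropical points of a band\<close>

text \<open>A maximum attained twice means that every nonzero entry has a rival at least as large.
  Removing only one copy of \<open>b\<close> lets a repeated entry be its own rival. This form needs
  no maximum, and its negation is a finite set of strict inequalities, which suits limits.\<close>

lemma tropical_null_iff:
  fixes \<phi> :: "'a \<Rightarrow> real"
  assumes nonneg: "\<And>b. b \<in># M \<Longrightarrow> 0 \<le> \<phi> b"
  shows "formal_sum tropical (image_mset \<phi> M) \<in> nullset tropical \<longleftrightarrow>
    (\<forall>b\<in>#M. \<phi> b = 0 \<or> (\<exists>b'\<in>#M - {#b#}. \<phi> b \<le> \<phi> b'))" (is "?L \<longleftrightarrow> ?R")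
proof -
  define N where "N = filter_mset (\<lambda>x. x \<noteq> 0) (image_mset \<phi> M)"
  have set_N: "set_mset N = {\<phi> b |b. b \<in># M \<and> \<phi> b \<noteq> 0}"
    by (auto simp: N_def)
  then have "set_mset N \<subseteq> {0<..}"
    using nonneg by (auto simp: less_le)
  then have L: "?L \<longleftrightarrow> N = {#} \<or> 2 \<le> count N (Max (set_mset N))"
    by (simp add: N_def formal_sum_def tropical_def)
  have count_N: "count N x = count (image_mset \<phi> M) x" if "x \<noteq> 0" for x
    using that by (simp add: N_def)
  have split: "image_mset \<phi> M = add_mset (\<phi> b) (image_mset \<phi> (M - {#b#}))" if "b \<in># M" for b
    using that by (metis image_mset_add_mset insert_DiffM)
  show ?thesis
  proof
    assume ?L
    show ?R
    proof
      fix b assume b: "b \<in># M"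
      show "\<phi> b = 0 \<or> (\<exists>b'\<in>#M - {#b#}. \<phi> b \<le> \<phi> b')"
      proof (cases "\<phi> b = 0")
        case False
        define m where "m = Max (set_mset N)"
        have "\<phi> b \<in># N"
          using b False set_N by auto
        then have "N \<noteq> {#}" "\<phi> b \<le> m" "m \<in># N"
          unfolding m_def by (auto intro!: Max_in)
        moreover from this have "m \<noteq> 0"
          by (simp add: N_def)
        ultimately have "2 \<le> count (image_mset \<phi> M) m"
          using \<open>?L\<close> L count_N by (auto simp: m_def)
        moreover have "count (image_mset \<phi> M) m \<le> Suc (count (image_mset \<phi> (M - {#b#})) m)"
          unfolding split[OF b] by simp
        ultimately have "0 < count (image_mset \<phi> (M - {#b#})) m"
          by linarith
        then have "m \<in># image_mset \<phi> (M - {#b#})"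
          by (simp only: count_greater_zero_iff)
        with \<open>\<phi> b \<le> m\<close> show ?thesis
          by auto
      qed simp
    qed
  next
    assume R: ?R
    show ?L
    proof (cases "N = {#}")
      case False
      define m where "m = Max (set_mset N)"
      have "m \<in># N"
        unfolding m_def using False by (intro Max_in) auto
      then obtain b where b: "b \<in># M" "\<phi> b = m" "m \<noteq> 0"
        using set_N by auto
      with R obtain b' where b': "b' \<in># M - {#b#}" "m \<le> \<phi> b'"
        by auto
      have "0 < m"
        using b nonneg by fastforce
      then have "\<phi> b' \<in># N"
        using b' set_N by (auto dest: in_diffD)
      then have "\<phi> b' = m"
        using b'(2) by (auto simp: m_def intro!: antisym)
      then have "m \<in># image_mset \<phi> (M - {#b#})"
        using b'(1) by auto
      then have "2 \<le> count (image_mset \<phi> M) m"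
        unfolding split[OF b(1)] using b(2) by (simp add: Suc_le_eq)
      then show ?thesis
        using L count_N b(3) by (simp add: m_def)
    qed (use L in simp)
  qed
qed

lemma (in band) nullset_subset:
  assumes "M \<in> nullset B"
  shows "set_mset M \<subseteq> carrier B - {pzero B}"
  using assms nullset_ideal by (auto simp: semiring_ideal_def ambient_semiring_def)

lemma (in band) band_Hom_tropical_iff:
  "\<phi> \<in> band_Hom B tropical \<longleftrightarrow> \<phi> \<in> extensional (carrier B) \<and>
    (\<forall>a\<in>carrier B. 0 \<le> \<phi> a) \<and> (\<forall>a\<in>carrier B. \<forall>b\<in>carrier B. \<phi> (a \<otimes> b) = \<phi> a * \<phi> b) \<and>
    \<phi> (pzero B) = 0 \<and> \<phi> \<one> = 1 \<and>
    (\<forall>M\<in>nullset B. \<forall>b\<in>#M. \<phi> b = 0 \<or> (\<exists>b'\<in>#M - {#b#}. \<phi> b \<le> \<phi> b'))"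
proof (cases "\<forall>a\<in>carrier B. 0 \<le> \<phi> a")
  case True
  then have "formal_sum tropical (image_mset \<phi> M) \<in> nullset tropical \<longleftrightarrow>
      (\<forall>b\<in>#M. \<phi> b = 0 \<or> (\<exists>b'\<in>#M - {#b#}. \<phi> b \<le> \<phi> b'))" if "M \<in> nullset B" for M
    using nullset_subset[OF that] by (intro tropical_null_iff) auto
  with True show ?thesis
    by (auto simp: band_Hom_def hom_def tropical_def)
next
  case False
  then show ?thesis
    by (auto simp: band_Hom_def hom_def tropical_def Pi_iff)
qed

lemma generators_induct:
  assumes "generators B as" and "submonoid H B" "pzero B \<in> H" "\<And>i. i < length as \<Longrightarrow> as ! i \<in> H"
    and "b \<in> carrier B"
  shows "b \<in> H"
  using assms unfolding generators_def by (metis in_set_conv_nth subsetI)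

text \<open>The elements on which the sequence converges form a submonoid containing
  \<open>pzero B\<close> and the generators, so convergence on generators spreads to all of
  \<open>B\<close>. Null conditions survive because a violation in the limit consists of finitely
  many strict inequalities, which would already hold for large \<open>k\<close>.\<close>

lemma (in band) band_Hom_tropical_limit:
  assumes gen: "generators B as"
    and \<phi>: "\<And>k. \<phi> k \<in> band_Hom B tropical"
    and lim: "\<And>i. i < length as \<Longrightarrow> (\<lambda>k::nat. \<phi> k (as ! i)) \<longlonglongrightarrow> y i"
  obtains \<psi> where "\<psi> \<in> band_Hom B tropical" "\<And>i. i < length as \<Longrightarrow> \<psi> (as ! i) = y i"
proof -
  note hom = \<phi>[unfolded band_Hom_tropical_iff]
  let ?H = "{b \<in> carrier B. convergent (\<lambda>k. \<phi> k b)}"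
  have "submonoid ?H B"
  proof
    fix a b assume "a \<in> ?H" "b \<in> ?H"
    moreover from this have "(\<lambda>k. \<phi> k (a \<otimes> b)) = (\<lambda>k. \<phi> k a * \<phi> k b)"
      using hom by blast
    ultimately show "a \<otimes> b \<in> ?H"
      by (simp add: convergent_mult)
  qed (use hom in \<open>auto simp: convergent_const\<close>)
  moreover have "pzero B \<in> ?H"
    using hom pzero_closed by (auto simp: convergent_const)
  moreover have "as ! i \<in> ?H" if "i < length as" for i
    using lim[OF that] gen that by (auto simp: convergent_def generators_def)
  ultimately have conv: "convergent (\<lambda>k. \<phi> k b)" if "b \<in> carrier B" for b
    using generators_induct[OF gen, of ?H b] that by blast
  define \<psi> where "\<psi> = restrict (\<lambda>b. lim (\<lambda>k. \<phi> k b)) (carrier B)"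
  have \<psi>: "(\<lambda>k. \<phi> k b) \<longlonglongrightarrow> \<psi> b" if "b \<in> carrier B" for b
    using conv[OF that] that by (simp add: \<psi>_def convergent_LIMSEQ_iff)
  have "\<psi> \<in> band_Hom B tropical"
    unfolding band_Hom_tropical_iff
  proof (intro conjI ballI)
    show "\<psi> \<in> extensional (carrier B)"
      by (simp add: \<psi>_def)
  next
    fix a assume "a \<in> carrier B"
    then show "0 \<le> \<psi> a"
      using hom by (intro LIMSEQ_le_const[OF \<psi>]) auto
  next
    fix a b assume ab: "a \<in> carrier B" "b \<in> carrier B"
    have "(\<lambda>k. \<phi> k (a \<otimes> b)) \<longlonglongrightarrow> \<psi> a * \<psi> b"
      using tendsto_mult[OF \<psi>[OF ab(1)] \<psi>[OF ab(2)]] hom ab by simp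
    then show "\<psi> (a \<otimes> b) = \<psi> a * \<psi> b"
      using LIMSEQ_unique \<psi> ab by blast
  next
    show "\<psi> (pzero B) = 0"
      using \<psi>[OF pzero_closed] hom by (simp add: LIMSEQ_const_iff)
    show "\<psi> \<one> = 1"
      using \<psi>[OF one_closed] hom by (simp add: LIMSEQ_const_iff)
  next
    fix M b assume M: "M \<in> nullset B" "b \<in># M"
    have carr: "c \<in> carrier B" if "c \<in># M" for c
      using nullset_subset[OF M(1)] that by blast
    show "\<psi> b = 0 \<or> (\<exists>b'\<in>#M - {#b#}. \<psi> b \<le> \<psi> b')"
    proof (rule ccontr)
      assume "\<not> ?thesis"
      then have neg: "\<psi> b \<noteq> 0" "\<And>b'. b' \<in># M - {#b#} \<Longrightarrow> \<psi> b' < \<psi> b"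
        by auto
      have "\<forall>\<^sub>F k in sequentially. \<phi> k b' < \<phi> k b" if "b' \<in># M - {#b#}" for b'
        using order_tendstoD(1)[OF tendsto_diff[OF \<psi>[OF carr[OF M(2)]] \<psi>[OF carr[OF in_diffD[OF that]]]], of 0]
          neg(2)[OF that] by simp
      then have "\<forall>\<^sub>F k in sequentially. \<forall>b'\<in>set_mset (M - {#b#}). \<phi> k b' < \<phi> k b"
        by (intro eventually_ball_finite) auto
      moreover have "\<forall>\<^sub>F k in sequentially. \<phi> k b \<noteq> 0"
        using tendsto_imp_eventually_ne[OF \<psi>[OF carr[OF M(2)]] neg(1)] .
      ultimately have "\<forall>\<^sub>F k in sequentially. False"
      proof eventually_elim
        case (elim k)
        with hom[of k] M show False
          by (meson not_le)
      qed
      then show False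
        by simp
    qed
  qed
  moreover have "\<psi> (as ! i) = y i" if "i < length as" for i
  proof -
    have "as ! i \<in> carrier B"
      using gen that by (auto simp: generators_def)
    then show ?thesis
      using LIMSEQ_unique[OF \<psi> lim[OF that]] by blast
  qed
  ultimately show thesis
    by (rule that)
qed


section \<open>Residue fields of primes\<close>

text \<open>A fraction is the set of all pairs equivalent to \<open>(a, b)\<close>, so that equality
  of fractions is equality of sets. The \<open>THE\<close> in the operations below is justified by
  independence of representatives, shown in \<open>fraction_mult\<close> and
  \<open>fraction_add\<close>.\<close>

definition fraction :: "('a, 'm) ring_scheme \<Rightarrow> 'a \<Rightarrow> 'a \<Rightarrow> ('a \<times> 'a) set" where
  "fraction D a b = {(c, d). c \<in> carrier D \<and> d \<in> carrier D - {\<zero>\<^bsub>D\<^esub>} \<and> a \<otimes>\<^bsub>D\<^esub> d = c \<otimes>\<^bsub>D\<^esub> b}"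

definition fraction_field :: "('a, 'm) ring_scheme \<Rightarrow> ('a \<times> 'a) set ring" where
  "fraction_field D =
    \<lparr>carrier = {fraction D a b |a b. a \<in> carrier D \<and> b \<in> carrier D - {\<zero>\<^bsub>D\<^esub>}},
     mult = (\<lambda>x y. THE z. \<exists>a b c d. (a, b) \<in> x \<and> (c, d) \<in> y \<and> z = fraction D (a \<otimes>\<^bsub>D\<^esub> c) (b \<otimes>\<^bsub>D\<^esub> d)),
     one = fraction D \<one>\<^bsub>D\<^esub> \<one>\<^bsub>D\<^esub>, zero = fraction D \<zero>\<^bsub>D\<^esub> \<one>\<^bsub>D\<^esub>,
     add = (\<lambda>x y. THE z. \<exists>a b c d. (a, b) \<in> x \<and> (c, d) \<in> y \<and>
        z = fraction D (a \<otimes>\<^bsub>D\<^esub> d \<oplus>\<^bsub>D\<^esub> c \<otimes>\<^bsub>D\<^esub> b) (b \<otimes>\<^bsub>D\<^esub> d))\<rparr>"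

context "domain"
begin

abbreviation "denom \<equiv> carrier R - {\<zero>}"

lemma denom_mult: "b \<in> denom \<Longrightarrow> d \<in> denom \<Longrightarrow> b \<otimes> d \<in> denom"
  using integral by auto

lemma fraction_trans:
  assumes "a \<in> carrier R" "c \<in> carrier R" "e \<in> carrier R" "b \<in> denom" "d \<in> denom" "f \<in> denom"
    and "a \<otimes> d = c \<otimes> b" "c \<otimes> f = e \<otimes> d"
  shows "a \<otimes> f = e \<otimes> b"
proof -
  have "(a \<otimes> f) \<otimes> d = (a \<otimes> d) \<otimes> f"
    using assms(1-6) by (simp add: m_ac)
  also have "\<dots> = (c \<otimes> f) \<otimes> b"
    using assms(1-6) by (simp add: assms(7) m_ac)
  also have "\<dots> = (e \<otimes> b) \<otimes> d"
    using assms(1-6) by (simp add: assms(8) m_ac)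
  finally show ?thesis
    using assms(1-6) by (subst (asm) m_rcancel) auto
qed

lemma fraction_eq_iff:
  assumes "a \<in> carrier R" "c \<in> carrier R" "b \<in> denom" "d \<in> denom"
  shows "fraction R a b = fraction R c d \<longleftrightarrow> a \<otimes> d = c \<otimes> b"
proof
  assume "fraction R a b = fraction R c d"
  moreover have "(c, d) \<in> fraction R c d"
    using assms by (simp add: fraction_def)
  ultimately show "a \<otimes> d = c \<otimes> b"
    using assms by (auto simp: fraction_def)
next
  assume *: "a \<otimes> d = c \<otimes> b"
  have "a \<otimes> f = e \<otimes> b \<longleftrightarrow> c \<otimes> f = e \<otimes> d" if "e \<in> carrier R" "f \<in> denom" for e f
    using fraction_trans[OF assms(1,2) that(1) assms(3,4) that(2) *]
      fraction_trans[OF assms(2,1) that(1) assms(4,3) that(2) *[symmetric]] by blast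
  then show "fraction R a b = fraction R c d"
    unfolding fraction_def by blast
qed

lemma mem_fraction:
  assumes "a \<in> carrier R" "b \<in> denom" "(c, d) \<in> fraction R a b"
  shows "c \<in> carrier R" "d \<in> denom" "a \<otimes> d = c \<otimes> b"
  using assms by (auto simp: fraction_def)

lemma fraction_mult:
  assumes "a \<in> carrier R" "b \<in> denom" "c \<in> carrier R" "d \<in> denom"
  shows "fraction R a b \<otimes>\<^bsub>fraction_field R\<^esub> fraction R c d = fraction R (a \<otimes> c) (b \<otimes> d)"
proof -
  let ?P = "\<lambda>z. \<exists>a' b' c' d'. (a', b') \<in> fraction R a b \<and> (c', d') \<in> fraction R c d \<and>
    z = fraction R (a' \<otimes> c') (b' \<otimes> d')"
  have "z = fraction R (a \<otimes> c) (b \<otimes> d)" if P: "?P z" for z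
  proof -
    obtain a' b' c' d' where "(a', b') \<in> fraction R a b" "(c', d') \<in> fraction R c d"
        and z: "z = fraction R (a' \<otimes> c') (b' \<otimes> d')"
      using P by blast
    note m = mem_fraction[OF assms(1,2) this(1)] mem_fraction[OF assms(3,4) this(2)]
    have "(a' \<otimes> c') \<otimes> (b \<otimes> d) = (a' \<otimes> b) \<otimes> (c' \<otimes> d)"
      using assms m(1,2,4,5) by (simp add: m_ac)
    also have "\<dots> = (a \<otimes> c) \<otimes> (b' \<otimes> d')"
      using assms m(1,2,4,5) by (simp add: m(3,6)[symmetric] m_ac)
    finally show ?thesis
      unfolding z using assms m denom_mult by (subst fraction_eq_iff) auto
  qed
  moreover have "?P (fraction R (a \<otimes> c) (b \<otimes> d))"
    using assms by (intro exI[of _ a] exI[of _ b] exI[of _ c] exI[of _ d]) (simp add: fraction_def)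
  ultimately have "(THE z. ?P z) = fraction R (a \<otimes> c) (b \<otimes> d)"
    by (intro the_equality) blast+
  then show ?thesis
    by (simp add: fraction_field_def)
qed

lemma fraction_add:
  assumes "a \<in> carrier R" "b \<in> denom" "c \<in> carrier R" "d \<in> denom"
  shows "fraction R a b \<oplus>\<^bsub>fraction_field R\<^esub> fraction R c d = fraction R (a \<otimes> d \<oplus> c \<otimes> b) (b \<otimes> d)"
proof -
  let ?P = "\<lambda>z. \<exists>a' b' c' d'. (a', b') \<in> fraction R a b \<and> (c', d') \<in> fraction R c d \<and>
    z = fraction R (a' \<otimes> d' \<oplus> c' \<otimes> b') (b' \<otimes> d')"
  have "z = fraction R (a \<otimes> d \<oplus> c \<otimes> b) (b \<otimes> d)" if P: "?P z" for z
  proof -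
    obtain a' b' c' d' where "(a', b') \<in> fraction R a b" "(c', d') \<in> fraction R c d"
        and z: "z = fraction R (a' \<otimes> d' \<oplus> c' \<otimes> b') (b' \<otimes> d')"
      using P by blast
    note m = mem_fraction[OF assms(1,2) this(1)] mem_fraction[OF assms(3,4) this(2)]
    have "(a' \<otimes> d' \<oplus> c' \<otimes> b') \<otimes> (b \<otimes> d) = (a' \<otimes> b) \<otimes> (d \<otimes> d') \<oplus> (c' \<otimes> d) \<otimes> (b \<otimes> b')"
      using assms m(1,2,4,5) by (simp add: m_ac l_distr r_distr)
    also have "\<dots> = (a \<otimes> d \<oplus> c \<otimes> b) \<otimes> (b' \<otimes> d')"
      using assms m(1,2,4,5) by (simp add: m(3,6)[symmetric] m_ac l_distr r_distr)
    finally show ?thesis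
      unfolding z using assms m denom_mult by (subst fraction_eq_iff) auto
  qed
  moreover have "?P (fraction R (a \<otimes> d \<oplus> c \<otimes> b) (b \<otimes> d))"
    using assms by (intro exI[of _ a] exI[of _ b] exI[of _ c] exI[of _ d]) (simp add: fraction_def)
  ultimately have "(THE z. ?P z) = fraction R (a \<otimes> d \<oplus> c \<otimes> b) (b \<otimes> d)"
    by (intro the_equality) blast+
  then show ?thesis
    by (simp add: fraction_field_def)
qed

lemma fraction_simps:
  "carrier (fraction_field R) = {fraction R a b |a b. a \<in> carrier R \<and> b \<in> denom}"
  "\<one>\<^bsub>fraction_field R\<^esub> = fraction R \<one> \<one>" "\<zero>\<^bsub>fraction_field R\<^esub> = fraction R \<zero> \<one>"
  by (simp_all add: fraction_field_def)

lemma fraction_closed: "a \<in> carrier R \<Longrightarrow> b \<in> denom \<Longrightarrow> fraction R a b \<in> carrier (fraction_field R)"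
  by (auto simp: fraction_simps)

lemma fraction_cases:
  assumes "x \<in> carrier (fraction_field R)"
  obtains a b where "a \<in> carrier R" "b \<in> denom" "x = fraction R a b"
  using assms by (auto simp: fraction_simps)

lemma fraction_field_field: "field (fraction_field R)"
proof -
  let ?L = "fraction_field R"
  have one: "\<one> \<in> denom"
    by simp
  have "cring ?L"
  proof (intro cringI abelian_groupI comm_monoidI)
    fix x y assume "x \<in> carrier ?L" "y \<in> carrier ?L"
    then obtain a b c d where xy: "a \<in> carrier R" "b \<in> denom" "c \<in> carrier R" "d \<in> denom"
        "x = fraction R a b" "y = fraction R c d"
      by (elim fraction_cases)
    then show "x \<oplus>\<^bsub>?L\<^esub> y \<in> carrier ?L" "x \<otimes>\<^bsub>?L\<^esub> y \<in> carrier ?L"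
      using denom_mult by (auto simp: fraction_add fraction_mult intro!: fraction_closed)
    show "x \<oplus>\<^bsub>?L\<^esub> y = y \<oplus>\<^bsub>?L\<^esub> x" "x \<otimes>\<^bsub>?L\<^esub> y = y \<otimes>\<^bsub>?L\<^esub> x"
      using xy by (auto simp: fraction_add fraction_mult m_comm a_comm)
  next
    fix x y z assume "x \<in> carrier ?L" "y \<in> carrier ?L" "z \<in> carrier ?L"
    then obtain a b c d e f where xyz: "a \<in> carrier R" "b \<in> denom" "c \<in> carrier R" "d \<in> denom"
        "e \<in> carrier R" "f \<in> denom" "x = fraction R a b" "y = fraction R c d" "z = fraction R e f"
      by (elim fraction_cases)
    have bd: "b \<otimes> d \<in> denom" "d \<otimes> f \<in> denom" "b \<otimes> f \<in> denom"
      using xyz denom_mult by auto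
    show "(x \<oplus>\<^bsub>?L\<^esub> y) \<oplus>\<^bsub>?L\<^esub> z = x \<oplus>\<^bsub>?L\<^esub> (y \<oplus>\<^bsub>?L\<^esub> z)" "(x \<otimes>\<^bsub>?L\<^esub> y) \<otimes>\<^bsub>?L\<^esub> z = x \<otimes>\<^bsub>?L\<^esub> (y \<otimes>\<^bsub>?L\<^esub> z)"
      using xyz bd by (simp_all add: fraction_add fraction_mult l_distr r_distr m_ac a_ac)
    have "((a \<otimes> d \<oplus> c \<otimes> b) \<otimes> e) \<otimes> ((b \<otimes> f) \<otimes> (d \<otimes> f)) =
        ((a \<otimes> e) \<otimes> (d \<otimes> f) \<oplus> (c \<otimes> e) \<otimes> (b \<otimes> f)) \<otimes> ((b \<otimes> d) \<otimes> f)"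
      using xyz(1-6) by (simp add: l_distr r_distr m_ac)
    then show "(x \<oplus>\<^bsub>?L\<^esub> y) \<otimes>\<^bsub>?L\<^esub> z = x \<otimes>\<^bsub>?L\<^esub> z \<oplus>\<^bsub>?L\<^esub> y \<otimes>\<^bsub>?L\<^esub> z"
      using xyz bd denom_mult[OF bd(1) xyz(6)] denom_mult[OF bd(3,2)]
      by (simp add: fraction_add fraction_mult fraction_eq_iff)
  next
    fix x assume "x \<in> carrier ?L"
    then obtain a b where x: "a \<in> carrier R" "b \<in> denom" "x = fraction R a b"
      by (elim fraction_cases)
    then show "\<zero>\<^bsub>?L\<^esub> \<oplus>\<^bsub>?L\<^esub> x = x" "\<one>\<^bsub>?L\<^esub> \<otimes>\<^bsub>?L\<^esub> x = x"
      using one by (simp_all add: fraction_simps fraction_add fraction_mult)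
    have "fraction R (\<ominus> a) b \<oplus>\<^bsub>?L\<^esub> x = \<zero>\<^bsub>?L\<^esub>"
      using x one denom_mult[OF x(2,2)]
      by (simp add: fraction_simps fraction_add fraction_eq_iff flip: l_distr) (simp add: l_neg)
    then show "\<exists>y\<in>carrier ?L. y \<oplus>\<^bsub>?L\<^esub> x = \<zero>\<^bsub>?L\<^esub>"
      using x by (intro bexI[of _ "fraction R (\<ominus> a) b"] fraction_closed) auto
  qed (auto simp: fraction_simps(2,3) intro!: fraction_closed)
  then show ?thesis
  proof (rule cring.cring_fieldI2)
    show "\<zero>\<^bsub>?L\<^esub> \<noteq> \<one>\<^bsub>?L\<^esub>"
      by (simp add: fraction_simps fraction_eq_iff)
    fix x assume "x \<in> carrier ?L" "x \<noteq> \<zero>\<^bsub>?L\<^esub>"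
    moreover from this obtain a b where x: "a \<in> carrier R" "b \<in> denom" "x = fraction R a b"
      by (elim fraction_cases)
    ultimately have a: "a \<in> denom"
      by (auto simp: fraction_simps fraction_eq_iff)
    then have "x \<otimes>\<^bsub>?L\<^esub> fraction R b a = \<one>\<^bsub>?L\<^esub>"
      using x denom_mult by (auto simp: fraction_simps fraction_mult fraction_eq_iff m_comm)
    then show "\<exists>y\<in>carrier ?L. x \<otimes>\<^bsub>?L\<^esub> y = \<one>\<^bsub>?L\<^esub>"
      using a x by (intro bexI[of _ "fraction R b a"] fraction_closed) auto
  qed
qed

lemma fraction_hom: "(\<lambda>a. fraction R a \<one>) \<in> ring_hom R (fraction_field R)"
proof (rule ring_hom_memI)
  fix a assume "a \<in> carrier R"
  then show "fraction R a \<one> \<in> carrier (fraction_field R)"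
    by (intro fraction_closed) auto
qed (auto simp: fraction_mult fraction_add fraction_simps)

lemma fraction_eq_zero_iff: "a \<in> carrier R \<Longrightarrow> fraction R a \<one> = \<zero>\<^bsub>fraction_field R\<^esub> \<longleftrightarrow> a = \<zero>"
  by (simp add: fraction_simps fraction_eq_iff)

end

text \<open>\<open>L\<close> is the fraction field of the domain \<open>R Quot I\<close>, and
  \<open>I\<close> is exactly the kernel because a domain embeds into its fraction field.\<close>

lemma (in primeideal) residue_field_at_prime:
  obtains L :: "('a set \<times> 'a set) set ring" and \<theta> where "field L" "\<theta> \<in> ring_hom R L"
    "\<forall>x\<in>carrier R. \<theta> x = \<zero>\<^bsub>L\<^esub> \<longleftrightarrow> x \<in> I"
proof -
  interpret Q: "domain" "R Quot I"
    by (rule quotient_is_domain)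
  let ?L = "fraction_field (R Quot I)"
  let ?\<theta> = "(\<lambda>a. fraction (R Quot I) a \<one>\<^bsub>R Quot I\<^esub>) \<circ> (+>) I"
  have "?\<theta> \<in> ring_hom R ?L"
    using rcos_ring_hom Q.fraction_hom by (rule ring_hom_trans)
  moreover have "\<forall>x\<in>carrier R. ?\<theta> x = \<zero>\<^bsub>?L\<^esub> \<longleftrightarrow> x \<in> I"
  proof
    fix x assume that: "x \<in> carrier R"
    have "I +> x \<in> carrier (R Quot I)"
      using ring_hom_closed[OF rcos_ring_hom that] .
    moreover have "I +> x = I \<longleftrightarrow> x \<in> I"
      using that a_rcos_const rcos_const_imp_mem by blast
    ultimately show "?\<theta> x = \<zero>\<^bsub>?L\<^esub> \<longleftrightarrow> x \<in> I"
      by (simp add: Q.fraction_eq_zero_iff) (simp add: FactRing_def)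
  qed
  ultimately show thesis
    by (rule that[OF Q.fraction_field_field])
qed


section \<open>Extension of valuations\<close>

text \<open>The union over \<open>n\<close> is the set \<open>M[x]\<close> of polynomial values with
  all coefficients in \<open>M\<close>. The degree bound is kept as an index because the proof of
  Chevalley's theorem descends on it.\<close>

primrec poly_values :: "('a, 'm) ring_scheme \<Rightarrow> 'a set \<Rightarrow> 'a \<Rightarrow> nat \<Rightarrow> 'a set" where
  "poly_values R M x 0 = M"
| "poly_values R M x (Suc n) =
    {y \<oplus>\<^bsub>R\<^esub> a \<otimes>\<^bsub>R\<^esub> (x [^]\<^bsub>R\<^esub> Suc n) |y a. y \<in> poly_values R M x n \<and> a \<in> M}"

text \<open>Subrings without unit, stable under multiplication by \<open>S\<close>. The maximal ones turn out to be the
  maximal ideals of valuation rings; working with them instead of local subrings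
  avoids localization in Chevalley's extension theorem.\<close>

definition (in ring) nonunital :: "'a set \<Rightarrow> 'a set \<Rightarrow> bool" where
  "nonunital S M \<longleftrightarrow> M \<subseteq> carrier R \<and> \<zero> \<in> M \<and> \<one> \<notin> M \<and> (\<forall>x\<in>M. \<ominus> x \<in> M) \<and>
    (\<forall>x\<in>M. \<forall>y\<in>M. x \<oplus> y \<in> M) \<and> (\<forall>x\<in>M. \<forall>y\<in>M. x \<otimes> y \<in> M) \<and> (\<forall>s\<in>S. \<forall>x\<in>M. s \<otimes> x \<in> M)"

text \<open>For a maximal \<open>M\<close> this is the valuation ring belonging to
  \<open>M\<close>.\<close>

definition (in ring) multiplier :: "'a set \<Rightarrow> 'a set" where
  "multiplier M = {x \<in> carrier R. \<forall>y\<in>M. x \<otimes> y \<in> M}"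

context cring
begin

context
  fixes M :: "'a set" and x :: 'a
  assumes x: "x \<in> carrier R"
    and M: "M \<subseteq> carrier R" "\<zero> \<in> M" "\<And>a. a \<in> M \<Longrightarrow> \<ominus> a \<in> M"
      "\<And>a b. a \<in> M \<Longrightarrow> b \<in> M \<Longrightarrow> a \<oplus> b \<in> M" "\<And>a b. a \<in> M \<Longrightarrow> b \<in> M \<Longrightarrow> a \<otimes> b \<in> M"
begin

lemma poly_values_carrier: "poly_values R M x n \<subseteq> carrier R"
  by (induction n) (use x M(1) in auto)

lemma poly_values_zero: "\<zero> \<in> poly_values R M x n"
proof (induction n)
  case (Suc n)
  have "\<zero> = \<zero> \<oplus> \<zero> \<otimes> (x [^] Suc n)"
    using x by simp
  then show ?case
    using Suc M(2) by auto
qed (simp add: M)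

lemma poly_values_mono: "m \<le> n \<Longrightarrow> poly_values R M x m \<subseteq> poly_values R M x n"
proof (induction n rule: nat_induct_at_least)
  case (Suc n)
  have "y \<in> poly_values R M x (Suc n)" if "y \<in> poly_values R M x n" for y
  proof -
    have "y = y \<oplus> \<zero> \<otimes> (x [^] Suc n)"
      using that poly_values_carrier x by (auto simp: subset_iff)
    then show ?thesis
      using that M(2) by auto
  qed
  with Suc show ?case
    by blast
qed simp

lemma poly_values_monom:
  assumes "a \<in> M" "i \<le> n"
  shows "a \<otimes> (x [^] i) \<in> poly_values R M x n"
proof -
  have "a \<otimes> (x [^] i) \<in> poly_values R M x i"
  proof (cases i)
    case (Suc j)
    have "a \<otimes> (x [^] i) = \<zero> \<oplus> a \<otimes> (x [^] Suc j)"
      using Suc assms M(1) x by auto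
    then show ?thesis
      using Suc poly_values_zero assms(1) by auto
  qed (use assms M(1) in auto)
  then show ?thesis
    using poly_values_mono[OF assms(2)] by blast
qed

lemma poly_values_add:
  "y \<in> poly_values R M x n \<Longrightarrow> z \<in> poly_values R M x n \<Longrightarrow> y \<oplus> z \<in> poly_values R M x n"
proof (induction n arbitrary: y z)
  case (Suc n)
  then obtain y' a z' b where yz: "y' \<in> poly_values R M x n" "z' \<in> poly_values R M x n" "a \<in> M" "b \<in> M"
    "y = y' \<oplus> a \<otimes> (x [^] Suc n)" "z = z' \<oplus> b \<otimes> (x [^] Suc n)"
    by auto
  have c: "y' \<in> carrier R" "z' \<in> carrier R" "a \<in> carrier R" "b \<in> carrier R" "x [^] Suc n \<in> carrier R"
    using yz poly_values_carrier M(1) x by auto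
  then have "y \<oplus> z = (y' \<oplus> z') \<oplus> (a \<oplus> b) \<otimes> (x [^] Suc n)"
    unfolding yz(5,6) by (simp add: l_distr a_ac)
  then show ?case
    using Suc.IH[OF yz(1,2)] M(4)[OF yz(3,4)] by auto
qed (simp add: M)

lemma poly_values_smult:
  assumes s: "s \<in> carrier R" "\<And>a. a \<in> M \<Longrightarrow> s \<otimes> a \<in> M"
  shows "y \<in> poly_values R M x n \<Longrightarrow> s \<otimes> y \<in> poly_values R M x n"
proof (induction n arbitrary: y)
  case (Suc n)
  then obtain y' a where y: "y' \<in> poly_values R M x n" "a \<in> M" "y = y' \<oplus> a \<otimes> (x [^] Suc n)"
    by auto
  have "y' \<in> carrier R" "a \<in> carrier R" "x [^] Suc n \<in> carrier R"
    using y poly_values_carrier M(1) x by auto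
  then have "s \<otimes> y = s \<otimes> y' \<oplus> (s \<otimes> a) \<otimes> (x [^] Suc n)"
    unfolding y(3) using s(1) by (simp add: r_distr m_assoc)
  then show ?case
    using Suc.IH[OF y(1)] s(2)[OF y(2)] by auto
qed (simp add: s)

lemma poly_values_neg: "y \<in> poly_values R M x n \<Longrightarrow> \<ominus> y \<in> poly_values R M x n"
  using poly_values_smult[of "\<ominus> \<one>" y n] M(1,3) poly_values_carrier[of n] by (auto simp: l_minus subset_iff)

lemma poly_values_shift:
  "y \<in> poly_values R M x n \<Longrightarrow> (x [^] j) \<otimes> y \<in> poly_values R M x (n + j)"
proof (induction n arbitrary: y)
  case 0
  then show ?case
    using poly_values_monom[of y j j] M(1) x by (auto simp: m_comm)
next
  case (Suc n)
  then obtain y' a where y: "y' \<in> poly_values R M x n" "a \<in> M" "y = y' \<oplus> a \<otimes> (x [^] Suc n)"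
    by auto
  have "y' \<in> carrier R" "a \<in> carrier R" "x [^] Suc n \<in> carrier R" "x [^] j \<in> carrier R"
    using y poly_values_carrier M(1) x by auto
  then have "(x [^] j) \<otimes> y = (x [^] j) \<otimes> y' \<oplus> a \<otimes> ((x [^] Suc n) \<otimes> (x [^] j))"
    unfolding y(3) by (simp add: r_distr m_ac)
  also have "(x [^] Suc n) \<otimes> (x [^] j) = x [^] Suc (n + j)"
    using x by (simp only: nat_pow_mult add_Suc)
  finally show ?case
    using Suc.IH[OF y(1)] y(2) by auto
qed

lemma poly_values_mult:
  "y \<in> poly_values R M x n \<Longrightarrow> z \<in> poly_values R M x m \<Longrightarrow> y \<otimes> z \<in> poly_values R M x (n + m)"
proof (induction n arbitrary: y)
  case 0
  then show ?case
    using poly_values_smult[of y z m] M(1,5) by auto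
next
  case (Suc n)
  then obtain y' a where y: "y' \<in> poly_values R M x n" "a \<in> M" "y = y' \<oplus> a \<otimes> (x [^] Suc n)"
    by auto
  have "y' \<in> carrier R" "a \<in> carrier R" "x [^] Suc n \<in> carrier R" "z \<in> carrier R"
    using y poly_values_carrier M(1) x Suc.prems(2) by auto
  then have "y \<otimes> z = y' \<otimes> z \<oplus> a \<otimes> ((x [^] Suc n) \<otimes> z)"
    unfolding y(3) by (simp add: l_distr m_assoc)
  moreover have "a \<otimes> ((x [^] Suc n) \<otimes> z) \<in> poly_values R M x (m + Suc n)"
    using y(2) M(1,5) by (intro poly_values_smult poly_values_shift Suc.prems(2)) auto
  moreover have "y' \<otimes> z \<in> poly_values R M x (m + Suc n)"
    using Suc.IH[OF y(1) Suc.prems(2)] poly_values_mono[of "n + m" "m + Suc n"] by auto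
  ultimately have "y \<otimes> z \<in> poly_values R M x (m + Suc n)"
    by (simp only: poly_values_add)
  then show ?case
    by (simp only: add.commute)
qed

end

section \<open>Maximal nonunital subrings and Chevalley's theorem\<close>

lemma nonunitalD:
  assumes "nonunital S M"
  shows "M \<subseteq> carrier R" "\<zero> \<in> M" "\<one> \<notin> M" "\<And>a. a \<in> M \<Longrightarrow> \<ominus> a \<in> M"
    "\<And>a b. a \<in> M \<Longrightarrow> b \<in> M \<Longrightarrow> a \<oplus> b \<in> M" "\<And>a b. a \<in> M \<Longrightarrow> b \<in> M \<Longrightarrow> a \<otimes> b \<in> M"
    "\<And>s a. s \<in> S \<Longrightarrow> a \<in> M \<Longrightarrow> s \<otimes> a \<in> M"
  using assms by (auto simp: nonunital_def)

text \<open>The only obstruction to \<open>M[x]\<close> being nonunital again is that it may contain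
  \<open>\<one>\<close>. For a maximal \<open>M\<close> this gives a dichotomy: either
  \<open>x\<close> multiplies \<open>M\<close> into itself, or \<open>\<one>\<close> is a polynomial
  value.\<close>

lemma nonunital_poly_values:
  assumes M: "nonunital S M" and "S \<subseteq> carrier R" and x: "x \<in> carrier R"
    and one: "\<And>n. \<one> \<notin> poly_values R M x n"
  shows "nonunital S (\<Union>n. poly_values R M x n)"
proof -
  note M' = nonunitalD(1,2,4-6)[OF M]
  have le: "poly_values R M x n \<subseteq> poly_values R M x (n + m)"
    "poly_values R M x m \<subseteq> poly_values R M x (n + m)" for n m
    by (rule poly_values_mono[OF x M']; simp)+
  let ?E = "\<Union>n. poly_values R M x n"
  show ?thesis
    unfolding nonunital_def
  proof (intro conjI ballI)
    show "?E \<subseteq> carrier R"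
      using poly_values_carrier[OF x M'] by (rule UN_least)
    show "\<zero> \<in> ?E"
      using poly_values_zero[OF x M'] by (rule UN_I[OF UNIV_I])
    show "\<one> \<notin> ?E"
      using one by simp
  next
    fix y assume "y \<in> ?E"
    then show "\<ominus> y \<in> ?E"
      by (elim UN_E) (intro UN_I[OF UNIV_I] poly_values_neg[OF x M'])
  next
    fix y z assume "y \<in> ?E" "z \<in> ?E"
    then obtain n m where yz: "y \<in> poly_values R M x n" "z \<in> poly_values R M x m"
      by (elim UN_E)
    show "y \<oplus> z \<in> ?E"
      using yz le(1)[of n m] le(2)[of m n] by (intro UN_I[OF UNIV_I, of _ _ "n + m"] poly_values_add[OF x M']) auto
    show "y \<otimes> z \<in> ?E"
      using poly_values_mult[OF x M' yz] by (rule UN_I[OF UNIV_I])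
  next
    fix s y assume s: "s \<in> S" and "y \<in> ?E"
    then obtain n where "y \<in> poly_values R M x n"
      by (elim UN_E)
    then have "s \<otimes> y \<in> poly_values R M x n"
      using assms(2) s by (intro poly_values_smult[OF x M'] nonunitalD(7)[OF M]) auto
    then show "s \<otimes> y \<in> ?E"
      by (rule UN_I[OF UNIV_I])
  qed
qed

text \<open>Each closure condition involves at most two elements of the set, and these lie in a
  common member of a chain, so Zorn's lemma applies.\<close>

lemma nonunital_maximal_exists:
  assumes "nonunital S M\<^sub>0"
  obtains M where "nonunital S M" "M\<^sub>0 \<subseteq> M" "\<And>M'. nonunital S M' \<Longrightarrow> M \<subseteq> M' \<Longrightarrow> M' = M"
proof -
  let ?A = "{M. nonunital S M \<and> M\<^sub>0 \<subseteq> M}"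
  have "\<exists>M\<in>?A. \<forall>N\<in>?A. M \<subseteq> N \<longrightarrow> N = M"
  proof (rule subset_Zorn_nonempty)
    show "?A \<noteq> {}"
      using assms by blast
    fix C assume C: "C \<noteq> {}" "subset.chain ?A C"
    then have sub: "C \<subseteq> ?A" and lin: "\<And>N Y. N \<in> C \<Longrightarrow> Y \<in> C \<Longrightarrow> N \<subseteq> Y \<or> Y \<subseteq> N"
      by (auto simp: subset_chain_def)
    have two: "\<exists>Z\<in>C. y \<in> Z \<and> z \<in> Z" if "y \<in> \<Union>C" "z \<in> \<Union>C" for y z
      using that lin by blast
    have D: "nonunital S N" if "N \<in> C" for N
      using sub that by blast
    have "y \<oplus> z \<in> \<Union>C \<and> y \<otimes> z \<in> \<Union>C" if "y \<in> \<Union>C" "z \<in> \<Union>C" for y z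
      using two[OF that] nonunitalD(5,6)[OF D] by blast
    moreover have "\<ominus> y \<in> \<Union>C" "y \<in> carrier R" if "y \<in> \<Union>C" for y
      using that nonunitalD(1,4)[OF D] by blast+
    moreover have "s \<otimes> y \<in> \<Union>C" if "s \<in> S" "y \<in> \<Union>C" for s y
      using that nonunitalD(7)[OF D] by blast
    moreover have "\<zero> \<in> \<Union>C" "\<one> \<notin> \<Union>C"
      using C(1) nonunitalD(2,3)[OF D] by blast+
    moreover have "M\<^sub>0 \<subseteq> \<Union>C"
      using C(1) sub by blast
    ultimately show "\<Union>C \<in> ?A"
      by (simp add: nonunital_def subset_iff)
  qed
  then obtain M where "M \<in> ?A" and max: "\<forall>N\<in>?A. M \<subseteq> N \<longrightarrow> N = M"
    by (rule bexE)
  show thesis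
  proof (rule that)
    show "nonunital S M" "M\<^sub>0 \<subseteq> M"
      using \<open>M \<in> ?A\<close> by simp_all
    then show "M' = M" if "nonunital S M'" "M \<subseteq> M'" for M'
      using max that by auto
  qed
qed

end

context field
begin

lemma inv_nonzero: "x \<in> carrier R - {\<zero>} \<Longrightarrow> inv x \<in> carrier R - {\<zero>}"
  using field_Units Units_inv_Units by blast

lemma r_inv_nonzero: "x \<in> carrier R - {\<zero>} \<Longrightarrow> x \<otimes> inv x = \<one>"
  by (simp add: field_Units)

lemma l_inv_nonzero: "x \<in> carrier R - {\<zero>} \<Longrightarrow> inv x \<otimes> x = \<one>"
  by (simp add: field_Units)

lemma pow_nonzero: "x \<in> carrier R - {\<zero>} \<Longrightarrow> x [^] (n::nat) \<in> carrier R - {\<zero>}"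
  by (induction n) (auto simp: integral_iff)

text \<open>Split off the constant coefficient \<open>v\<close> of a polynomial in
  \<open>inv x\<close>. The rest \<open>z\<close> contains only the powers
  \<open>inv x [^] j\<close> with \<open>1 \<le> j \<le> m\<close>, and multiplication by
  \<open>x [^] n\<close> turns them into powers of \<open>x\<close> of exponent at most
  \<open>n - 1\<close>.\<close>

lemma poly_values_inv_split:
  assumes M: "nonunital S M" and x: "x \<in> carrier R - {\<zero>}"
  shows "w \<in> poly_values R M (inv x) m \<Longrightarrow>
    \<exists>v\<in>M. \<exists>z\<in>carrier R. w = v \<oplus> z \<and>
      (\<forall>n. m \<le> n \<longrightarrow> 0 < n \<longrightarrow> z \<otimes> (x [^] n) \<in> poly_values R M x (n - 1))"
proof (induction m arbitrary: w)
  case 0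
  have "w = w \<oplus> \<zero>"
    using 0 nonunitalD(1)[OF M] by auto
  moreover have "\<zero> \<otimes> (x [^] n) \<in> poly_values R M x (n - 1)" for n :: nat
    using poly_values_zero[of x M] x nonunitalD[OF M] by simp
  ultimately show ?case
    using 0 by auto
next
  case (Suc m)
  then obtain y a where y: "y \<in> poly_values R M (inv x) m" "a \<in> M" "w = y \<oplus> a \<otimes> (inv x [^] Suc m)"
    by auto
  obtain v z where vz: "v \<in> M" "z \<in> carrier R" "y = v \<oplus> z"
    "\<And>n. m \<le> n \<Longrightarrow> 0 < n \<Longrightarrow> z \<otimes> (x [^] n) \<in> poly_values R M x (n - 1)"
    using Suc.IH[OF y(1)] by blast
  have c: "a \<in> carrier R" "v \<in> carrier R" "inv x [^] Suc m \<in> carrier R"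
    using y vz nonunitalD(1)[OF M] inv_nonzero[OF x] by auto
  define z' where "z' = z \<oplus> a \<otimes> (inv x [^] Suc m)"
  have "z' \<otimes> (x [^] n) \<in> poly_values R M x (n - 1)" if n: "Suc m \<le> n" for n
  proof -
    have "(inv x [^] Suc m) \<otimes> (x [^] n) = (inv x [^] Suc m) \<otimes> ((x [^] Suc m) \<otimes> (x [^] (n - Suc m)))"
      using nat_pow_mult[of x "Suc m" "n - Suc m"] x n by simp
    also have "\<dots> = ((inv x \<otimes> x) [^] Suc m) \<otimes> (x [^] (n - Suc m))"
      using x inv_nonzero[OF x] by (subst nat_pow_distrib) (auto simp: m_assoc)
    also have "\<dots> = x [^] (n - Suc m)"
      using x by (subst l_inv_nonzero) auto
    finally have "z' \<otimes> (x [^] n) = z \<otimes> (x [^] n) \<oplus> a \<otimes> (x [^] (n - Suc m))"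
      unfolding z'_def using c vz x by (subst l_distr) (auto simp: m_assoc)
    moreover have "z \<otimes> (x [^] n) \<in> poly_values R M x (n - 1)"
      using vz(4) n by simp
    moreover have "a \<otimes> (x [^] (n - Suc m)) \<in> poly_values R M x (n - 1)"
      using x nonunitalD[OF M] y(2) n by (intro poly_values_monom) auto
    ultimately show ?thesis
      using poly_values_add[of x M] x nonunitalD[OF M] by auto
  qed
  moreover have "w = v \<oplus> z'" "z' \<in> carrier R"
    using y vz c by (auto simp: z'_def a_assoc)
  ultimately show ?case
    using vz(1) by auto
qed

text \<open>The degree descent. From \<open>\<one> = y + u x^(n+1)\<close> and
  \<open>\<one> = v + z\<close> one gets \<open>\<one> = v + z y + u (z x^(n+1))\<close>, where
  \<open>z y = y - v y\<close> and \<open>z x^(n+1)\<close> has degree at most \<open>n\<close>. The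
  usual argument divides by \<open>1 - v\<close>, a unit of a local ring; here one multiplies by
  \<open>z = 1 - v\<close> instead, so no inverse is required.\<close>

lemma poly_values_one_lower:
  assumes M: "nonunital S M" and x: "x \<in> carrier R - {\<zero>}"
    and "\<one> \<in> poly_values R M x (Suc n)" "\<one> \<in> poly_values R M (inv x) m" "m \<le> Suc n"
  shows "\<one> \<in> poly_values R M x n"
proof -
  note M' = nonunitalD(1,2,4-6)[OF M]
  have xc: "x \<in> carrier R"
    using x by simp
  obtain y u where y: "y \<in> poly_values R M x n" "u \<in> M" "\<one> = y \<oplus> u \<otimes> (x [^] Suc n)"
    using assms(3) by auto
  obtain v z where vz: "v \<in> M" "z \<in> carrier R" "\<one> = v \<oplus> z"
    "z \<otimes> (x [^] Suc n) \<in> poly_values R M x n"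
    using poly_values_inv_split[OF M x assms(4)] assms(5) by force
  let ?q = "z \<otimes> (x [^] Suc n)"
  have c: "y \<in> carrier R" "u \<in> carrier R" "v \<in> carrier R" "x [^] Suc n \<in> carrier R"
    using y vz M'(1) poly_values_carrier[OF xc M'] xc by auto
  have z: "z = \<one> \<oplus> \<ominus> v"
    using c vz(2,3) r_neg1[of v z] by (simp add: a_comm)
  have "\<one> = v \<oplus> z \<otimes> (y \<oplus> u \<otimes> (x [^] Suc n))"
    by (simp only: y(3)[symmetric] r_one[OF vz(2)] vz(3)[symmetric])
  also have "\<dots> = v \<oplus> (z \<otimes> y \<oplus> u \<otimes> ?q)"
    using c vz(2) by (simp add: r_distr m_ac)
  also have "z \<otimes> y = y \<oplus> \<ominus> (v \<otimes> y)"
    unfolding z using c by (simp add: l_distr l_minus)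
  finally have eq: "\<one> = v \<oplus> ((y \<oplus> \<ominus> (v \<otimes> y)) \<oplus> u \<otimes> ?q)" .
  have "v \<in> poly_values R M x n"
    using poly_values_mono[OF xc M', of 0 n] vz(1) by auto
  moreover have "v \<otimes> y \<in> poly_values R M x n" "u \<otimes> ?q \<in> poly_values R M x n"
    using y vz c M'(5) by (auto intro!: poly_values_smult[OF xc M'])
  ultimately show ?thesis
    using y(1) by (subst eq) (intro poly_values_add[OF xc M'] poly_values_neg[OF xc M'])
qed

text \<open>If neither \<open>x\<close> nor \<open>inv x\<close> multiplies a maximal
  \<open>M\<close> into itself, then \<open>\<one>\<close> is a polynomial value over
  \<open>M\<close> at both. Of the two least degrees, both positive because \<open>\<one>\<close> is
  not in \<open>M\<close>, one that is at least the other can be lowered by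
  \<open>poly_values_one_lower\<close>.\<close>

theorem nonunital_valuation_exists:
  assumes "nonunital S M\<^sub>0" and S: "S \<subseteq> carrier R"
  obtains M where "nonunital S M" "M\<^sub>0 \<subseteq> M"
    "\<And>x. x \<in> carrier R - {\<zero>} \<Longrightarrow> x \<in> multiplier M \<or> inv x \<in> multiplier M"
proof -
  obtain M where M: "nonunital S M" "M\<^sub>0 \<subseteq> M"
    and max: "\<And>M'. nonunital S M' \<Longrightarrow> M \<subseteq> M' \<Longrightarrow> M' = M"
    using nonunital_maximal_exists[OF assms(1)] by blast
  note M' = nonunitalD(1,2,4-6)[OF M(1)]
  have one: "\<exists>n. \<one> \<in> poly_values R M x n" if x: "x \<in> carrier R" "x \<notin> multiplier M" for x
  proof (rule ccontr)
    assume "\<nexists>n. \<one> \<in> poly_values R M x n"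
    then have "nonunital S (\<Union>n. poly_values R M x n)"
      using nonunital_poly_values[OF M(1) S x(1)] by blast
    moreover have "M \<subseteq> (\<Union>n. poly_values R M x n)"
      using poly_values.simps(1)[of R M x] by (intro subsetI UN_I[OF UNIV_I, of _ _ 0]) simp
    ultimately have eq: "(\<Union>n. poly_values R M x n) = M"
      by (rule max)
    have "x \<otimes> y \<in> M" if "y \<in> M" for y
    proof -
      have "x \<otimes> y = y \<otimes> (x [^] (1::nat))"
        using that M'(1) x(1) by (auto simp: m_comm)
      then have "x \<otimes> y \<in> poly_values R M x 1"
        using poly_values_monom[OF x(1) M' that, of 1 1] by simp
      with eq show ?thesis
        by blast
    qed
    with x show False
      by (simp add: multiplier_def)
  qed
  have "x \<in> multiplier M \<or> inv x \<in> multiplier M" if x: "x \<in> carrier R - {\<zero>}" for x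
  proof (rule ccontr)
    assume neg: "\<not> ?thesis"
    note ix = inv_nonzero[OF x]
    have ex: "\<exists>n. \<one> \<in> poly_values R M x n" "\<exists>n. \<one> \<in> poly_values R M (inv x) n"
      using one x ix neg by auto
    define n where "n = (LEAST n. \<one> \<in> poly_values R M x n)"
    define m where "m = (LEAST n. \<one> \<in> poly_values R M (inv x) n)"
    have n: "\<one> \<in> poly_values R M x n" "\<one> \<in> poly_values R M (inv x) m"
      unfolding n_def m_def by (rule LeastI_ex[OF ex(1)], rule LeastI_ex[OF ex(2)])
    have pos: "n \<noteq> 0" "m \<noteq> 0"
      using n nonunitalD(3)[OF M(1)] by (metis poly_values.simps(1))+
    show False
    proof (cases "m \<le> n")
      case True
      then have "\<one> \<in> poly_values R M x (n - 1)"
        using poly_values_one_lower[OF M(1) x, of "n - 1" m] n pos by simp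
      then show False
        using Least_le[of "\<lambda>n. \<one> \<in> poly_values R M x n" "n - 1"] pos by (simp add: n_def)
    next
      case False
      have "inv (inv x) = x"
        using x by (simp add: field_Units)
      with False have "\<one> \<in> poly_values R M (inv x) (m - 1)"
        using poly_values_one_lower[OF M(1) ix, of "m - 1" n] n pos by simp
      then show False
        using Least_le[of "\<lambda>n. \<one> \<in> poly_values R M (inv x) n" "m - 1"] pos by (simp add: m_def)
    qed
  qed
  with M show thesis
    by (rule that)
qed

end


section \<open>Monomials and algebraic independence\<close>

text \<open>\<open>power_prod\<close> reads only the entries in \<open>I\<close>; fixing the others
  at 0 keeps a finite set of exponents from listing the same monomial twice.\<close>

definition exponents :: "nat set \<Rightarrow> (nat \<Rightarrow> nat) set" where
  "exponents I = {e. \<forall>i. i \<notin> I \<longrightarrow> e i = 0}"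

definition power_prod :: "('a, 'm) ring_scheme \<Rightarrow> (nat \<Rightarrow> 'a) \<Rightarrow> nat set \<Rightarrow> (nat \<Rightarrow> nat) \<Rightarrow> 'a" where
  "power_prod R u I e = (\<Otimes>\<^bsub>R\<^esub>i\<in>I. u i [^]\<^bsub>R\<^esub> e i)"

text \<open>Independence modulo \<open>P\<close>. Phrased with membership in \<open>P\<close>, the
  same notion serves for several primes of one ring and, with \<open>{\<zero>}\<close>, for their
  residue fields.\<close>

definition alg_independent ::
    "('a, 'm) ring_scheme \<Rightarrow> 'a set \<Rightarrow> 'a set \<Rightarrow> (nat \<Rightarrow> 'a) \<Rightarrow> nat set \<Rightarrow> bool" where
  "alg_independent R P k u I \<longleftrightarrow>
    (\<forall>E c. finite E \<longrightarrow> E \<subseteq> exponents I \<longrightarrow> c \<in> E \<rightarrow> k \<longrightarrow>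
      (\<Oplus>\<^bsub>R\<^esub>e\<in>E. c e \<otimes>\<^bsub>R\<^esub> power_prod R u I e) \<in> P \<longrightarrow> (\<forall>e\<in>E. c e = \<zero>\<^bsub>R\<^esub>))"

lemma alg_independentD:
  assumes "alg_independent R P k u I" "finite E" "E \<subseteq> exponents I" "c \<in> E \<rightarrow> k"
    and "(\<Oplus>\<^bsub>R\<^esub>e\<in>E. c e \<otimes>\<^bsub>R\<^esub> power_prod R u I e) \<in> P" "e \<in> E"
  shows "c e = \<zero>\<^bsub>R\<^esub>"
  using assms unfolding alg_independent_def by simp

text \<open>The predicate \<open>\<Phi>\<close> restricts the exponents: a lower bound on the weight
  in the construction of valuations, no restriction for the full polynomial ring. Terms may repeat
  an exponent, which makes the closure properties simple inductions; \<open>poly_span_finsum\<close>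
  collects them.\<close>

inductive_set poly_span ::
    "('a, 'm) ring_scheme \<Rightarrow> 'a set \<Rightarrow> (nat \<Rightarrow> 'a) \<Rightarrow> nat set \<Rightarrow> ((nat \<Rightarrow> nat) \<Rightarrow> bool) \<Rightarrow> 'a set"
  for R k u I \<Phi> where
  zero: "\<zero>\<^bsub>R\<^esub> \<in> poly_span R k u I \<Phi>"
| add: "x \<in> poly_span R k u I \<Phi> \<Longrightarrow> c \<in> k \<Longrightarrow> e \<in> exponents I \<Longrightarrow> \<Phi> e \<Longrightarrow>
    c \<otimes>\<^bsub>R\<^esub> power_prod R u I e \<oplus>\<^bsub>R\<^esub> x \<in> poly_span R k u I \<Phi>"

lemma exponents_add: "e \<in> exponents I \<Longrightarrow> f \<in> exponents I \<Longrightarrow> (\<lambda>i. e i + f i) \<in> exponents I"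
  by (simp add: exponents_def)

lemma exponents_zero: "(\<lambda>_. 0) \<in> exponents I"
  by (simp add: exponents_def)

context cring
begin

lemma power_prod_closed [intro, simp]: "u \<in> I \<rightarrow> carrier R \<Longrightarrow> power_prod R u I e \<in> carrier R"
  unfolding power_prod_def by (intro finprod_closed) auto

lemma power_prod_zero: "u \<in> I \<rightarrow> carrier R \<Longrightarrow> power_prod R u I (\<lambda>_. 0) = \<one>"
  unfolding power_prod_def by (intro finprod_one_eqI) auto

lemma power_prod_add:
  assumes "u \<in> I \<rightarrow> carrier R"
  shows "power_prod R u I (\<lambda>i. e i + f i) = power_prod R u I e \<otimes> power_prod R u I f"
proof -
  have "power_prod R u I (\<lambda>i. e i + f i) = (\<Otimes>i\<in>I. (u i [^] e i) \<otimes> (u i [^] f i))"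
    unfolding power_prod_def using assms
    by (intro finprod_cong') (auto simp: nat_pow_mult Pi_iff)
  also have "\<dots> = power_prod R u I e \<otimes> power_prod R u I f"
    unfolding power_prod_def using assms by (intro finprod_multf) auto
  finally show ?thesis .
qed

lemma power_prod_insert:
  assumes "finite I" "i \<notin> I" "u \<in> insert i I \<rightarrow> carrier R"
  shows "power_prod R u (insert i I) e = (u i [^] e i) \<otimes> power_prod R u I e"
  unfolding power_prod_def using assms by (subst finprod_insert) auto

lemma power_prod_cong:
  assumes "u \<in> I \<rightarrow> carrier R" "\<And>i. i \<in> I \<Longrightarrow> e i = f i"
  shows "power_prod R u I e = power_prod R u I f"
  unfolding power_prod_def using assms by (intro finprod_cong') auto

lemma power_prod_single:
  assumes "finite I" "i \<in> I" "u \<in> I \<rightarrow> carrier R"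
  shows "power_prod R u I (\<lambda>j. if j = i then n else 0) = u i [^] n"
proof -
  have "power_prod R u I (\<lambda>j. if j = i then n else 0) = (\<Otimes>j\<in>I. if i = j then u j [^] n else \<one>)"
    unfolding power_prod_def using assms by (intro finprod_cong') (auto simp: Pi_iff)
  also have "\<dots> = u i [^] n"
    using assms by (intro finprod_singleton) (auto simp: Pi_iff)
  finally show ?thesis .
qed

context
  fixes k :: "'a set" and u :: "nat \<Rightarrow> 'a" and I :: "nat set"
  assumes k: "subring k R" and u: "u \<in> I \<rightarrow> carrier R"
begin

lemma k_carrier: "c \<in> k \<Longrightarrow> c \<in> carrier R"
  using subringE(1)[OF k] by blast

lemma poly_span_carrier: "poly_span R k u I \<Phi> \<subseteq> carrier R"
proof
  fix x assume "x \<in> poly_span R k u I \<Phi>"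
  then show "x \<in> carrier R"
    by induction (use k_carrier u in auto)
qed

lemma poly_span_finsum:
  assumes "x \<in> poly_span R k u I \<Phi>"
  obtains E c where "finite E" "E \<subseteq> exponents I" "\<And>e. e \<in> E \<Longrightarrow> \<Phi> e" "c \<in> E \<rightarrow> k"
    "x = (\<Oplus>e\<in>E. c e \<otimes> power_prod R u I e)"
  using assms
proof (induction arbitrary: thesis)
  case zero
  show ?case
    by (rule zero[of "{}"]) auto
next
  case (add x d f)
  obtain E c where E: "finite E" "E \<subseteq> exponents I" "\<And>e. e \<in> E \<Longrightarrow> \<Phi> e" and c: "c \<in> E \<rightarrow> k"
    and x: "x = (\<Oplus>e\<in>E. c e \<otimes> power_prod R u I e)"
    using add.IH by blast
  \<comment> \<open>If the exponent \<open>f\<close> already occurs, the new coefficient is added to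
    the old one, so that the exponents remain a set.\<close>
  define c' where "c' = c(f := d \<oplus> (if f \<in> E then c f else \<zero>))"
  have c': "c' \<in> insert f E \<rightarrow> k"
    using c add.hyps subringE(2,7)[OF k] by (auto simp: c'_def Pi_iff)
  have cc: "c \<in> E \<rightarrow> carrier R" "c' \<in> insert f E \<rightarrow> carrier R" "d \<in> carrier R"
    using c c' add.hyps k_carrier by auto
  let ?m = "power_prod R u I"
  have m: "?m e \<in> carrier R" for e
    using u by simp
  have rest: "(\<Oplus>e\<in>E - {f}. c' e \<otimes> ?m e) = (\<Oplus>e\<in>E - {f}. c e \<otimes> ?m e)"
    using cc m by (intro finsum_cong') (auto simp: c'_def)
  have "(\<Oplus>e\<in>insert f E. c' e \<otimes> ?m e) = (\<Oplus>e\<in>insert f (E - {f}). c' e \<otimes> ?m e)"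
    by simp
  also have "\<dots> = c' f \<otimes> ?m f \<oplus> (\<Oplus>e\<in>E - {f}. c e \<otimes> ?m e)"
    using E(1) cc m by (subst finsum_insert) (auto simp: rest Pi_iff)
  also have "\<dots> = d \<otimes> ?m f \<oplus> x"
  proof (cases "f \<in> E")
    case True
    have S: "(\<Oplus>e\<in>E - {f}. c e \<otimes> ?m e) \<in> carrier R"
      using cc m by (intro finsum_closed) auto
    have "x = (\<Oplus>e\<in>insert f (E - {f}). c e \<otimes> ?m e)"
      unfolding x using True by (simp add: insert_absorb)
    also have "\<dots> = c f \<otimes> ?m f \<oplus> (\<Oplus>e\<in>E - {f}. c e \<otimes> ?m e)"
      using E(1) cc m True by (subst finsum_insert) auto
    finally show ?thesis
      using True cc m S by (auto simp: c'_def l_distr a_assoc Pi_iff)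
  next
    case False
    then show ?thesis
      using cc x by (simp add: c'_def)
  qed
  finally have "d \<otimes> ?m f \<oplus> x = (\<Oplus>e\<in>insert f E. c' e \<otimes> ?m e)" ..
  then show ?case
    using add.prems[of "insert f E" c'] E add.hyps c' by auto
qed

lemma poly_span_sum:
  assumes "finite E" "E \<subseteq> exponents I" "\<And>e. e \<in> E \<Longrightarrow> \<Phi> e" "c \<in> E \<rightarrow> k"
  shows "(\<Oplus>e\<in>E. c e \<otimes> power_prod R u I e) \<in> poly_span R k u I \<Phi>"
  using assms
proof (induction E rule: finite_induct)
  case empty
  then show ?case
    by (simp add: poly_span.zero)
next
  case (insert f E)
  then have "(\<Oplus>e\<in>insert f E. c e \<otimes> power_prod R u I e) =
      c f \<otimes> power_prod R u I f \<oplus> (\<Oplus>e\<in>E. c e \<otimes> power_prod R u I e)"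
    using u k_carrier by (subst finsum_insert) (auto simp: Pi_iff)
  then show ?case
    using insert by (auto intro!: poly_span.add)
qed

lemma poly_span_add:
  assumes "x \<in> poly_span R k u I \<Phi>" "y \<in> poly_span R k u I \<Phi>"
  shows "x \<oplus> y \<in> poly_span R k u I \<Phi>"
  using assms(1)
proof induction
  case (add x c e)
  have "x \<in> carrier R" "y \<in> carrier R" "c \<in> carrier R" "power_prod R u I e \<in> carrier R"
    using add assms(2) poly_span_carrier k_carrier u by auto
  then show ?case
    using add by (auto simp: a_assoc intro!: poly_span.add)
qed (use assms(2) poly_span_carrier[of \<Phi>] in \<open>simp add: subset_iff\<close>)

lemma poly_span_monom:
  assumes "c \<in> k" "e \<in> exponents I" "\<Phi> e"
  shows "c \<otimes> power_prod R u I e \<in> poly_span R k u I \<Phi>"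
  using poly_span.add[of \<zero> R k u I \<Phi> c e, OF poly_span.zero assms] assms k_carrier u by simp

lemma poly_span_monom_mult:
  assumes "x \<in> poly_span R k u I \<Phi>" "d \<in> k" "f \<in> exponents I"
    and "\<And>e. \<Phi> e \<Longrightarrow> \<Psi> (\<lambda>i. e i + f i)"
  shows "(d \<otimes> power_prod R u I f) \<otimes> x \<in> poly_span R k u I \<Psi>"
  using assms(1)
proof induction
  case zero
  then show ?case
    using assms(2) k_carrier u by (simp add: poly_span.zero)
next
  case (add x c e)
  have m: "power_prod R u I (\<lambda>i. e i + f i) = power_prod R u I e \<otimes> power_prod R u I f"
    using u by (rule power_prod_add)
  have "x \<in> carrier R" "c \<in> carrier R" "d \<in> carrier R"
    "power_prod R u I e \<in> carrier R" "power_prod R u I f \<in> carrier R"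
    using add assms(2) poly_span_carrier k_carrier u by auto
  then have "(d \<otimes> power_prod R u I f) \<otimes> (c \<otimes> power_prod R u I e \<oplus> x) =
    (c \<otimes> d) \<otimes> power_prod R u I (\<lambda>i. e i + f i) \<oplus> (d \<otimes> power_prod R u I f) \<otimes> x"
    unfolding m by (simp add: r_distr m_ac)
  then show ?case
    using add assms subringE(6)[OF k] by (auto intro!: poly_span.add exponents_add)
qed

lemma poly_span_mult:
  assumes "x \<in> poly_span R k u I \<Phi>" "y \<in> poly_span R k u I \<Psi>"
    and "\<And>e f. \<Phi> e \<Longrightarrow> \<Psi> f \<Longrightarrow> \<Theta> (\<lambda>i. e i + f i)"
  shows "x \<otimes> y \<in> poly_span R k u I \<Theta>"
  using assms(1)
proof induction
  case zero
  then show ?case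
    using assms(2) poly_span_carrier[of \<Psi>] by (simp add: poly_span.zero subset_iff)
next
  case (add x c e)
  have "x \<in> carrier R" "y \<in> carrier R" "c \<otimes> power_prod R u I e \<in> carrier R"
    using add assms(2) poly_span_carrier k_carrier u by auto
  then have "(c \<otimes> power_prod R u I e \<oplus> x) \<otimes> y = (c \<otimes> power_prod R u I e) \<otimes> y \<oplus> x \<otimes> y"
    by (simp add: l_distr)
  moreover have "(c \<otimes> power_prod R u I e) \<otimes> y \<in> poly_span R k u I \<Theta>"
  proof (rule poly_span_monom_mult[OF assms(2) add.hyps(2,3)])
    fix f assume "\<Psi> f"
    then have "\<Theta> (\<lambda>i. e i + f i)"
      using assms(3) add.hyps(4) by blast
    then show "\<Theta> (\<lambda>i. f i + e i)"
      by (simp only: add.commute)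
  qed
  ultimately show ?case
    using add poly_span_add by simp
qed

lemma poly_span_smult:
  assumes "x \<in> poly_span R k u I \<Phi>" "c \<in> k"
  shows "c \<otimes> x \<in> poly_span R k u I \<Phi>"
  using poly_span_monom_mult[OF assms exponents_zero, of \<Phi>] power_prod_zero[OF u] k_carrier[OF assms(2)]
  by simp

text \<open>Otherwise moving the monomial \<open>f\<close> to the other side would give a vanishing
  sum whose coefficient at \<open>f\<close> is \<open>\<ominus> \<one>\<close>.\<close>

lemma alg_independent_monom_notin:
  assumes ind: "alg_independent R {\<zero>} k u I" and "\<one> \<noteq> \<zero>" and f: "f \<in> exponents I" "\<not> \<Phi> f"
  shows "power_prod R u I f \<notin> poly_span R k u I \<Phi>"
proof
  let ?m = "power_prod R u I"
  assume "?m f \<in> poly_span R k u I \<Phi>"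
  then obtain E c where E: "finite E" "E \<subseteq> exponents I" "\<And>e. e \<in> E \<Longrightarrow> \<Phi> e" "c \<in> E \<rightarrow> k"
    and eq: "?m f = (\<Oplus>e\<in>E. c e \<otimes> ?m e)"
    by (rule poly_span_finsum) blast
  define c' where "c' = c(f := \<ominus> \<one>)"
  have m: "?m e \<in> carrier R" for e
    using u by simp
  have nf: "f \<notin> E"
    using E f by blast
  have c': "c' \<in> insert f E \<rightarrow> k"
    using E subringE(3,5)[OF k] by (auto simp: c'_def)
  have "(\<Oplus>e\<in>insert f E. c' e \<otimes> ?m e) = c' f \<otimes> ?m f \<oplus> (\<Oplus>e\<in>E. c' e \<otimes> ?m e)"
    using E c' nf m k_carrier by (subst finsum_insert) (auto simp: Pi_iff)
  also have "(\<Oplus>e\<in>E. c' e \<otimes> ?m e) = (\<Oplus>e\<in>E. c e \<otimes> ?m e)"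
    using E nf m k_carrier by (intro finsum_cong') (auto simp: c'_def Pi_iff)
  also have "c' f \<otimes> ?m f \<oplus> (\<Oplus>e\<in>E. c e \<otimes> ?m e) = \<zero>"
    using m[of f] by (simp add: c'_def l_minus l_neg flip: eq)
  finally have "c' f = \<zero>"
    using E f(1) c' by (intro alg_independentD[OF ind, of "insert f E" c' f]) simp_all
  then have "\<ominus> \<one> = \<zero>"
    by (simp add: c'_def)
  then show False
    using minus_minus[OF one_closed] assms(2) by simp
qed

end

end


section \<open>Monomial valuations\<close>

context field
begin

lemma power_prod_nonzero:
  assumes "finite I" "u \<in> I \<rightarrow> carrier R - {\<zero>}"
  shows "power_prod R u I e \<in> carrier R - {\<zero>}"
  using assms
proof (induction I rule: finite_induct)
  case empty
  then show ?case
    by (simp add: power_prod_def)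
next
  case (insert i I)
  then have "u i [^] e i \<in> carrier R - {\<zero>}" "power_prod R u I e \<in> carrier R - {\<zero>}"
    by (auto intro!: pow_nonzero simp del: Diff_iff)
  moreover have "power_prod R u (insert i I) e = (u i [^] e i) \<otimes> power_prod R u I e"
    using insert by (intro power_prod_insert) auto
  ultimately show ?case
    by (auto simp: integral_iff)
qed

lemma inv_mult_nonzero:
  assumes "x \<in> carrier R - {\<zero>}" "y \<in> carrier R - {\<zero>}"
  shows "inv (x \<otimes> y) = inv x \<otimes> inv y"
proof (rule comm_inv_char)
  note i = inv_nonzero[OF assms(1)] inv_nonzero[OF assms(2)]
  have "(x \<otimes> y) \<otimes> (inv x \<otimes> inv y) = (x \<otimes> inv x) \<otimes> (y \<otimes> inv y)"
    using assms i by (simp add: m_ac)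
  then show "(x \<otimes> y) \<otimes> (inv x \<otimes> inv y) = \<one>"
    using assms by (simp add: r_inv_nonzero)
qed (use assms inv_nonzero[OF assms(1)] inv_nonzero[OF assms(2)] in auto)

text \<open>The set consists of the Laurent polynomials all of whose terms have positive weight, a
  first approximation to the maximal ideal. It omits \<open>\<one>\<close> because a monomial would
  otherwise be a combination of monomials of strictly larger weight, against independence. The
  multipliers are chosen to force the valuation to be trivial on \<open>k\<close> and to order
  monomials by weight.\<close>

lemma monomial_nonunital:
  fixes w :: "(nat \<Rightarrow> nat) \<Rightarrow> real"
  assumes k: "subring k R" and I: "finite I" and u: "u \<in> I \<rightarrow> carrier R - {\<zero>}"
    and ind: "alg_independent R {\<zero>} k u I"
    and w: "\<And>e f. w (\<lambda>i. e i + f i) = w e + w f"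
  defines "t \<equiv> power_prod R u I"
  shows "nonunital (k \<union> {t e \<otimes> inv (t f) |e f. e \<in> exponents I \<and> f \<in> exponents I \<and> w f \<le> w e})
    {p \<otimes> inv (t f) |p f. f \<in> exponents I \<and> p \<in> poly_span R k u I (\<lambda>e. w f < w e)}"
    (is "nonunital (k \<union> ?S) ?M")
proof -
  have u': "u \<in> I \<rightarrow> carrier R"
    using u by auto
  note k_carrier = k_carrier[OF k u']
  have t: "t e \<in> carrier R - {\<zero>}" for e
    unfolding t_def using power_prod_nonzero[OF I u] .
  have t_add: "t (\<lambda>i. e i + f i) = t e \<otimes> t f" for e f
    unfolding t_def using power_prod_add[OF u'] .
  let ?T = "\<lambda>f. poly_span R k u I (\<lambda>e. w f < w e)"
  have T: "?T f \<subseteq> carrier R" for f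
    by (rule poly_span_carrier[OF k u'])
  \<comment> \<open>Passing to a larger denominator: multiplying the numerator by \<open>t g\<close>
    and the denominator by \<open>t h\<close> keeps the strict weight inequality as long as
    \<open>w h \<le> w g\<close>.\<close>
  have shift: "t g \<otimes> p \<in> ?T (\<lambda>i. f i + h i)" if "p \<in> ?T f" "g \<in> exponents I" "w h \<le> w g" for p f g h
  proof -
    have "(\<one> \<otimes> t g) \<otimes> p \<in> ?T (\<lambda>i. f i + h i)"
      unfolding t_def using that subringE(3)[OF k] w
      by (intro poly_span_monom_mult[OF k u' that(1)]) auto
    then show ?thesis
      using t[of g] by simp
  qed
  show ?thesis
    unfolding nonunital_def
  proof (intro conjI ballI)
    show "?M \<subseteq> carrier R"
      using T inv_nonzero[OF t] by auto
    have "\<zero> = \<zero> \<otimes> inv (t (\<lambda>_. 0))"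
      using inv_nonzero[OF t] by simp
    then show "\<zero> \<in> ?M"
      using poly_span.zero[of R k u I] exponents_zero[of I] by blast
    show "\<one> \<notin> ?M"
    proof
      assume "\<one> \<in> ?M"
      then obtain p f where p: "f \<in> exponents I" "p \<in> ?T f" "\<one> = p \<otimes> inv (t f)"
        by blast
      have "p \<in> carrier R"
        using p T by blast
      then have "p = (p \<otimes> inv (t f)) \<otimes> t f"
        using t[of f] inv_nonzero[OF t, of f] by (simp add: m_assoc l_inv_nonzero)
      also have "\<dots> = t f"
        using t[of f] by (simp flip: p(3))
      finally show False
        using alg_independent_monom_notin[OF k u' ind _ p(1), of "\<lambda>e. w f < w e"] p(2)
        by (simp add: t_def)
    qed
  next
    fix x assume "x \<in> ?M"
    then obtain p f where p: "f \<in> exponents I" "p \<in> ?T f" "x = p \<otimes> inv (t f)"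
      by blast
    have "\<ominus> \<one> \<in> k"
      using subringE(3,5)[OF k] by blast
    then have "\<ominus> \<one> \<otimes> p \<in> ?T f"
      by (rule poly_span_smult[OF k u' p(2)])
    moreover have "\<ominus> x = (\<ominus> \<one> \<otimes> p) \<otimes> inv (t f)"
      using p T inv_nonzero[OF t, of f] by (auto simp: l_minus subset_iff)
    ultimately show "\<ominus> x \<in> ?M"
      using p(1) by blast
  next
    fix x y assume "x \<in> ?M" "y \<in> ?M"
    then obtain p f q g where p: "f \<in> exponents I" "p \<in> ?T f" "x = p \<otimes> inv (t f)"
      and q: "g \<in> exponents I" "q \<in> ?T g" "y = q \<otimes> inv (t g)"
      by blast
    let ?h = "\<lambda>i. f i + g i"
    have c: "p \<in> carrier R" "q \<in> carrier R" "inv (t f) \<in> carrier R" "inv (t g) \<in> carrier R"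
      "t f \<in> carrier R" "t g \<in> carrier R"
      using p q T inv_nonzero[OF t] t by auto
    have h: "?h \<in> exponents I" "inv (t ?h) = inv (t f) \<otimes> inv (t g)"
      using p q exponents_add t by (auto simp: t_add inv_mult_nonzero simp del: Diff_iff)
    have "t g \<otimes> p \<oplus> t f \<otimes> q \<in> ?T ?h"
      using shift[OF p(2) q(1), of g] shift[OF q(2) p(1), of f]
      by (intro poly_span_add[OF k u']) (auto simp: add.commute)
    moreover have "x \<oplus> y = (t g \<otimes> p \<oplus> t f \<otimes> q) \<otimes> inv (t ?h)"
    proof -
      have "(t g \<otimes> p \<oplus> t f \<otimes> q) \<otimes> inv (t ?h) =
          (t g \<otimes> inv (t g)) \<otimes> (p \<otimes> inv (t f)) \<oplus> (t f \<otimes> inv (t f)) \<otimes> (q \<otimes> inv (t g))"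
        unfolding h(2) using c by (simp add: l_distr r_distr m_ac)
      then show ?thesis
        using c t by (simp add: p(3) q(3) r_inv_nonzero)
    qed
    ultimately show "x \<oplus> y \<in> ?M"
      using h(1) by blast
    have "p \<otimes> q \<in> ?T ?h"
      by (rule poly_span_mult[OF k u' p(2) q(2)]) (simp add: w)
    moreover have "x \<otimes> y = (p \<otimes> q) \<otimes> inv (t ?h)"
      unfolding h(2) p(3) q(3) using c by (simp add: m_ac)
    ultimately show "x \<otimes> y \<in> ?M"
      using h(1) by blast
  next
    fix s x assume s: "s \<in> k \<union> ?S" and "x \<in> ?M"
    then obtain p f where p: "f \<in> exponents I" "p \<in> ?T f" "x = p \<otimes> inv (t f)"
      by blast
    have c: "p \<in> carrier R" "inv (t f) \<in> carrier R"
      using p T inv_nonzero[OF t] by auto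
    show "s \<otimes> x \<in> ?M"
    proof (cases "s \<in> k")
      case True
      then have "s \<otimes> p \<in> ?T f"
        using poly_span_smult[OF k u' p(2)] by blast
      moreover have "s \<otimes> x = (s \<otimes> p) \<otimes> inv (t f)"
        using True k_carrier c p(3) by (simp add: m_assoc)
      ultimately show ?thesis
        using p(1) by blast
    next
      case False
      then obtain g h where g: "g \<in> exponents I" "h \<in> exponents I" "w h \<le> w g" "s = t g \<otimes> inv (t h)"
        using s by blast
      have "s \<otimes> x = (t g \<otimes> p) \<otimes> inv (t (\<lambda>i. f i + h i))"
        unfolding p(3) g(4) t_add inv_mult_nonzero[OF t t]
        using c t[of g] inv_nonzero[OF t, of h] by (simp add: m_ac)
      then show ?thesis
        using shift[OF p(2) g(1,3)] exponents_add[OF p(1) g(2)] by blast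
    qed
  qed
qed

end

text \<open>A valuation is used only through the divisibility preorder of its valuation ring \<open>A\<close>.\<close>

locale valuation_ring = field R for R (structure) +
  fixes A :: "'a set"
  assumes subring_A: "subring A R"
    and total: "x \<in> carrier R - {\<zero>} \<Longrightarrow> y \<in> carrier R - {\<zero>} \<Longrightarrow>
      (\<exists>r\<in>A. y = r \<otimes> x) \<or> (\<exists>r\<in>A. x = r \<otimes> y)"
begin

text \<open>Read \<open>x \<preceq> y\<close> as: the valuation of \<open>x\<close> is at most that
  of \<open>y\<close>. Zero then has the largest valuation.\<close>

definition divides :: "'a \<Rightarrow> 'a \<Rightarrow> bool" (infix \<open>\<preceq>\<close> 50) where
  "x \<preceq> y \<longleftrightarrow> (\<exists>r\<in>A. y = r \<otimes> x)"

lemma A_carrier: "r \<in> A \<Longrightarrow> r \<in> carrier R"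
  using subringE(1)[OF subring_A] by blast

lemma divides_refl: "x \<in> carrier R \<Longrightarrow> x \<preceq> x"
  unfolding divides_def using subringE(3)[OF subring_A] by (intro bexI[of _ \<one>]) auto

lemma divides_trans:
  assumes "x \<preceq> y" "y \<preceq> z" "x \<in> carrier R"
  shows "x \<preceq> z"
proof -
  obtain r s where "r \<in> A" "y = r \<otimes> x" "s \<in> A" "z = s \<otimes> y"
    using assms unfolding divides_def by blast
  moreover from this have "z = (s \<otimes> r) \<otimes> x"
    using A_carrier assms(3) by (simp add: m_assoc)
  ultimately show ?thesis
    unfolding divides_def using subringE(6)[OF subring_A] by blast
qed

lemma divides_total: "x \<in> carrier R - {\<zero>} \<Longrightarrow> y \<in> carrier R - {\<zero>} \<Longrightarrow> x \<preceq> y \<or> y \<preceq> x"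
  using total unfolding divides_def by blast

lemma divides_mult:
  assumes "x \<preceq> y" "x' \<preceq> y'" "x \<in> carrier R" "x' \<in> carrier R"
  shows "x \<otimes> x' \<preceq> y \<otimes> y'"
proof -
  obtain r s where rs: "r \<in> A" "y = r \<otimes> x" "s \<in> A" "y' = s \<otimes> x'"
    using assms unfolding divides_def by blast
  then have "y \<otimes> y' = (r \<otimes> s) \<otimes> (x \<otimes> x')"
    using A_carrier assms(3,4) by (simp add: m_ac)
  then show ?thesis
    unfolding divides_def using rs subringE(6)[OF subring_A] by blast
qed

lemma divides_pow: "x \<preceq> y \<Longrightarrow> x \<in> carrier R \<Longrightarrow> x [^] (n::nat) \<preceq> y [^] n"
  by (induction n) (auto intro!: divides_mult divides_refl)

lemma divides_cancel:
  assumes "z \<otimes> x \<preceq> z \<otimes> y" "x \<in> carrier R" "y \<in> carrier R" "z \<in> carrier R - {\<zero>}"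
  shows "x \<preceq> y"
proof -
  obtain r where r: "r \<in> A" "z \<otimes> y = r \<otimes> (z \<otimes> x)"
    using assms(1) unfolding divides_def by blast
  then have "z \<otimes> y = z \<otimes> (r \<otimes> x)"
    using assms A_carrier by (simp add: m_lcomm)
  then have "y = r \<otimes> x"
    using assms r A_carrier by (simp add: m_lcancel)
  then show ?thesis
    using r unfolding divides_def by blast
qed

text \<open>If \<open>x = r \<otimes> y\<close> with \<open>r\<close> in \<open>A\<close>, the
  hypothesis yields \<open>s \<otimes> r [^] n = \<one>\<close> with \<open>s\<close> in
  \<open>A\<close>. So \<open>r\<close> is a unit of \<open>A\<close>, with inverse
  \<open>s \<otimes> r [^] (n - 1)\<close>, and \<open>y\<close> is a multiple of \<open>x\<close>
  as well.\<close>

lemma divides_pow_cancel: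
  assumes "x [^] n \<preceq> y [^] n" "0 < (n::nat)" "x \<in> carrier R - {\<zero>}" "y \<in> carrier R - {\<zero>}"
  shows "x \<preceq> y"
proof (rule ccontr)
  assume "\<not> x \<preceq> y"
  then obtain r where r: "r \<in> A" "x = r \<otimes> y"
    using divides_total[OF assms(3,4)] unfolding divides_def by blast
  obtain s where s: "s \<in> A" "y [^] n = s \<otimes> (x [^] n)"
    using assms(1) unfolding divides_def by blast
  have c: "r \<in> carrier R" "s \<in> carrier R" "y \<in> carrier R" "y [^] n \<in> carrier R - {\<zero>}"
    using r s A_carrier assms pow_nonzero[OF assms(4)] by auto
  obtain m where m: "n = Suc m"
    using assms(2) by (cases n) auto
  have "y [^] n = s \<otimes> ((r [^] n) \<otimes> (y [^] n))"
    using s(2) r(2) c by (simp add: nat_pow_distrib)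
  then have "\<one> \<otimes> (y [^] n) = (s \<otimes> (r [^] n)) \<otimes> (y [^] n)"
    using c by (simp add: m_assoc)
  then have one: "s \<otimes> (r [^] n) = \<one>"
    using c by (subst (asm) m_rcancel) auto
  have "r [^] m \<in> A"
    using r(1) subringE(3,6)[OF subring_A] by (induction m) auto
  then have "s \<otimes> (r [^] m) \<in> A"
    using s(1) subringE(6)[OF subring_A] by blast
  moreover have "y = (s \<otimes> (r [^] m)) \<otimes> x"
  proof -
    have "(s \<otimes> (r [^] m)) \<otimes> x = (s \<otimes> (r [^] n)) \<otimes> y"
      unfolding r(2) m using c by (simp add: m_assoc)
    then show ?thesis
      using one c by simp
  qed
  ultimately show False
    using \<open>\<not> x \<preceq> y\<close> unfolding divides_def by blast
qed

lemma divides_add: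
  assumes "x \<preceq> y" "x \<preceq> z" "x \<in> carrier R"
  shows "x \<preceq> y \<oplus> z"
proof -
  obtain r s where rs: "r \<in> A" "y = r \<otimes> x" "s \<in> A" "z = s \<otimes> x"
    using assms unfolding divides_def by blast
  then have "y \<oplus> z = (r \<oplus> s) \<otimes> x"
    using A_carrier assms(3) by (simp add: l_distr)
  then show ?thesis
    unfolding divides_def using rs subringE(7)[OF subring_A] by blast
qed

lemma divides_smult:
  assumes "x \<preceq> y" "r \<in> A" "x \<in> carrier R"
  shows "x \<preceq> r \<otimes> y"
  using divides_trans[OF assms(1) _ assms(3)] assms(2) unfolding divides_def by blast

lemma divides_zero: "x \<in> carrier R \<Longrightarrow> x \<preceq> \<zero>"
  unfolding divides_def using subringE(2)[OF subring_A] by (intro bexI[of _ \<zero>]) auto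

lemma divides_finsum:
  assumes "finite J" "\<And>j. j \<in> J \<Longrightarrow> x \<preceq> \<tau> j" "\<tau> \<in> J \<rightarrow> carrier R" "x \<in> carrier R"
  shows "x \<preceq> (\<Oplus>j\<in>J. \<tau> j)"
  using assms
proof (induction J rule: finite_induct)
  case (insert j J)
  then show ?case
    by (subst finsum_insert) (auto intro!: divides_add)
qed (simp add: divides_zero)

lemma divides_least:
  assumes "finite J" "J \<noteq> {}" "\<tau> \<in> J \<rightarrow> carrier R - {\<zero>}"
  shows "\<exists>m\<in>J. \<forall>j\<in>J. \<tau> m \<preceq> \<tau> j"
  using assms
proof (induction J rule: finite_ne_induct)
  case (insert j J)
  then obtain m where m: "m \<in> J" "\<forall>j\<in>J. \<tau> m \<preceq> \<tau> j"
    by auto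
  have c: "\<tau> m \<in> carrier R - {\<zero>}" "\<tau> j \<in> carrier R - {\<zero>}"
    using insert.prems m by auto
  show ?case
  proof (cases "\<tau> m \<preceq> \<tau> j")
    case True
    with m show ?thesis
      by blast
  next
    case False
    then have "\<tau> j \<preceq> \<tau> m"
      using divides_total[OF c] by blast
    moreover from this have "\<tau> j \<preceq> \<tau> i" if "i \<in> J" for i
      using m that c divides_trans[of "\<tau> j" "\<tau> m"] by blast
    ultimately show ?thesis
      using divides_refl c by blast
  qed
qed (auto intro!: divides_refl)

text \<open>The ultrametric inequality: term \<open>j\<close> is minus the sum of the other nonzero
  terms, and that sum is divisible by the one of least valuation among them. This is the source of
  the doubly attained maximum in tropical points.\<close>

lemma zero_sum_dominated:
  assumes J: "finite J" and \<tau>: "\<tau> \<in> J \<rightarrow> carrier R" "(\<Oplus>j\<in>J. \<tau> j) = \<zero>" and j: "j \<in> J" "\<tau> j \<noteq> \<zero>"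
  shows "\<exists>i\<in>J - {j}. \<tau> i \<noteq> \<zero> \<and> \<tau> i \<preceq> \<tau> j"
proof -
  let ?J = "{i \<in> J - {j}. \<tau> i \<noteq> \<zero>}"
  have c: "\<tau> j \<in> carrier R" "(\<Oplus>i\<in>?J. \<tau> i) \<in> carrier R"
    using \<tau>(1) j(1) by (auto intro!: finsum_closed)
  have "(\<Oplus>i\<in>J. \<tau> i) = (\<Oplus>i\<in>insert j (J - {j}). \<tau> i)"
    using j(1) by (simp add: insert_absorb)
  also have "\<dots> = \<tau> j \<oplus> (\<Oplus>i\<in>J - {j}. \<tau> i)"
    using J \<tau>(1) j(1) by (subst finsum_insert) auto
  also have "(\<Oplus>i\<in>J - {j}. \<tau> i) = (\<Oplus>i\<in>?J. \<tau> i)"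
    using J \<tau>(1) by (intro add.finprod_mono_neutral_cong_right) auto
  finally have eq: "\<tau> j = \<ominus> (\<Oplus>i\<in>?J. \<tau> i)"
    using c \<tau>(2) by (simp add: sum_zero_eq_neg)
  then have "?J \<noteq> {}"
    using j(2) by (metis finsum_empty minus_zero)
  then obtain m where m: "m \<in> ?J" "\<forall>i\<in>?J. \<tau> m \<preceq> \<tau> i"
    using divides_least[of ?J \<tau>] J \<tau>(1) by auto
  have "\<tau> m \<preceq> (\<Oplus>i\<in>?J. \<tau> i)"
    using m J \<tau>(1) by (intro divides_finsum) auto
  then have "\<tau> m \<preceq> \<ominus> \<one> \<otimes> (\<Oplus>i\<in>?J. \<tau> i)"
    using m(1) \<tau>(1) subringE(3,5)[OF subring_A] by (intro divides_smult) auto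
  then have "\<tau> m \<preceq> \<tau> j"
    using c(2) by (simp add: eq l_minus)
  with m(1) show ?thesis
    by blast
qed

end

section \<open>Weights of monomials and real values of algebraic elements\<close>

definition weight :: "nat set \<Rightarrow> (nat \<Rightarrow> real) \<Rightarrow> (nat \<Rightarrow> nat) \<Rightarrow> real" where
  "weight I l e = (\<Sum>i\<in>I. l i * real (e i))"

lemma weight_add: "weight I l (\<lambda>i. e i + f i) = weight I l e + weight I l f"
  by (simp add: weight_def algebra_simps sum.distrib)

lemma weight_mult: "weight I l (\<lambda>i. n * e i) = real n * weight I l e"
  by (simp add: weight_def algebra_simps sum_distrib_left)

lemma weight_cong: "(\<And>i. i \<in> I \<Longrightarrow> e i = f i) \<Longrightarrow> weight I l e = weight I l f"
  by (simp add: weight_def)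

lemma (in cring) power_prod_pow:
  assumes "u \<in> I \<rightarrow> carrier R"
  shows "power_prod R u I (\<lambda>i. n * e i) = power_prod R u I e [^] n"
proof (induction n)
  case (Suc n)
  have "power_prod R u I (\<lambda>i. Suc n * e i) = power_prod R u I (\<lambda>i. n * e i + e i)"
    by (simp add: add.commute)
  then show ?case
    using Suc power_prod_add[OF assms, of "\<lambda>i. n * e i" e] by simp
qed (use power_prod_zero[OF assms] in simp)

text \<open>This stands for a valuation that is trivial on \<open>k\<close> and takes the value
  \<open>l i\<close> at \<open>u i\<close>. Since \<open>A\<close> carries no chosen value group,
  the values of monomials are fixed only through the order they induce.\<close>

locale monomial_valuation = valuation_ring R A for R (structure) and A +
  fixes k :: "'a set" and u :: "nat \<Rightarrow> 'a" and I :: "nat set" and l :: "nat \<Rightarrow> real"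
  assumes finite_I: "finite I" and u: "u \<in> I \<rightarrow> carrier R - {\<zero>}"
    and subfield_k: "subfield k R" and k_subset: "k \<subseteq> A"
    and order: "e \<in> exponents I \<Longrightarrow> f \<in> exponents I \<Longrightarrow>
      power_prod R u I f \<preceq> power_prod R u I e \<longleftrightarrow> weight I l f \<le> weight I l e"
begin

abbreviation "t \<equiv> power_prod R u I"

lemma t_nonzero: "t e \<in> carrier R - {\<zero>}"
  using power_prod_nonzero[OF finite_I u] .

lemma u_carrier: "u \<in> I \<rightarrow> carrier R"
  using u by auto

text \<open>Neither side sees entries outside \<open>I\<close>, so \<open>order\<close> extends to
  arbitrary exponent vectors, which is what \<open>has_value\<close> quantifies over.\<close>

lemma t_order: "t f \<preceq> t e \<longleftrightarrow> weight I l f \<le> weight I l e"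
proof -
  let ?r = "\<lambda>e i. if i \<in> I then e i else (0::nat)"
  have "t (?r e) = t e" for e
    using u_carrier by (intro power_prod_cong) auto
  moreover have "weight I l (?r e) = weight I l e" for e
    by (intro weight_cong) auto
  ultimately show ?thesis
    using order[of "?r e" "?r f"] by (simp add: exponents_def)
qed

definition assoc_to :: "'a \<Rightarrow> 'a \<Rightarrow> bool" (infix \<open>\<bowtie>\<close> 50) where
  "x \<bowtie> y \<longleftrightarrow> x \<preceq> y \<and> y \<preceq> x"

lemma assoc_sym: "x \<bowtie> y \<Longrightarrow> y \<bowtie> x"
  by (simp add: assoc_to_def)

lemma assoc_trans: "x \<bowtie> y \<Longrightarrow> y \<bowtie> z \<Longrightarrow> x \<in> carrier R \<Longrightarrow> z \<in> carrier R \<Longrightarrow> x \<bowtie> z"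
  unfolding assoc_to_def using divides_trans by blast

text \<open>\<open>has_value x s\<close> says that the valuation of \<open>x\<close> is \<open>s\<close>; it is recovered from a power of \<open>x\<close>
  which is a Laurent monomial up to a unit of \<open>A\<close>.\<close>

definition has_value :: "'a \<Rightarrow> real \<Rightarrow> bool" where
  "has_value x s \<longleftrightarrow> x \<in> carrier R - {\<zero>} \<and>
    (\<exists>q e f. 0 < q \<and> (x [^] (q::nat)) \<otimes> t e \<bowtie> t f \<and> real q * s = weight I l f - weight I l e)"

lemma has_value_one: "has_value \<one> 0"
proof -
  have "\<one> [^] (1::nat) \<otimes> t (\<lambda>_. 0) = t (\<lambda>_. 0)"
    using t_nonzero[of "\<lambda>_. 0"] by simp
  then have "\<one> [^] (1::nat) \<otimes> t (\<lambda>_. 0) \<bowtie> t (\<lambda>_. 0)"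
    using t_nonzero[of "\<lambda>_. 0"] by (simp only: assoc_to_def) (simp add: divides_refl)
  then show ?thesis
    unfolding has_value_def
    by (intro conjI exI[of _ "1::nat"] exI[of _ "\<lambda>_. 0::nat"]) auto
qed

lemma has_value_power:
  assumes "has_value x s"
  shows "\<exists>q e f. 0 < (q::nat) \<and> real q * s = weight I l f - weight I l e \<and>
    (\<forall>n. x [^] (n * q) \<otimes> t (\<lambda>i. n * e i) \<bowtie> t (\<lambda>i. n * f i))"
proof -
  have x: "x \<in> carrier R - {\<zero>}"
    using assms by (simp add: has_value_def)
  obtain q e f where q: "0 < (q::nat)" "(x [^] q) \<otimes> t e \<bowtie> t f" "real q * s = weight I l f - weight I l e"
    using assms unfolding has_value_def by (elim exE conjE) (rule that)
  have c: "x [^] q \<otimes> t e \<in> carrier R" "t f \<in> carrier R" "t e \<in> carrier R" "x \<in> carrier R"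
    using x t_nonzero by auto
  have "x [^] (n * q) \<otimes> t (\<lambda>i. n * e i) \<bowtie> t (\<lambda>i. n * f i)" for n
  proof -
    have "x [^] (n * q) \<otimes> t (\<lambda>i. n * e i) = (x [^] q \<otimes> t e) [^] n"
      using c by (simp add: power_prod_pow[OF u_carrier] nat_pow_distrib nat_pow_pow mult.commute)
    then show ?thesis
      using q(2) c unfolding assoc_to_def by (simp add: power_prod_pow[OF u_carrier] divides_pow)
  qed
  then have "\<forall>n. x [^] (n * q) \<otimes> t (\<lambda>i. n * e i) \<bowtie> t (\<lambda>i. n * f i)"
    by (rule allI)
  with q(1,3) show ?thesis
    by (intro exI conjI)
qed

text \<open>Raising to a common multiple of the two exponents lets both values be compared with the
  same \<open>q\<close>.\<close>

lemma has_value_common_power: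
  assumes "has_value x s" "has_value y s'"
  obtains q e f g h where "0 < (q::nat)"
    "real q * s = weight I l f - weight I l e" "real q * s' = weight I l h - weight I l g"
    "x [^] q \<otimes> t e \<bowtie> t f" "y [^] q \<otimes> t g \<bowtie> t h"
proof -
  obtain a e f where a: "0 < (a::nat)" "real a * s = weight I l f - weight I l e"
    "\<forall>n. x [^] (n * a) \<otimes> t (\<lambda>i. n * e i) \<bowtie> t (\<lambda>i. n * f i)"
    using has_value_power[OF assms(1)] by (elim exE conjE) (rule that)
  obtain b g h where b: "0 < (b::nat)" "real b * s' = weight I l h - weight I l g"
    "\<forall>n. y [^] (n * b) \<otimes> t (\<lambda>i. n * g i) \<bowtie> t (\<lambda>i. n * h i)"
    using has_value_power[OF assms(2)] by (elim exE conjE) (rule that)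
  show thesis
  proof (rule that[of "b * a"])
    show "real (b * a) * s = weight I l (\<lambda>i. b * f i) - weight I l (\<lambda>i. b * e i)"
      using a(2) by (simp add: weight_mult mult.assoc flip: right_diff_distrib)
    show "real (b * a) * s' = weight I l (\<lambda>i. a * h i) - weight I l (\<lambda>i. a * g i)"
      using b(2) by (simp add: weight_mult mult.assoc mult.left_commute flip: right_diff_distrib)
    show "x [^] (b * a) \<otimes> t (\<lambda>i. b * e i) \<bowtie> t (\<lambda>i. b * f i)"
      using a(3) by (rule spec)
    show "y [^] (b * a) \<otimes> t (\<lambda>i. a * g i) \<bowtie> t (\<lambda>i. a * h i)"
      using b(3)[rule_format, of a] by (simp add: mult.commute)
  qed (use a b in simp)
qed

lemma has_value_mult:
  assumes "has_value x s" "has_value y s'"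
  shows "has_value (x \<otimes> y) (s + s')"
proof -
  obtain q e f g h where q: "0 < (q::nat)"
    "real q * s = weight I l f - weight I l e" "real q * s' = weight I l h - weight I l g"
    "x [^] q \<otimes> t e \<bowtie> t f" "y [^] q \<otimes> t g \<bowtie> t h"
    by (rule has_value_common_power[OF assms])
  have xy: "x \<in> carrier R - {\<zero>}" "y \<in> carrier R - {\<zero>}"
    using assms by (auto simp: has_value_def)
  then have c: "x \<in> carrier R" "y \<in> carrier R" "t e \<in> carrier R" "t f \<in> carrier R" "t g \<in> carrier R" "t h \<in> carrier R"
    using t_nonzero by auto
  have "((x \<otimes> y) [^] q) \<otimes> t (\<lambda>i. e i + g i) = (x [^] q \<otimes> t e) \<otimes> (y [^] q \<otimes> t g)"
    using c by (simp add: power_prod_add[OF u_carrier] nat_pow_distrib m_ac)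
  then have "((x \<otimes> y) [^] q) \<otimes> t (\<lambda>i. e i + g i) \<bowtie> t (\<lambda>i. f i + h i)"
    using q(4,5) c unfolding assoc_to_def power_prod_add[OF u_carrier, of f h]
    by (simp add: divides_mult)
  moreover have "real q * (s + s') = weight I l (\<lambda>i. f i + h i) - weight I l (\<lambda>i. e i + g i)"
    using q(2,3) by (simp add: weight_add distrib_left)
  moreover have "x \<otimes> y \<in> carrier R - {\<zero>}"
    using xy by (auto simp: integral_iff)
  ultimately show ?thesis
    unfolding has_value_def using q(1) by blast
qed

text \<open>After raising to the common power and clearing both denominators with
  \<open>t e \<otimes> t g\<close>, each side is associated to a monomial, and divisibility of
  monomials is comparison of weights. Applied with \<open>y = x\<close>, it shows that the value is
  unique.\<close>

lemma has_value_divides_iff: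
  assumes "has_value x s" "has_value y s'"
  shows "x \<preceq> y \<longleftrightarrow> s \<le> s'"
proof -
  obtain q e f g h where q: "0 < (q::nat)"
    "real q * s = weight I l f - weight I l e" "real q * s' = weight I l h - weight I l g"
    "x [^] q \<otimes> t e \<bowtie> t f" "y [^] q \<otimes> t g \<bowtie> t h"
    by (rule has_value_common_power[OF assms])
  have xy: "x \<in> carrier R - {\<zero>}" "y \<in> carrier R - {\<zero>}"
    using assms by (auto simp: has_value_def)
  have c: "x [^] q \<in> carrier R" "y [^] q \<in> carrier R" "t e \<in> carrier R" "t f \<in> carrier R" "t g \<in> carrier R" "t h \<in> carrier R"
    using xy t_nonzero by auto
  have eg: "t e \<otimes> t g \<in> carrier R - {\<zero>}"
    using t_nonzero[of e] t_nonzero[of g] by (auto simp: integral_iff)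
  have xq: "(t e \<otimes> t g) \<otimes> x [^] q \<bowtie> t (\<lambda>i. f i + g i)"
  proof -
    have "(t e \<otimes> t g) \<otimes> x [^] q = (x [^] q \<otimes> t e) \<otimes> t g"
      using c by (simp add: m_ac)
    then show ?thesis
      using q(4) c unfolding assoc_to_def power_prod_add[OF u_carrier]
      by (simp add: divides_mult divides_refl)
  qed
  have yq: "(t e \<otimes> t g) \<otimes> y [^] q \<bowtie> t (\<lambda>i. h i + e i)"
  proof -
    have "(t e \<otimes> t g) \<otimes> y [^] q = (y [^] q \<otimes> t g) \<otimes> t e"
      using c by (simp add: m_ac)
    then show ?thesis
      using q(5) c unfolding assoc_to_def power_prod_add[OF u_carrier]
      by (simp add: divides_mult divides_refl)
  qed
  have "x \<preceq> y \<longleftrightarrow> x [^] q \<preceq> y [^] q"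
    using divides_pow_cancel[OF _ q(1) xy] divides_pow xy by blast
  also have "\<dots> \<longleftrightarrow> (t e \<otimes> t g) \<otimes> x [^] q \<preceq> (t e \<otimes> t g) \<otimes> y [^] q"
    using divides_cancel[OF _ c(1,2) eg] divides_mult[OF divides_refl, of "t e \<otimes> t g"] eg c by blast
  also have "\<dots> \<longleftrightarrow> t (\<lambda>i. f i + g i) \<preceq> t (\<lambda>i. h i + e i)"
  proof -
    have cc: "(t e \<otimes> t g) \<otimes> x [^] q \<in> carrier R" "(t e \<otimes> t g) \<otimes> y [^] q \<in> carrier R"
      "t (\<lambda>i. f i + g i) \<in> carrier R" "t (\<lambda>i. h i + e i) \<in> carrier R"
      using c t_nonzero by auto
    show ?thesis
      using xq yq cc unfolding assoc_to_def by (meson divides_trans)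
  qed
  also have "\<dots> \<longleftrightarrow> real q * s \<le> real q * s'"
    unfolding t_order weight_add q(2,3) by linarith
  also have "\<dots> \<longleftrightarrow> s \<le> s'"
    using q(1) by simp
  finally show ?thesis .
qed

lemma has_value_unique: "has_value x s \<Longrightarrow> has_value x s' \<Longrightarrow> s = s'"
  using has_value_divides_iff[of x s x s'] has_value_divides_iff[of x s' x s] divides_refl[of x]
  by (auto simp: has_value_def)

lemma k_unit:
  assumes "c \<in> k" "c \<noteq> \<zero>" "x \<in> carrier R"
  shows "c \<otimes> x \<bowtie> x"
proof -
  have c: "c \<in> carrier R - {\<zero>}" "inv c \<in> k"
    using assms subfield_m_inv(1)[OF subfield_k, of c] subringE(1)[OF subfieldE(1)[OF subfield_k]] by auto
  then have "x = inv c \<otimes> (c \<otimes> x)"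
    using assms inv_nonzero[OF c(1)] by (simp add: l_inv_nonzero flip: m_assoc)
  with c assms k_subset show ?thesis
    unfolding assoc_to_def divides_def by blast
qed

text \<open>A polynomial relation of \<open>u i\<close> over the monomials in \<open>u\<^sub>j\<close>, \<open>j \<in> I\<close>, leaves only finitely many
  linear forms in the weights as candidates for the valuation of \<open>u i\<close>.\<close>

lemma has_value_of_relation:
  assumes i: "i \<notin> I" "u i \<in> carrier R - {\<zero>}"
    and E: "finite E" "c \<in> E \<rightarrow> k" "(\<Oplus>e\<in>E. c e \<otimes> power_prod R u (insert i I) e) = \<zero>"
      "e\<^sub>0 \<in> E" "c e\<^sub>0 \<noteq> \<zero>" "E \<subseteq> exponents (insert i I)"
    and generic: "\<And>e f. e \<in> E \<Longrightarrow> f \<in> E \<Longrightarrow> (\<exists>j\<in>I. e j \<noteq> f j) \<Longrightarrow> weight I l e \<noteq> weight I l f"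
  shows "\<exists>e\<in>E. \<exists>f\<in>E. f i < e i \<and>
    has_value (u i) ((weight I l f - weight I l e) / (real (e i) - real (f i)))"
proof -
  define \<tau> where "\<tau> e = c e \<otimes> power_prod R u (insert i I) e" for e
  have uI: "u \<in> insert i I \<rightarrow> carrier R"
    using u i by auto
  have pp: "power_prod R u (insert i I) e = u i [^] e i \<otimes> t e" for e
    by (rule power_prod_insert[OF finite_I i(1) uI])
  have pp_nz: "power_prod R u (insert i I) e \<in> carrier R - {\<zero>}" for e
    using finite_I u i by (intro power_prod_nonzero) auto
  have kc: "c e \<in> carrier R" if "e \<in> E" for e
    using E(2) that subringE(1)[OF subfieldE(1)[OF subfield_k]] by auto
  have \<tau>c: "\<tau> \<in> E \<rightarrow> carrier R"
    using kc pp_nz by (auto simp: \<tau>_def)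
  have \<tau>_nz: "\<tau> e \<noteq> \<zero> \<longleftrightarrow> c e \<noteq> \<zero>" if "e \<in> E" for e
    using kc[OF that] pp_nz[of e] by (auto simp: \<tau>_def integral_iff)
  let ?E = "{e\<in>E. c e \<noteq> \<zero>}"
  \<comment> \<open>\<open>m\<close> is a term of least valuation, and by
    \<open>zero_sum_dominated\<close> another nonzero term \<open>n\<close> has valuation at most
    that of \<open>m\<close>; hence the two are associated.\<close>
  obtain m where m: "m \<in> ?E" "\<forall>e\<in>?E. \<tau> m \<preceq> \<tau> e"
    using divides_least[of ?E \<tau>] E(1,4,5) \<tau>c \<tau>_nz by auto
  obtain n where n: "n \<in> E - {m}" "\<tau> n \<noteq> \<zero>" "\<tau> n \<preceq> \<tau> m"
    using zero_sum_dominated[OF E(1) \<tau>c, of m] E(3) m(1) \<tau>_nz by (auto simp: \<tau>_def)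
  have n': "n \<in> ?E"
    using n \<tau>_nz by auto
  have assoc: "u i [^] m i \<otimes> t m \<bowtie> u i [^] n i \<otimes> t n"
  proof -
    have *: "\<tau> e \<bowtie> u i [^] e i \<otimes> t e" if "e \<in> ?E" for e
      unfolding \<tau>_def pp using that E(2) pp_nz[of e] by (intro k_unit) (auto simp: pp)
    have "\<tau> m \<bowtie> \<tau> n"
      using n(3) m(2) n' by (auto simp: assoc_to_def)
    moreover have "u i [^] e i \<otimes> t e \<in> carrier R" for e
      using pp_nz[of e] by (simp add: pp)
    ultimately show ?thesis
      using assoc_trans[OF assoc_sym[OF *[OF m(1)]] assoc_trans[OF _ *[OF n']]] \<tau>c m(1) by auto
  qed
  have val_of: "has_value (u i) ((weight I l f - weight I l e) / (real (e i) - real (f i)))"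
    if *: "u i [^] e i \<otimes> t e \<bowtie> u i [^] f i \<otimes> t f" and less: "f i < e i" for e f
  proof -
    have c: "u i [^] f i \<in> carrier R - {\<zero>}" "t e \<in> carrier R" "t f \<in> carrier R"
      "u i [^] (e i - f i) \<otimes> t e \<in> carrier R"
      using i(2) t_nonzero pow_nonzero[OF i(2)] by auto
    have "u i [^] e i \<otimes> t e = u i [^] f i \<otimes> (u i [^] (e i - f i) \<otimes> t e)"
      using i(2) less c nat_pow_mult[of "u i" "f i" "e i - f i"] by (simp flip: m_assoc)
    then have "u i [^] (e i - f i) \<otimes> t e \<bowtie> t f"
      using * divides_cancel[OF _ c(4,3,1)] divides_cancel[OF _ c(3,4,1)] unfolding assoc_to_def by simp
    with less i(2) show ?thesis
      unfolding has_value_def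
      by (intro conjI exI[of _ "e i - f i"] exI[of _ e] exI[of _ f]) (auto simp: of_nat_diff)
  qed
  \<comment> \<open>With equal exponents at \<open>i\<close> the powers of \<open>u i\<close> cancel
    and the monomials in \<open>I\<close> have equal weight. Genericity then makes the exponents
    agree on \<open>I\<close>, so \<open>m = n\<close>, which is excluded.\<close>
  have "m i \<noteq> n i"
  proof
    assume eq: "m i = n i"
    then have "t m \<bowtie> t n"
      using assoc divides_cancel[of "u i [^] n i" "t m" "t n"] divides_cancel[of "u i [^] n i" "t n" "t m"]
        pow_nonzero[OF i(2)] t_nonzero unfolding assoc_to_def by auto
    then have "weight I l m = weight I l n"
      by (auto simp: assoc_to_def t_order)
    then have "m j = n j" if "j \<in> I" for j
      using generic m(1) n' that by blast
    moreover have "m j = n j" if "j \<notin> insert i I" for j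
    proof -
      have "m \<in> exponents (insert i I)" "n \<in> exponents (insert i I)"
        using E(6) m(1) n' by auto
      with that show ?thesis
        by (simp add: exponents_def)
    qed
    ultimately have "m = n"
      using eq by (intro ext) (metis insertE)
    with n(1) show False
      by simp
  qed
  then consider "n i < m i" | "m i < n i"
    by linarith
  then show ?thesis
  proof cases
    case 1
    with val_of[OF assoc] m(1) n' show ?thesis
      by auto
  next
    case 2
    with val_of[OF assoc_sym[OF assoc]] m(1) n' show ?thesis
      by auto
  qed
qed

end

context field
begin

text \<open>Chevalley's theorem is applied to the sets of \<open>monomial_nonunital\<close>, and the
  valuation ring is \<open>multiplier M\<close>. The inclusion
  \<open>S \<subseteq> multiplier M\<close> orders monomials of increasing weight. For the converse,
  if \<open>?t f\<close> divided \<open>?t e\<close> with \<open>f\<close> of larger weight, then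
  \<open>?t f \<otimes> inv (?t e)\<close> would lie in \<open>M\<close> and its inverse in the
  multiplier ring, so \<open>\<one>\<close> would lie in \<open>M\<close>.\<close>

lemma monomial_valuation_exists:
  assumes k: "subfield k R" and I: "finite I" and u: "u \<in> I \<rightarrow> carrier R - {\<zero>}"
    and ind: "alg_independent R {\<zero>} k u I"
  obtains A where "monomial_valuation R A k u I l"
proof -
  let ?t = "power_prod R u I" and ?w = "weight I l"
  have sk: "subring k R"
    by (rule subfieldE(1)[OF k])
  have t: "?t e \<in> carrier R - {\<zero>}" for e
    using power_prod_nonzero[OF I u] .
  define S where "S = k \<union> {?t e \<otimes> inv (?t f) |e f. e \<in> exponents I \<and> f \<in> exponents I \<and> ?w f \<le> ?w e}"
  define M\<^sub>0 where "M\<^sub>0 = {p \<otimes> inv (?t f) |p f. f \<in> exponents I \<and> p \<in> poly_span R k u I (\<lambda>e. ?w f < ?w e)}"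
  have M0: "nonunital S M\<^sub>0"
    unfolding S_def M\<^sub>0_def by (rule monomial_nonunital[OF sk I u ind weight_add])
  have S: "S \<subseteq> carrier R"
    using subringE(1)[OF sk] t inv_nonzero[OF t] by (auto simp: S_def)
  obtain M where M: "nonunital S M" "M\<^sub>0 \<subseteq> M"
    and val: "\<forall>x\<in>carrier R - {\<zero>}. x \<in> multiplier M \<or> inv x \<in> multiplier M"
    by (rule nonunital_valuation_exists[OF M0 S]) (rule that; blast)
  note D = nonunitalD[OF M(1)]
  have Mc: "y \<in> carrier R" if "y \<in> M" for y
    using that D(1) by blast
  have SA: "S \<subseteq> multiplier M"
    using S D(7) by (auto simp: multiplier_def)
  have "subring (multiplier M) R"
    using D Mc by (intro subringI) (auto simp: multiplier_def l_minus m_assoc l_distr)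
  moreover have "(\<exists>r\<in>multiplier M. y = r \<otimes> x) \<or> (\<exists>r\<in>multiplier M. x = r \<otimes> y)"
    if x: "x \<in> carrier R - {\<zero>}" and y: "y \<in> carrier R - {\<zero>}" for x y
  proof -
    note ix = inv_nonzero[OF x] and iy = inv_nonzero[OF y]
    have "y \<otimes> inv x \<in> carrier R - {\<zero>}"
      using ix y by (auto simp: integral_iff)
    then have "y \<otimes> inv x \<in> multiplier M \<or> inv (y \<otimes> inv x) \<in> multiplier M"
      by (rule val[rule_format])
    moreover have "inv (y \<otimes> inv x) = inv y \<otimes> x"
      using x y ix by (simp add: inv_mult_nonzero field_Units)
    moreover have "y = (y \<otimes> inv x) \<otimes> x" "x = (inv y \<otimes> x) \<otimes> y"
      using x y ix iy by (simp_all add: m_assoc l_inv_nonzero) (simp add: m_comm[of x y] l_inv_nonzero flip: m_assoc)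
    ultimately show ?thesis
      by metis
  qed
  ultimately interpret V: valuation_ring R "multiplier M"
    by (intro valuation_ring.intro valuation_ring_axioms.intro field_axioms)
  have "monomial_valuation R (multiplier M) k u I l"
  proof (intro monomial_valuation.intro monomial_valuation_axioms.intro V.valuation_ring_axioms)
    show "k \<subseteq> multiplier M"
      using SA by (auto simp: S_def)
    fix e f assume ef: "e \<in> exponents I" "f \<in> exponents I"
    show "V.divides (?t f) (?t e) \<longleftrightarrow> ?w f \<le> ?w e"
    proof
      assume "?w f \<le> ?w e"
      then have "?t e \<otimes> inv (?t f) \<in> multiplier M"
        using SA ef by (auto simp: S_def)
      moreover have "?t e = (?t e \<otimes> inv (?t f)) \<otimes> ?t f"
        using t[of e] t[of f] inv_nonzero[OF t[of f]] by (simp add: m_assoc l_inv_nonzero)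
      ultimately show "V.divides (?t f) (?t e)"
        unfolding V.divides_def by blast
    next
      assume "V.divides (?t f) (?t e)"
      then obtain r where r: "r \<in> multiplier M" "?t e = r \<otimes> ?t f"
        unfolding V.divides_def by blast
      show "?w f \<le> ?w e"
      proof (rule ccontr)
        assume "\<not> ?w f \<le> ?w e"
        then have "\<one> \<otimes> ?t f \<in> poly_span R k u I (\<lambda>f. ?w e < ?w f)"
          using ef u subringE(3)[OF sk] by (intro poly_span_monom[OF sk]) auto
        then have "?t f \<otimes> inv (?t e) \<in> M"
          using t[of f] ef M(2) by (auto simp: M\<^sub>0_def)
        then have "r \<otimes> (?t f \<otimes> inv (?t e)) \<in> M"
          using r(1) by (simp add: multiplier_def)
        also have "r \<otimes> (?t f \<otimes> inv (?t e)) = (r \<otimes> ?t f) \<otimes> inv (?t e)"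
          using r(1) t[of f] inv_nonzero[OF t[of e]] by (simp add: multiplier_def m_assoc)
        also have "\<dots> = \<one>"
          unfolding r(2)[symmetric] by (rule r_inv_nonzero[OF t])
        finally show False
          using D(3) by blast
      qed
    qed
  qed (use I u k in auto)
  then show thesis
    by (rule that)
qed

end


section \<open>Cubes in the space of tropical points\<close>

text \<open>The finite case of Baire's theorem: adding a closed set with empty interior to a set
  with empty interior creates no interior points.\<close>

lemma finite_closed_cover_interior:
  fixes \<F> :: "'a :: topological_space set set"
  assumes "finite \<F>" "\<And>F. F \<in> \<F> \<Longrightarrow> closed F" "\<Union>\<F> = UNIV"
  shows "\<exists>F\<in>\<F>. interior F \<noteq> {}"
proof (rule ccontr)
  assume neg: "\<not> ?thesis"
  have "interior (\<Union>\<G>) = {}" if "\<G> \<subseteq> \<F>" for \<G>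
    using finite_subset[OF that assms(1)] that
  proof (induction \<G> rule: finite_induct)
    case (insert F \<G>)
    then show ?case
      using neg assms(2) interior_closed_Un_empty_interior[of F "\<Union>\<G>"] by auto
  qed simp
  with assms(3) show False
    using interior_UNIV by (metis UNIV_not_empty order_refl)
qed

lemma continuous_weight: "continuous_on A (\<lambda>l. weight I l e)"
  unfolding weight_def by (intro continuous_intros continuous_on_subset[OF continuous_on_product_coordinates]) auto

lemma closed_weight_eq: "closed {l. weight I l e = weight I l f}"
  by (intro closed_Collect_eq continuous_weight)

text \<open>Moving only coordinate \<open>j\<close> changes the difference of the two weights at the
  nonzero rate \<open>e j - f j\<close>, so one leaves the hyperplane at once.\<close>

lemma weight_eq_interior_empty:
  assumes "finite I" "j \<in> I" "e j \<noteq> f j"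
  shows "interior {l. weight I l e = weight I l f} = {}"
proof (rule ccontr)
  let ?H = "{l. weight I l e = weight I l f}"
  assume "interior ?H \<noteq> {}"
  then obtain l where l: "l \<in> interior ?H"
    by blast
  define p where "p x = l(j := l j + x)" for x
  have p_weight: "weight I (p x) e = weight I l e + x * e j" for x e
  proof -
    have "weight I (p x) e = (\<Sum>i\<in>I. l i * e i + (if i = j then x * e j else 0))"
      unfolding weight_def p_def by (intro sum.cong) (auto simp: algebra_simps)
    then show ?thesis
      using assms by (simp add: sum.distrib weight_def)
  qed
  have "continuous_on UNIV p"
  proof (intro continuous_on_coordinatewise_then_product)
    show "continuous_on UNIV (\<lambda>x. p x i)" for i
      by (cases "i = j") (auto simp: p_def intro!: continuous_intros)
  qed
  then have "open (p -` interior ?H)"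
    by (intro open_vimage open_interior)
  moreover have "0 \<in> p -` interior ?H"
    using l by (simp add: p_def)
  ultimately obtain \<epsilon> where \<epsilon>: "\<epsilon> > 0" "ball 0 \<epsilon> \<subseteq> p -` interior ?H"
    using open_contains_ball_eq by blast
  then have "\<epsilon> / 2 \<in> p -` interior ?H"
    by (intro subsetD[OF \<epsilon>(2)]) (simp add: dist_real_def)
  then have "p (\<epsilon> / 2) \<in> ?H"
    using interior_subset[of ?H] by blast
  moreover have "weight I l e = weight I l f"
    using l interior_subset by blast
  ultimately show False
    using \<epsilon>(1) assms(3) by (simp add: p_weight)
qed

lemma topspace_Sigma_space:
  assumes "band B" "generators B as"
  shows "topspace (Sigma_space B as) =
    (\<lambda>\<phi>. \<lambda>i\<in>{..<length as}. \<phi> (as ! i)) ` band_Hom B tropical"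
proof -
  interpret band B by fact
  have "as ! i \<in> carrier B" if "i < length as" for i
    using assms(2) that by (auto simp: generators_def)
  then show ?thesis
    by (auto simp: Sigma_space_def band_Hom_tropical_iff split: if_splits)
qed

text \<open>Continuity of the formulas turns convergent weights into convergent coordinates, and
  \<open>band_Hom_tropical_limit\<close> supplies the limiting point.\<close>

lemma (in band) closed_Sigma_section:
  fixes s :: "nat \<Rightarrow> (nat \<Rightarrow> real) \<Rightarrow> real"
  assumes "generators B as" and "\<And>i. i < length as \<Longrightarrow> continuous_on UNIV (s i)"
  shows "closed {l. \<exists>\<phi>\<in>band_Hom B tropical. \<forall>i<length as. \<phi> (as ! i) = s i l}"
  unfolding closed_sequential_limits
proof (intro allI impI, elim conjE)
  fix x l
  assume x: "\<forall>n. x n \<in> {l. \<exists>\<phi>\<in>band_Hom B tropical. \<forall>i<length as. \<phi> (as ! i) = s i l}"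
    and lim: "x \<longlonglongrightarrow> l"
  then obtain \<phi> where \<phi>: "\<And>n. \<phi> n \<in> band_Hom B tropical"
    "\<And>n i. i < length as \<Longrightarrow> \<phi> n (as ! i) = s i (x n)"
    by simp metis
  have "(\<lambda>n. \<phi> n (as ! i)) \<longlonglongrightarrow> s i l" if "i < length as" for i
    using continuous_on_tendsto_compose[OF assms(2)[OF that] lim] \<phi>(2)[OF that] by simp
  then have "\<exists>\<psi>\<in>band_Hom B tropical. \<forall>i<length as. \<psi> (as ! i) = s i l"
    by (rule band_Hom_tropical_limit[OF assms(1) \<phi>(1)]) blast+
  then show "l \<in> {l. \<exists>\<phi>\<in>band_Hom B tropical. \<forall>i<length as. \<phi> (as ! i) = s i l}"
    by blast
qed

text \<open>A cube on which all coordinates of points of \<open>\<Sigma>\<close> are prescribed by continuous functions, those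
  indexed by \<open>I\<close> being \<open>exp (- l i)\<close>, is a retract of \<open>\<Sigma>\<close>.\<close>

lemma covering_dim_le_of_section:
  fixes s :: "nat \<Rightarrow> (nat \<Rightarrow> real) \<Rightarrow> real" and c :: "nat \<Rightarrow> real"
  assumes B: "band B" "generators B as" and I: "I \<subseteq> {..<length as}"
    and s: "\<And>i. i < length as \<Longrightarrow> continuous_on UNIV (s i)"
      "\<And>i. i \<in> I \<Longrightarrow> s i = (\<lambda>l. exp (- l i))"
    and sec: "\<epsilon> > 0" "\<And>l. (\<And>i. \<bar>l i - c i\<bar> \<le> \<epsilon>) \<Longrightarrow>
      \<exists>\<phi>\<in>band_Hom B tropical. \<forall>i<length as. \<phi> (as ! i) = s i l"
    and dim: "covering_dim_le (Sigma_space B as) n"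
  shows "int (card I) \<le> n"
proof -
  let ?N = "{..<length as}" and ?\<Sigma> = "Sigma_space B as"
  let ?C = "top_of_set (unit_cube (card I))"
  interpret band B by fact
  have finI: "finite I"
    using I finite_subset by blast
  then obtain h where h: "bij_betw h {..<card I} I"
    using ex_bij_betw_nat_finite by (metis atLeast0LessThan)
  define idx where "idx = inv_into {..<card I} h"
  have idx: "idx i < card I" "h (idx i) = i" if "i \<in> I" for i
    using h that unfolding idx_def bij_betw_def
    by (metis inv_into_into lessThan_iff, metis f_inv_into_f)
  have idx_h: "idx (h j) = j" "h j \<in> I" if "j < card I" for j
    using h that unfolding idx_def bij_betw_def by auto
  \<comment> \<open>The unit cube is mapped onto the box with corner \<open>c\<close> and side
    \<epsilon> in the directions of \<open>I\<close>; the other weights stay at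
    \<open>c\<close>.\<close>
  define L where "L x i = (if i \<in> I then c i + \<epsilon> * x (idx i) else c i)" for x :: "nat \<Rightarrow> real" and i
  define f where "f x = (\<lambda>i\<in>?N. s i (L x))" for x
  define lo hi where "lo i = exp (- (c i + \<epsilon>))" and "hi i = exp (- c i)" for i
  \<comment> \<open>The retraction must be continuous on all tropical points, also where a
    coordinate is 0. Clamping to the interval from \<open>lo\<close> to \<open>hi\<close> keeps the
    logarithm defined and the result in the cube; on the section the clamping has no effect.\<close>
  define g :: "(nat \<Rightarrow> real) \<Rightarrow> nat \<Rightarrow> real" where
    "g y j = (if j < card I then (- ln (max (lo (h j)) (min (hi (h j)) (y (h j)))) - c (h j)) / \<epsilon> else 0)"
    for y j
  have lo_hi: "0 < lo i" "lo i \<le> hi i" for i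
    using sec(1) by (simp_all add: lo_def hi_def)
  have L_box: "\<bar>L x i - c i\<bar> \<le> \<epsilon>" if "x \<in> unit_cube (card I)" for x i
    using that sec(1) idx(1) by (auto simp: L_def unit_cube_def abs_mult)
  have f_mem: "f x \<in> topspace ?\<Sigma>" if x: "x \<in> unit_cube (card I)" for x
  proof -
    obtain \<phi> where "\<phi> \<in> band_Hom B tropical" "\<forall>i<length as. \<phi> (as ! i) = s i (L x)"
      using sec(2)[of "L x", OF L_box[OF x]] by blast
    moreover from this have "f x = (\<lambda>i\<in>?N. \<phi> (as ! i))"
      by (auto simp: f_def)
    ultimately show ?thesis
      unfolding topspace_Sigma_space[OF B] by blast
  qed
  have cont_L: "continuous_on A L" for A
  proof (intro continuous_on_coordinatewise_then_product)
    show "continuous_on A (\<lambda>x. L x i)" for i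
      by (cases "i \<in> I") (auto simp: L_def
        intro!: continuous_intros continuous_on_subset[OF continuous_on_product_coordinates])
  qed
  have "continuous_map ?C (product_topology (\<lambda>_. top_of_set {0..}) ?N) f"
    unfolding continuous_map_componentwise
  proof (intro conjI ballI)
    show "f ` topspace ?C \<subseteq> extensional ?N"
      by (auto simp: f_def)
    fix i assume i: "i \<in> ?N"
    have "continuous_on (unit_cube (card I)) (\<lambda>x. s i (L x))"
      using i by (intro continuous_on_compose2[OF s(1) cont_L]) auto
    moreover have "s i (L x) \<ge> 0" if "x \<in> unit_cube (card I)" for x
    proof -
      have "f x i \<in> {0..}"
        using f_mem[OF that] i unfolding Sigma_space_def by (auto simp: PiE_iff)
      then show ?thesis
        using i by (simp add: f_def)
    qed
    ultimately show "continuous_map ?C (top_of_set {0..}) (\<lambda>x. f x i)"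
      using i by (auto simp: f_def continuous_map_in_subtopology)
  qed
  then have f: "continuous_map ?C ?\<Sigma> f"
    using f_mem unfolding Sigma_space_def by (auto simp: continuous_map_in_subtopology)
  have "g y \<in> unit_cube (card I)" for y
  proof -
    have "0 \<le> g y j \<and> g y j \<le> 1" if "j < card I" for j
    proof -
      define z where "z = max (lo (h j)) (min (hi (h j)) (y (h j)))"
      have "lo (h j) \<le> z" "z \<le> hi (h j)" "0 < z"
        using lo_hi[of "h j"] by (auto simp: z_def)
      then have "- (c (h j) + \<epsilon>) \<le> ln z" "ln z \<le> - c (h j)"
        using lo_hi[of "h j"] by (simp_all add: lo_def hi_def ln_ge_iff) (metis exp_gt_zero ln_exp ln_mono)
      then show ?thesis
        using that sec(1) by (simp add: g_def flip: z_def)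
    qed
    then show ?thesis
      by (simp add: unit_cube_def g_def)
  qed
  moreover have "continuous_map ?\<Sigma> (powertop_real UNIV) g"
    unfolding continuous_map_componentwise
  proof (intro conjI ballI)
    fix j
    show "continuous_map ?\<Sigma> euclideanreal (\<lambda>y. g y j)"
    proof (cases "j < card I")
      case True
      then have hj: "h j \<in> ?N"
        using idx_h I by blast
      have "continuous_map (product_topology (\<lambda>_. top_of_set {0::real..}) ?N) (top_of_set {0..}) (\<lambda>y. y (h j))"
        using hj by (rule continuous_map_product_projection)
      then have "continuous_map ?\<Sigma> (top_of_set {0..}) (\<lambda>y. y (h j))"
        unfolding Sigma_space_def by (rule continuous_map_from_subtopology)
      then have proj: "continuous_map ?\<Sigma> euclideanreal (\<lambda>y. y (h j))"
        by (simp add: continuous_map_in_subtopology)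
      have "continuous_on UNIV (\<lambda>z. (- ln (max (lo (h j)) (min (hi (h j)) z)) - c (h j)) / \<epsilon>)"
        using lo_hi(1)[of "h j"] sec(1) by (intro continuous_intros) auto
      then have "continuous_map euclideanreal euclideanreal
          (\<lambda>z. (- ln (max (lo (h j)) (min (hi (h j)) z)) - c (h j)) / \<epsilon>)"
        by simp
      from continuous_map_compose[OF proj this] show ?thesis
        using True by (simp add: g_def o_def)
    qed (simp add: g_def)
  qed auto
  ultimately have g: "continuous_map ?\<Sigma> ?C g"
    by (auto simp: continuous_map_in_subtopology euclidean_product_topology)
  have "g (f x) = x" if x: "x \<in> unit_cube (card I)" for x
  proof
    fix j show "g (f x) j = x j"
    proof (cases "j < card I")
      case True
      let ?i = "h j"
      have "?i \<in> I" "?i \<in> ?N"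
        using True idx_h I by auto
      then have "f x ?i = exp (- (c ?i + \<epsilon> * x j))"
        using True idx_h(1) by (simp add: f_def s(2) L_def)
      moreover have "0 \<le> x j" "x j \<le> 1"
        using x True by (auto simp: unit_cube_def)
      moreover from this have "0 \<le> \<epsilon> * x j" "\<epsilon> * x j \<le> \<epsilon>"
        using sec(1) by (simp_all add: mult_left_le)
      ultimately have "max (lo ?i) (min (hi ?i) (f x ?i)) = exp (- (c ?i + \<epsilon> * x j))"
        by (simp add: lo_def hi_def max_absorb2 min_absorb2)
      then show ?thesis
        using True sec(1) by (simp add: g_def)
    qed (use x in \<open>simp add: g_def unit_cube_def\<close>)
  qed
  then have "covering_dim_le ?C n"
    using covering_dim_le_retract[OF dim g f] by simp
  then show ?thesis
    by (rule covering_dim_le_unit_cube)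
qed

section \<open>Tropical points from field-valued points of a band\<close>

lemma (in field) alg_independent_nonzero:
  assumes "subring k R" "finite I" "u \<in> I \<rightarrow> carrier R" "alg_independent R {\<zero>} k u I" "i \<in> I"
  shows "u i \<noteq> \<zero>"
proof
  assume 0: "u i = \<zero>"
  let ?e = "\<lambda>j. if j = i then 1 else 0 :: nat"
  have "power_prod R u I ?e = \<zero>"
    using power_prod_single[OF assms(2,5,3), of 1] 0 assms(3,5) by simp
  then have "(\<Oplus>e\<in>{?e}. \<one> \<otimes> power_prod R u I e) \<in> {\<zero>}"
    by simp
  moreover have "{?e} \<subseteq> exponents I"
    using assms(5) by (auto simp: exponents_def)
  ultimately have "\<one> = \<zero>"
    using subringE(3)[OF assms(1)] by (intro alg_independentD[OF assms(4), of "{?e}" "\<lambda>_. \<one>" ?e]) auto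
  then show False
    by simp
qed

text \<open>In the application \<open>L\<close> is the residue field of a prime of
  \<open>rho K B\<close>, and \<open>\<beta> b\<close> is the image of the basis element
  \<open>b\<close>.\<close>

locale band_point = band B + L: field L for B :: "('a, 'm) band_scheme" and L :: "('l, 'n) ring_scheme" +
  fixes \<beta> :: "'a \<Rightarrow> 'l"
  assumes \<beta>_closed: "a \<in> carrier B \<Longrightarrow> \<beta> a \<in> carrier L"
    and \<beta>_mult: "a \<in> carrier B \<Longrightarrow> b \<in> carrier B \<Longrightarrow> \<beta> (a \<otimes>\<^bsub>B\<^esub> b) = \<beta> a \<otimes>\<^bsub>L\<^esub> \<beta> b"
    and \<beta>_one: "\<beta> \<one>\<^bsub>B\<^esub> = \<one>\<^bsub>L\<^esub>" and \<beta>_zero: "\<beta> (pzero B) = \<zero>\<^bsub>L\<^esub>"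
    and \<beta>_null: "N \<in> nullset B \<Longrightarrow> (\<Oplus>\<^bsub>L\<^esub>b\<in>set_mset N. [count N b] \<cdot>\<^bsub>L\<^esub> \<beta> b) = \<zero>\<^bsub>L\<^esub>"
begin

text \<open>Taking \<open>exp (- v b)\<close> turns sums of valuations into products and least
  valuations into greatest tropical values. Real values are demanded only for the generators: the
  elements that are sent to zero or have a value form a submonoid, as \<open>has_value_mult\<close>
  shows.\<close>

lemma tropical_point_of_valuation:
  assumes gen: "generators B as"
    and val: "monomial_valuation L A k u I l"
    and gen_val: "\<And>i. i < length as \<Longrightarrow> \<beta> (as ! i) \<noteq> \<zero>\<^bsub>L\<^esub> \<Longrightarrow>
      \<exists>s\<in>V i. monomial_valuation.has_value L A u I l (\<beta> (as ! i)) s"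
  obtains \<phi> where "\<phi> \<in> band_Hom B tropical"
    "\<And>i. i < length as \<Longrightarrow> \<beta> (as ! i) = \<zero>\<^bsub>L\<^esub> \<Longrightarrow> \<phi> (as ! i) = 0"
    "\<And>i. i < length as \<Longrightarrow> \<beta> (as ! i) \<noteq> \<zero>\<^bsub>L\<^esub> \<Longrightarrow> \<exists>s\<in>V i. \<phi> (as ! i) = exp (- s)"
proof -
  interpret V: monomial_valuation L A k u I l
    by (rule val)
  have as: "as ! i \<in> carrier B" if "i < length as" for i
    using gen that by (auto simp: generators_def)
  let ?H = "{b \<in> carrier B. \<beta> b = \<zero>\<^bsub>L\<^esub> \<or> (\<exists>s. V.has_value (\<beta> b) s)}"
  have "submonoid ?H B"
  proof
    show "\<one>\<^bsub>B\<^esub> \<in> ?H"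
      using V.has_value_one by (auto simp: \<beta>_one)
    fix a b assume ab: "a \<in> ?H" "b \<in> ?H"
    show "a \<otimes>\<^bsub>B\<^esub> b \<in> ?H"
    proof (cases "\<beta> a = \<zero>\<^bsub>L\<^esub> \<or> \<beta> b = \<zero>\<^bsub>L\<^esub>")
      case True
      with ab show ?thesis
        by (auto simp: \<beta>_mult \<beta>_closed)
    next
      case False
      with ab obtain s s' where "V.has_value (\<beta> a) s" "V.has_value (\<beta> b) s'"
        by blast
      then have "V.has_value (\<beta> (a \<otimes>\<^bsub>B\<^esub> b)) (s + s')"
        using ab V.has_value_mult by (simp add: \<beta>_mult)
      with ab show ?thesis
        by blast
    qed
  qed auto
  moreover have "pzero B \<in> ?H"
    by (simp add: pzero_closed \<beta>_zero)
  moreover have "as ! i \<in> ?H" if "i < length as" for i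
    using gen_val[OF that] as[OF that] by blast
  ultimately have H: "\<beta> b = \<zero>\<^bsub>L\<^esub> \<or> (\<exists>s. V.has_value (\<beta> b) s)" if "b \<in> carrier B" for b
    using generators_induct[OF gen, of ?H b] that by blast
  define v where "v b = (THE s. V.has_value (\<beta> b) s)" for b
  have v: "V.has_value (\<beta> b) s \<Longrightarrow> v b = s" for b s
    unfolding v_def using V.has_value_unique by blast
  have hv: "V.has_value (\<beta> b) (v b)" if "b \<in> carrier B" "\<beta> b \<noteq> \<zero>\<^bsub>L\<^esub>" for b
    using H[OF that(1)] that(2) v by blast
  define \<phi> where "\<phi> = (\<lambda>b\<in>carrier B. if \<beta> b = \<zero>\<^bsub>L\<^esub> then 0 else exp (- v b))"
  have "\<phi> \<in> band_Hom B tropical"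
    unfolding band_Hom_tropical_iff
  proof (intro conjI ballI)
    fix a b assume ab: "a \<in> carrier B" "b \<in> carrier B"
    show "\<phi> (a \<otimes>\<^bsub>B\<^esub> b) = \<phi> a * \<phi> b"
    proof (cases "\<beta> a = \<zero>\<^bsub>L\<^esub> \<or> \<beta> b = \<zero>\<^bsub>L\<^esub>")
      case True
      with ab show ?thesis
        by (auto simp: \<phi>_def \<beta>_mult \<beta>_closed)
    next
      case False
      then have "v (a \<otimes>\<^bsub>B\<^esub> b) = v a + v b"
        using ab V.has_value_mult[OF hv hv] by (intro v) (simp add: \<beta>_mult)
      with False ab show ?thesis
        by (simp add: \<phi>_def \<beta>_mult \<beta>_closed L.integral_iff exp_add[symmetric])
    qed
  next
    show "\<phi> \<one>\<^bsub>B\<^esub> = 1"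
      using v[of "\<one>\<^bsub>B\<^esub>" 0] V.has_value_one by (simp add: \<phi>_def \<beta>_one)
  next
    fix N b assume N: "N \<in> nullset B" "b \<in># N"
    have carr: "c \<in> carrier B" if "c \<in># N" for c
      using nullset_subset[OF N(1)] that by blast
    \<comment> \<open>An entry of multiplicity at least two is its own rival. For multiplicity one,
      the term of \<open>b\<close> in the vanishing sum is \<open>\<beta> b\<close> itself, and
      \<open>zero_sum_dominated\<close> provides the rival.\<close>
    show "\<phi> b = 0 \<or> (\<exists>b'\<in>#N - {#b#}. \<phi> b \<le> \<phi> b')"
    proof (cases "\<beta> b = \<zero>\<^bsub>L\<^esub> \<or> 2 \<le> count N b")
      case True
      then show ?thesis
      proof
        assume "2 \<le> count N b"
        then have "b \<in># N - {#b#}"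
          by (simp flip: count_greater_zero_iff)
        then show ?thesis
          by blast
      qed (use carr[OF N(2)] in \<open>simp add: \<phi>_def\<close>)
    next
      case False
      then have "count N b = 1"
        using N(2) unfolding count_greater_zero_iff[symmetric] by linarith
      define \<tau> where "\<tau> c = [count N c] \<cdot>\<^bsub>L\<^esub> \<beta> c" for c
      have \<tau>: "\<tau> \<in> set_mset N \<rightarrow> carrier L"
        using carr \<beta>_closed by (auto simp: \<tau>_def)
      have "\<tau> b = \<beta> b"
        using \<open>count N b = 1\<close> carr[OF N(2)] \<beta>_closed by (simp add: \<tau>_def)
      then obtain b' where b': "b' \<in># N" "b' \<noteq> b" "\<tau> b' \<noteq> \<zero>\<^bsub>L\<^esub>" "V.divides (\<tau> b') (\<beta> b)"
        using V.zero_sum_dominated[OF _ \<tau> _ N(2)] \<beta>_null[OF N(1)] False by (auto simp: \<tau>_def)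
      have nz: "\<beta> b' \<noteq> \<zero>\<^bsub>L\<^esub>"
        using b'(3) by (auto simp: \<tau>_def)
      \<comment> \<open>The multiplicity of \<open>b'\<close> is an element of \<open>A\<close>, so
        the term \<open>\<tau> b'\<close> has at least the valuation of \<open>\<beta> b'\<close>.
        This passes the comparison from the term to \<open>b'\<close>, in any
        characteristic.\<close>
      have "[n] \<cdot>\<^bsub>L\<^esub> \<one>\<^bsub>L\<^esub> \<in> A" for n :: nat
        using subringE(2,3,7)[OF V.subring_A] by (induction n) auto
      moreover have "\<tau> b' = ([count N b'] \<cdot>\<^bsub>L\<^esub> \<one>\<^bsub>L\<^esub>) \<otimes>\<^bsub>L\<^esub> \<beta> b'"
        using carr[OF b'(1)] \<beta>_closed by (simp add: \<tau>_def L.add_pow_ldistr)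
      ultimately have "V.divides (\<beta> b') (\<tau> b')"
        unfolding V.divides_def by blast
      then have "V.divides (\<beta> b') (\<beta> b)"
        using V.divides_trans b'(4) carr[OF b'(1)] \<beta>_closed by blast
      then have "v b' \<le> v b"
        using V.has_value_divides_iff[OF hv hv] carr[OF b'(1)] carr[OF N(2)] nz False by blast
      then have "\<phi> b \<le> \<phi> b'"
        using carr[OF b'(1)] carr[OF N(2)] nz False by (simp add: \<phi>_def)
      moreover have "b' \<in># N - {#b#}"
        using b'(1,2) by (simp add: in_diff_count)
      ultimately show ?thesis
        by blast
    qed
  qed (auto simp: \<phi>_def \<beta>_zero pzero_closed)
  moreover have "\<phi> (as ! i) = 0" if "i < length as" "\<beta> (as ! i) = \<zero>\<^bsub>L\<^esub>" for i
    using that as by (simp add: \<phi>_def)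
  moreover have "\<exists>s\<in>V i. \<phi> (as ! i) = exp (- s)" if i: "i < length as" "\<beta> (as ! i) \<noteq> \<zero>\<^bsub>L\<^esub>" for i
  proof -
    obtain s where "s \<in> V i" "V.has_value (\<beta> (as ! i)) s"
      using gen_val[OF i] by blast
    then show ?thesis
      using v i as by (auto simp: \<phi>_def)
  qed
  ultimately show thesis
    by (rule that)
qed

lemma card_maximal_independent_le:
  assumes gen: "generators B as" and k: "subfield k L" and I: "I \<subseteq> {..<length as}"
    and ind: "alg_independent L {\<zero>\<^bsub>L\<^esub>} k (\<lambda>i. \<beta> (as ! i)) I"
    and max: "\<And>i. i < length as \<Longrightarrow> i \<notin> I \<Longrightarrow>
      \<not> alg_independent L {\<zero>\<^bsub>L\<^esub>} k (\<lambda>i. \<beta> (as ! i)) (insert i I)"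
    and dim: "covering_dim_le (Sigma_space B as) n"
  shows "int (card I) \<le> n"
proof -
  let ?u = "\<lambda>i. \<beta> (as ! i)" and ?J = "{i. i < length as \<and> i \<notin> I}"
  have sk: "subring k L"
    by (rule subfieldE(1)[OF k])
  have finI: "finite I"
    using I finite_subset by blast
  have as: "as ! i \<in> carrier B" if "i < length as" for i
    using gen that by (auto simp: generators_def)
  have u: "?u i \<in> carrier L" if "i < length as" for i
    using as[OF that] by (rule \<beta>_closed)
  have uI: "?u \<in> I \<rightarrow> carrier L"
    using I u by auto
  have uI': "?u \<in> I \<rightarrow> carrier L - {\<zero>\<^bsub>L\<^esub>}"
    using uI L.alg_independent_nonzero[OF sk finI uI ind] by auto
  have "\<forall>i\<in>?J. \<exists>E c. finite E \<and> E \<subseteq> exponents (insert i I) \<and> c \<in> E \<rightarrow> k \<and>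
      (\<Oplus>\<^bsub>L\<^esub>e\<in>E. c e \<otimes>\<^bsub>L\<^esub> power_prod L ?u (insert i I) e) = \<zero>\<^bsub>L\<^esub> \<and> (\<exists>e\<in>E. c e \<noteq> \<zero>\<^bsub>L\<^esub>)"
    using max unfolding alg_independent_def by auto
  from bchoice[OF this] obtain E where "\<forall>i\<in>?J. \<exists>c. finite (E i) \<and> E i \<subseteq> exponents (insert i I) \<and>
      c \<in> E i \<rightarrow> k \<and> (\<Oplus>\<^bsub>L\<^esub>e\<in>E i. c e \<otimes>\<^bsub>L\<^esub> power_prod L ?u (insert i I) e) = \<zero>\<^bsub>L\<^esub> \<and>
      (\<exists>e\<in>E i. c e \<noteq> \<zero>\<^bsub>L\<^esub>)"
    by (rule exE)
  from bchoice[OF this] obtain c where E': "\<forall>i\<in>?J. finite (E i) \<and> E i \<subseteq> exponents (insert i I) \<and>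
      c i \<in> E i \<rightarrow> k \<and> (\<Oplus>\<^bsub>L\<^esub>e\<in>E i. c i e \<otimes>\<^bsub>L\<^esub> power_prod L ?u (insert i I) e) = \<zero>\<^bsub>L\<^esub> \<and>
      (\<exists>e\<in>E i. c i e \<noteq> \<zero>\<^bsub>L\<^esub>)"
    by (rule exE)
  have E: "finite (E i)" "E i \<subseteq> exponents (insert i I)" "c i \<in> E i \<rightarrow> k"
    "(\<Oplus>\<^bsub>L\<^esub>e\<in>E i. c i e \<otimes>\<^bsub>L\<^esub> power_prod L ?u (insert i I) e) = \<zero>\<^bsub>L\<^esub>"
    "\<exists>e\<in>E i. c i e \<noteq> \<zero>\<^bsub>L\<^esub>" if "i \<in> ?J" for i
    using E' that by blast+
  \<comment> \<open>For pairs with equal exponents at \<open>i\<close> the quotient is 0 by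
    convention. Such extra candidates do no harm: \<open>C i\<close> has to be a finite set of
    continuous functions that contains the true coordinate.\<close>
  define slope where "slope i p l = (weight I l (snd p) - weight I l (fst p)) / (real (fst p i) - real (snd p i))"
    for i :: nat and p :: "(nat \<Rightarrow> nat) \<times> (nat \<Rightarrow> nat)" and l
  define C where "C i = (if i \<in> I then {\<lambda>l. exp (- l i)} else if ?u i = \<zero>\<^bsub>L\<^esub> then {\<lambda>_. 0}
      else (\<lambda>p l. exp (- slope i p l)) ` (E i \<times> E i))" for i
  have finC: "finite (C i)" if "i < length as" for i
    using E(1) that by (auto simp: C_def)
  have contC: "continuous_on UNIV h" if "i < length as" "h \<in> C i" for i h
  proof -
    have "continuous_on UNIV (\<lambda>l :: nat \<Rightarrow> real. exp (- l i))"
      by (intro continuous_on_exp continuous_on_minus continuous_on_product_coordinates)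
    moreover have "continuous_on UNIV (\<lambda>l. exp (- slope i p l))" for p
      unfolding slope_def divide_inverse by (intro continuous_intros continuous_weight)
    ultimately show ?thesis
      using that(2) by (auto simp: C_def split: if_splits)
  qed
  define F where "F s = {l. \<exists>\<phi>\<in>band_Hom B tropical. \<forall>i<length as. \<phi> (as ! i) = s i l}"
    for s :: "nat \<Rightarrow> (nat \<Rightarrow> real) \<Rightarrow> real"
  let ?S = "PiE {..<length as} C"
  \<comment> \<open>The pairs of exponents on whose hyperplanes the genericity assumption of
    \<open>has_value_of_relation\<close> could fail.\<close>
  define D where "D = (\<Union>i\<in>?J. {p \<in> E i \<times> E i. \<exists>j\<in>I. fst p j \<noteq> snd p j})"
  define H where "H p = {l. weight I l (fst p) = weight I l (snd p)}" for p :: "(nat \<Rightarrow> nat) \<times> (nat \<Rightarrow> nat)"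
  have "finite D"
    unfolding D_def using E(1) by (intro finite_UN_I) auto
  have "finite ?S"
    by (intro finite_PiE) (auto intro: finC)
  have cover: "l \<in> \<Union>(F ` ?S \<union> H ` D)" for l
  proof (cases "l \<in> \<Union>(H ` D)")
    case False
    obtain A where val: "monomial_valuation L A k ?u I l"
      by (rule L.monomial_valuation_exists[OF k finI uI' ind])
    then interpret V: monomial_valuation L A k ?u I l .
    define Val where "Val i = (if i \<in> I then {l i} else (\<lambda>p. slope i p l) ` (E i \<times> E i))" for i
    have "\<exists>s\<in>Val i. V.has_value (?u i) s" if i: "i < length as" "?u i \<noteq> \<zero>\<^bsub>L\<^esub>" for i
    proof (cases "i \<in> I")
      case True
      let ?e = "\<lambda>j. if j = i then 1 else 0 :: nat"
      have "power_prod L ?u I ?e = ?u i"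
        using L.power_prod_single[OF finI True uI, of 1] u[OF i(1)] by simp
      moreover have "weight I l ?e = l i" "weight I l (\<lambda>_. 0) = 0"
        using True finI by (simp_all add: weight_def if_distrib cong: if_cong)
      moreover have "?u i [^]\<^bsub>L\<^esub> (1::nat) \<otimes>\<^bsub>L\<^esub> power_prod L ?u I (\<lambda>_. 0) = ?u i"
        using u[OF i(1)] L.power_prod_zero[OF uI] by simp
      ultimately have "V.has_value (?u i) (l i)"
        unfolding V.has_value_def using u[OF i(1)] i(2)
        by (intro conjI exI[of _ "1::nat"] exI[of _ "\<lambda>_. 0::nat"] exI[of _ ?e])
          (auto simp: V.assoc_to_def V.divides_refl)
      with True show ?thesis
        by (simp add: Val_def)
    next
      case False
      with i have iJ: "i \<in> ?J"
        by simp
      then obtain e\<^sub>0 where e0: "e\<^sub>0 \<in> E i" "c i e\<^sub>0 \<noteq> \<zero>\<^bsub>L\<^esub>"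
        using E(5)[OF iJ] by blast
      have generic: "weight I l e \<noteq> weight I l f" if "e \<in> E i" "f \<in> E i" "\<exists>j\<in>I. e j \<noteq> f j" for e f
      proof -
        have "(e, f) \<in> D"
          using that iJ by (auto simp: D_def)
        then show ?thesis
          using \<open>l \<notin> \<Union>(H ` D)\<close> by (force simp: H_def)
      qed
      have "\<exists>e\<in>E i. \<exists>f\<in>E i. f i < e i \<and>
          V.has_value (?u i) ((weight I l f - weight I l e) / (real (e i) - real (f i)))"
        by (rule V.has_value_of_relation[OF False _ E(1)[OF iJ] E(3)[OF iJ] E(4)[OF iJ] e0 E(2)[OF iJ] generic])
          (use i u in auto)
      then obtain e f where "e \<in> E i" "f \<in> E i"
        "V.has_value (?u i) ((weight I l f - weight I l e) / (real (e i) - real (f i)))"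
        by blast
      then show ?thesis
        using False by (force simp: Val_def slope_def)
    qed
    then have "\<exists>\<phi>\<in>band_Hom B tropical.
      (\<forall>i<length as. ?u i = \<zero>\<^bsub>L\<^esub> \<longrightarrow> \<phi> (as ! i) = 0) \<and>
      (\<forall>i<length as. ?u i \<noteq> \<zero>\<^bsub>L\<^esub> \<longrightarrow> (\<exists>s\<in>Val i. \<phi> (as ! i) = exp (- s)))"
      by (rule tropical_point_of_valuation[OF gen val]) blast+
    then obtain \<phi> where \<phi>: "\<phi> \<in> band_Hom B tropical"
      "\<forall>i<length as. ?u i = \<zero>\<^bsub>L\<^esub> \<longrightarrow> \<phi> (as ! i) = 0"
      "\<forall>i<length as. ?u i \<noteq> \<zero>\<^bsub>L\<^esub> \<longrightarrow> (\<exists>s\<in>Val i. \<phi> (as ! i) = exp (- s))"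
      by (elim bexE conjE) (rule that)
    have "\<exists>h\<in>C i. \<phi> (as ! i) = h l" if "i < length as" for i
    proof (cases "?u i = \<zero>\<^bsub>L\<^esub>")
      case True
      then have "i \<notin> I"
        using uI' by auto
      with True \<phi>(2) that show ?thesis
        by (simp add: C_def)
    next
      case False
      then obtain s where "s \<in> Val i" "\<phi> (as ! i) = exp (- s)"
        using \<phi>(3) \<open>i < length as\<close> by blast
      with False show ?thesis
        by (auto simp: C_def Val_def split: if_splits)
    qed
    then obtain s where s: "\<And>i. i < length as \<Longrightarrow> s i \<in> C i \<and> \<phi> (as ! i) = s i l"
      by metis
    then have "restrict s {..<length as} \<in> ?S" "l \<in> F (restrict s {..<length as})"
      using \<phi>(1) by (auto simp: F_def)
    then show ?thesis
      by blast
  qed blast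
  have "\<exists>G\<in>F ` ?S \<union> H ` D. interior G \<noteq> {}"
  proof (rule finite_closed_cover_interior)
    show "finite (F ` ?S \<union> H ` D)"
      using \<open>finite D\<close> \<open>finite ?S\<close> by blast
    show "\<Union>(F ` ?S \<union> H ` D) = UNIV"
      using cover by blast
    fix G assume "G \<in> F ` ?S \<union> H ` D"
    then show "closed G"
    proof
      assume "G \<in> F ` ?S"
      then show "closed G"
        unfolding F_def using contC by (auto intro!: closed_Sigma_section[OF gen] simp: PiE_iff)
    qed (auto simp: H_def closed_weight_eq)
  qed
  \<comment> \<open>The hyperplanes drop out, so the member with interior points is one of the sets
    \<open>F s\<close>: a single tuple of formulas is valid near \<open>x\<close>.\<close>
  moreover have "interior (H p) = {}" if "p \<in> D" for p
    using that weight_eq_interior_empty[OF finI] by (auto simp: D_def H_def)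
  ultimately obtain s where s: "s \<in> ?S" "interior (F s) \<noteq> {}"
    by blast
  then obtain x where "x \<in> interior (F s)"
    by blast
  then obtain \<delta> where \<delta>: "\<delta> > 0" "ball x \<delta> \<subseteq> F s"
    unfolding mem_interior by blast
  \<comment> \<open>The weights are functions on all of \<open>nat\<close>. A box that restricts
    every coordinate at once still fits into the metric ball.\<close>
  obtain \<epsilon> where \<epsilon>: "\<epsilon> > 0" "\<And>x y :: nat \<Rightarrow> real. (\<And>i. \<bar>x i - y i\<bar> \<le> \<epsilon>) \<Longrightarrow> dist x y < \<delta>"
    using dist_le_of_coordinates[OF \<delta>(1)] by metis
  show ?thesis
  proof (rule covering_dim_le_of_section[OF band_axioms gen I _ _ \<epsilon>(1) _ dim])
    show "continuous_on UNIV (s i)" if "i < length as" for i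
      using s(1) contC that by (auto simp: PiE_iff)
    show "s i = (\<lambda>l. exp (- l i))" if "i \<in> I" for i
      using s(1) I that by (force simp: PiE_iff C_def)
    fix l assume "\<And>i. \<bar>l i - x i\<bar> \<le> \<epsilon>"
    then have "l \<in> ball x \<delta>"
      using \<epsilon>(2)[of l x] by (simp add: dist_commute)
    then show "\<exists>\<phi>\<in>band_Hom B tropical. \<forall>i<length as. \<phi> (as ! i) = s i l"
      using \<delta>(2) by (auto simp: F_def)
  qed
qed

text \<open>It suffices to bound a maximal independent set of generators containing \<open>I\<close>.\<close>

theorem card_independent_le:
  assumes gen: "generators B as" and k: "subfield k L" and I: "I \<subseteq> {..<length as}"
    and ind: "alg_independent L {\<zero>\<^bsub>L\<^esub>} k (\<lambda>i. \<beta> (as ! i)) I"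
    and dim: "covering_dim_le (Sigma_space B as) n"
  shows "int (card I) \<le> n"
proof -
  let ?P = "\<lambda>J. I \<subseteq> J \<and> J \<subseteq> {..<length as} \<and> alg_independent L {\<zero>\<^bsub>L\<^esub>} k (\<lambda>i. \<beta> (as ! i)) J"
  have "finite {J. ?P J}"
    by (rule finite_subset[of _ "Pow {..<length as}"]) auto
  moreover have "{J. ?P J} \<noteq> {}"
    using I ind by blast
  ultimately have "\<exists>J\<in>{J. ?P J}. \<forall>J'\<in>{J. ?P J}. J \<subseteq> J' \<longrightarrow> J = J'"
    by (rule finite_has_maximal)
  then obtain J where J: "?P J" and max: "\<forall>J'\<in>{J. ?P J}. J \<subseteq> J' \<longrightarrow> J = J'"
    by (elim bexE) (simp only: mem_Collect_eq)
  have "int (card J) \<le> n"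
  proof (rule card_maximal_independent_le[OF gen k _ _ _ dim])
    show "\<not> alg_independent L {\<zero>\<^bsub>L\<^esub>} k (\<lambda>i. \<beta> (as ! i)) (insert i J)" if "i < length as" "i \<notin> J" for i
    proof
      assume "alg_independent L {\<zero>\<^bsub>L\<^esub>} k (\<lambda>i. \<beta> (as ! i)) (insert i J)"
      then have "insert i J \<in> {J. ?P J}"
        using J that(1) by auto
      then have "J = insert i J"
        using max by blast
      with that(2) show False
        by blast
    qed
  qed (use J in auto)
  moreover have "card I \<le> card J"
    using J by (intro card_mono) (auto intro: finite_subset)
  ultimately show ?thesis
    by linarith
qed

end


section \<open>Chains of primes and algebraic independence\<close>

lemma alg_independent_antimono:
  "alg_independent R Q k u I \<Longrightarrow> P \<subseteq> Q \<Longrightarrow> alg_independent R P k u I"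
  unfolding alg_independent_def by blast

context ring_hom_cring
begin

lemma hom_power_prod:
  assumes "u \<in> I \<rightarrow> carrier R"
  shows "h (power_prod R u I e) = power_prod S (\<lambda>i. h (u i)) I e"
proof -
  have "h (power_prod R u I e) = (\<Otimes>\<^bsub>S\<^esub>i\<in>I. (h \<circ> (\<lambda>i. u i [^] e i)) i)"
    unfolding power_prod_def using assms by (intro hom_finprod) auto
  also have "\<dots> = power_prod S (\<lambda>i. h (u i)) I e"
    unfolding power_prod_def using assms
    by (intro S.finprod_cong') (auto simp: ring.hom_nat_pow Pi_iff)
  finally show ?thesis .
qed

lemma hom_poly:
  assumes "u \<in> I \<rightarrow> carrier R" "c \<in> E \<rightarrow> carrier R"
  shows "h (\<Oplus>e\<in>E. c e \<otimes> power_prod R u I e) =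
    (\<Oplus>\<^bsub>S\<^esub>e\<in>E. h (c e) \<otimes>\<^bsub>S\<^esub> power_prod S (\<lambda>i. h (u i)) I e)"
proof -
  have "h (\<Oplus>e\<in>E. c e \<otimes> power_prod R u I e) =
      (\<Oplus>\<^bsub>S\<^esub>e\<in>E. (h \<circ> (\<lambda>e. c e \<otimes> power_prod R u I e)) e)"
    using assms by (intro hom_finsum) auto
  also have "\<dots> = (\<Oplus>\<^bsub>S\<^esub>e\<in>E. h (c e) \<otimes>\<^bsub>S\<^esub> power_prod S (\<lambda>i. h (u i)) I e)"
    using assms by (intro S.finsum_cong') (auto simp: hom_power_prod[OF assms(1)] Pi_iff)
  finally show ?thesis .
qed

text \<open>A relation in the image lifts to one with coefficients in \<open>k\<close>; its value
  lies in the kernel, hence in \<open>P\<close>.\<close>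

lemma alg_independent_image:
  assumes ind: "alg_independent R P k u I" and "k \<subseteq> carrier R" "u \<in> I \<rightarrow> carrier R"
    and kernel: "\<And>x. x \<in> carrier R \<Longrightarrow> h x = \<zero>\<^bsub>S\<^esub> \<Longrightarrow> x \<in> P"
  shows "alg_independent S {\<zero>\<^bsub>S\<^esub>} (h ` k) (\<lambda>i. h (u i)) I"
  unfolding alg_independent_def
proof (intro allI impI ballI)
  fix E c e
  assume E: "finite E" "E \<subseteq> exponents I" "c \<in> E \<rightarrow> h ` k" "e \<in> E"
    and sum: "(\<Oplus>\<^bsub>S\<^esub>e\<in>E. c e \<otimes>\<^bsub>S\<^esub> power_prod S (\<lambda>i. h (u i)) I e) \<in> {\<zero>\<^bsub>S\<^esub>}"
  have "\<forall>e\<in>E. \<exists>d. d \<in> k \<and> c e = h d"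
    using E(3) by blast
  from bchoice[OF this] obtain d where "\<forall>e\<in>E. d e \<in> k \<and> c e = h (d e)"
    by (rule exE)
  then have d: "d \<in> E \<rightarrow> k" "\<And>e. e \<in> E \<Longrightarrow> c e = h (d e)"
    by blast+
  have dc: "d \<in> E \<rightarrow> carrier R"
    using d(1) assms(2) by blast
  have "h (\<Oplus>e\<in>E. d e \<otimes> power_prod R u I e) =
      (\<Oplus>\<^bsub>S\<^esub>e\<in>E. h (d e) \<otimes>\<^bsub>S\<^esub> power_prod S (\<lambda>i. h (u i)) I e)"
    by (rule hom_poly[OF assms(3) dc])
  also have "\<dots> = (\<Oplus>\<^bsub>S\<^esub>e\<in>E. c e \<otimes>\<^bsub>S\<^esub> power_prod S (\<lambda>i. h (u i)) I e)"
    using dc d(2) assms(3) by (intro S.finsum_cong') (auto simp: Pi_iff)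
  finally have "h (\<Oplus>e\<in>E. d e \<otimes> power_prod R u I e) = \<zero>\<^bsub>S\<^esub>"
    using sum by simp
  moreover have "(\<Oplus>e\<in>E. d e \<otimes> power_prod R u I e) \<in> carrier R"
    using dc assms(3) by (intro R.finsum_closed) (auto simp: Pi_iff)
  ultimately have "(\<Oplus>e\<in>E. d e \<otimes> power_prod R u I e) \<in> P"
    by (intro kernel)
  then have "d e = \<zero>"
    using alg_independentD[OF ind E(1,2) d(1) _ E(4)] by blast
  then show "c e = \<zero>\<^bsub>S\<^esub>"
    using d(2)[OF E(4)] by simp
qed

end

text \<open>Coefficient lists begin with the leading coefficient, hence the reversed range.\<close>

lemma (in ring) eval_map_rev:
  fixes n :: nat
  assumes "x \<in> carrier R" "g \<in> {..n} \<rightarrow> carrier R"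
  shows "eval (map g (rev [0..<Suc n])) x = (\<Oplus>i\<in>{..n}. g i \<otimes> (x [^] i))"
  using assms(2)
proof (induction n)
  case (Suc n)
  have eq: "map g (rev [0..<Suc (Suc n)]) = g (Suc n) # map g (rev [0..<Suc n])"
    by simp
  have "eval (map g (rev [0..<Suc (Suc n)])) x =
      g (Suc n) \<otimes> (x [^] Suc n) \<oplus> eval (map g (rev [0..<Suc n])) x"
    unfolding eq by simp
  also have "\<dots> = (\<Oplus>i\<in>{..Suc n}. g i \<otimes> (x [^] i))"
    using Suc assms(1) by (subst Suc.IH) (auto simp: finsum_Suc Pi_iff)
  finally show ?case .
qed (use assms in auto)

lemma (in ring) normalize_eq_Nil: "normalize p = [] \<Longrightarrow> set p \<subseteq> {\<zero>}"
  by (induction p) (auto split: if_splits)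

text \<open>Normalizing strips leading zeros without changing values, and the nonzero coefficient
  \<open>g m\<close> prevents the result from being the zero polynomial.\<close>

lemma (in ring) algebraic_of_relation:
  fixes n m :: nat
  assumes "F \<subseteq> carrier R" "x \<in> carrier R" "g \<in> {..n} \<rightarrow> F"
    and "(\<Oplus>i\<in>{..n}. g i \<otimes> (x [^] i)) = \<zero>" "m \<le> n" "g m \<noteq> \<zero>"
  shows "(algebraic over F) x"
proof (rule algebraicI)
  let ?p = "map g (rev [0..<Suc n])"
  have F: "set ?p \<subseteq> F"
    using assms(3) by auto
  show "normalize ?p \<in> carrier (F[X])"
    using normalize_gives_polynomial[OF F] by (simp add: univ_poly_def)
  show "normalize ?p \<noteq> []"
  proof
    assume "normalize ?p = []"
    then have "set ?p \<subseteq> {\<zero>}"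
      by (rule normalize_eq_Nil)
    moreover have "g m \<in> set ?p"
      using assms(5) by (auto simp del: upt_Suc)
    ultimately show False
      using assms(6) by blast
  qed
  have "eval (normalize ?p) x = eval ?p x"
    using F assms(1,2) by (intro eval_normalize) auto
  also have "\<dots> = (\<Oplus>i\<in>{..n}. g i \<otimes> (x [^] i))"
    using assms(1,2,3) by (intro eval_map_rev) auto
  finally show "eval (normalize ?p) x = \<zero>"
    using assms(4) by simp
qed

section \<open>Fractions and algebraic dependence inside a field\<close>

context field
begin

lemma subring_fractions:
  assumes D: "subring D R" and A: "subring A R" "A \<subseteq> D"
  shows "subring {p \<otimes> inv q |p q. p \<in> D \<and> q \<in> A - {\<zero>}} R" (is "subring ?W R")
proof (rule subringI)
  have c: "p \<in> carrier R" "q \<in> carrier R - {\<zero>}" "inv q \<in> carrier R" if "p \<in> D" "q \<in> A - {\<zero>}" for p q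
    using that subringE(1)[OF D] A(2) inv_nonzero[of q] by auto
  show "?W \<subseteq> carrier R"
    using c by auto
  have "\<one> = \<one> \<otimes> inv \<one>" "\<one> \<in> A - {\<zero>}"
    using subringE(3)[OF A(1)] by simp_all
  then show "\<one> \<in> ?W"
    using subringE(3)[OF D] by blast
  fix x assume "x \<in> ?W"
  then obtain p q where p: "p \<in> D" "q \<in> A - {\<zero>}" "x = p \<otimes> inv q"
    by blast
  have "\<ominus> x = \<ominus> p \<otimes> inv q"
    using p(3) c[OF p(1,2)] by (simp add: l_minus)
  then show "\<ominus> x \<in> ?W"
    using p subringE(5)[OF D] by blast
  fix y assume "y \<in> ?W"
  then obtain r s where r: "r \<in> D" "s \<in> A - {\<zero>}" "y = r \<otimes> inv s"
    by blast
  note cp = c[OF p(1,2)] and cr = c[OF r(1,2)]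
  have qs: "q \<otimes> s \<in> A - {\<zero>}"
    using p(2) r(2) cp cr subringE(6)[OF A(1)] by (auto simp: integral_iff)
  have iqs: "inv (q \<otimes> s) = inv q \<otimes> inv s"
    using cp cr by (intro inv_mult_nonzero)
  have "x \<otimes> y = (p \<otimes> r) \<otimes> inv (q \<otimes> s)"
    unfolding p(3) r(3) iqs using cp cr by (simp add: m_ac)
  then show "x \<otimes> y \<in> ?W"
    using qs subringE(6)[OF D p(1) r(1)] by blast
  have "(p \<otimes> s \<oplus> r \<otimes> q) \<otimes> inv (q \<otimes> s) =
      (s \<otimes> inv s) \<otimes> (p \<otimes> inv q) \<oplus> (q \<otimes> inv q) \<otimes> (r \<otimes> inv s)"
    unfolding iqs using cp cr by (simp add: l_distr r_distr m_ac)
  also have "\<dots> = x \<oplus> y"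
    using cp cr p(3) r(3) by (simp add: r_inv_nonzero)
  finally have "x \<oplus> y = (p \<otimes> s \<oplus> r \<otimes> q) \<otimes> inv (q \<otimes> s)" ..
  moreover have "p \<otimes> s \<oplus> r \<otimes> q \<in> D"
    using p r A(2) by (intro subringE(6,7)[OF D]) auto
  ultimately show "x \<oplus> y \<in> ?W"
    using qs by blast
qed

lemma subfield_fractions:
  assumes A: "subring A R"
  shows "subfield {p \<otimes> inv q |p q. p \<in> A \<and> q \<in> A - {\<zero>}} R" (is "subfield ?W R")
proof (rule subfieldI'[OF subring_fractions[OF A A order_refl]])
  fix x assume x: "x \<in> ?W - {\<zero>}"
  then obtain p q where p: "p \<in> A" "q \<in> A - {\<zero>}" "x = p \<otimes> inv q"
    by blast
  have q: "q \<in> carrier R - {\<zero>}" "p \<in> carrier R"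
    using p subringE(1)[OF A] by auto
  then have p0: "p \<in> A - {\<zero>}" "p \<in> carrier R - {\<zero>}"
    using x p inv_nonzero[OF q(1)] by (auto simp: integral_iff)
  have "inv x = inv p \<otimes> inv (inv q)"
    unfolding p(3) using p0(2) inv_nonzero[OF q(1)] by (rule inv_mult_nonzero)
  also have "inv (inv q) = q"
    using q(1) by (simp add: field_Units)
  finally have "inv x = q \<otimes> inv p"
    using q p0 inv_nonzero[OF p0(2)] by (simp add: m_comm)
  then show "inv x \<in> ?W"
    using p p0 by blast
qed

lemma fractions_incl:
  assumes "subring A R" "p \<in> D" "D \<subseteq> carrier R"
  shows "p \<in> {p \<otimes> inv q |p q. p \<in> D \<and> q \<in> A - {\<zero>}}"
proof -
  have "p = p \<otimes> inv \<one>" "\<one> \<in> A - {\<zero>}"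
    using assms subringE(3)[OF assms(1)] by auto
  then show ?thesis
    using assms(2) by blast
qed

lemma subring_poly_span:
  assumes k: "subring k R" and u: "u \<in> I \<rightarrow> carrier R"
  shows "subring (poly_span R k u I (\<lambda>_. True)) R"
proof (rule subringI)
  let ?A = "poly_span R k u I (\<lambda>_. True)"
  show "?A \<subseteq> carrier R"
    by (rule poly_span_carrier[OF k u])
  show "\<one> \<in> ?A"
    using poly_span_monom[OF k u subringE(3)[OF k] exponents_zero, of "\<lambda>_. True"] power_prod_zero[OF u]
    by simp
  show "x \<oplus> y \<in> ?A" "x \<otimes> y \<in> ?A" if "x \<in> ?A" "y \<in> ?A" for x y
    using poly_span_add[OF k u that] poly_span_mult[OF k u that] by simp_all
  show "\<ominus> x \<in> ?A" if "x \<in> ?A" for x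
  proof -
    have "\<ominus> \<one> \<in> k"
      using subringE(3,5)[OF k] by blast
    moreover have "x \<in> carrier R"
      using that poly_span_carrier[OF k u] by blast
    ultimately show ?thesis
      using poly_span_smult[OF k u that] by (metis l_minus l_one one_closed)
  qed
qed

text \<open>Sort a relation by powers of \<open>u i\<close>: the coefficient \<open>g m\<close> of
  the \<open>m\<close>-th power is a polynomial in the \<open>u j\<close> with
  \<open>j \<in> I\<close>, so the relation becomes a univariate one over \<open>F\<close>.\<close>

lemma algebraic_of_dependent:
  assumes k: "subring k R" and I: "finite I" and u: "u \<in> insert i I \<rightarrow> carrier R" and i: "i \<notin> I"
    and ind: "alg_independent R {\<zero>} k u I"
    and dep: "\<not> alg_independent R {\<zero>} k u (insert i I)"
    and F: "poly_span R k u I (\<lambda>_. True) \<subseteq> F" "F \<subseteq> carrier R"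
  shows "(algebraic over F) (u i)"
proof -
  let ?t = "power_prod R u I" and ?z = "u i"
  have uI: "u \<in> I \<rightarrow> carrier R" and z: "?z \<in> carrier R"
    using u by auto
  obtain E c e\<^sub>0 where E: "finite E" "E \<subseteq> exponents (insert i I)" "c \<in> E \<rightarrow> k"
    "(\<Oplus>e\<in>E. c e \<otimes> power_prod R u (insert i I) e) = \<zero>" "e\<^sub>0 \<in> E" "c e\<^sub>0 \<noteq> \<zero>"
    using dep unfolding alg_independent_def by auto
  have cc: "c e \<in> carrier R" if "e \<in> E" for e
    using E(3) that subringE(1)[OF k] by auto
  have tc: "?t e \<in> carrier R" for e
    using uI by simp
  have pp: "power_prod R u (insert i I) e = (?z [^] e i) \<otimes> ?t e" for e
    by (rule power_prod_insert[OF I i u])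
  define Em where "Em m = {e\<in>E. e i = m}" for m
  have finEm: "finite (Em m)" for m
    using E(1) by (simp add: Em_def)
  define g where "g m = (\<Oplus>e\<in>Em m. c e \<otimes> ?t e)" for m
  have gc: "g m \<in> carrier R" for m
    unfolding g_def using cc tc by (intro finsum_closed) (auto simp: Em_def)
  \<comment> \<open>Resetting the exponent of \<open>i\<close> turns the exponents in
    \<open>Em m\<close> into elements of \<open>exponents I\<close>; it is injective there because
    they all agree at \<open>i\<close>.\<close>
  let ?r = "\<lambda>e. e(i := 0)"
  have inj: "inj_on ?r (Em m)" for m
    by (rule inj_onI) (auto simp: Em_def fun_eq_iff, metis)
  have rexp: "?r ` Em m \<subseteq> exponents I" for m
    using E(2) by (auto simp: Em_def exponents_def subset_iff)
  define d where "d m = c \<circ> inv_into (Em m) ?r" for m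
  have dr: "d m (?r e) = c e" if "e \<in> Em m" for e m
    unfolding d_def comp_apply using inv_into_f_f[OF inj that] by simp
  have dk: "d m \<in> ?r ` Em m \<rightarrow> k" for m
    using dr E(3) by (auto simp: Em_def)
  have dc: "d m (?r e) \<in> carrier R" if "e \<in> Em m" for e m
    using dk[of m] that subringE(1)[OF k] by auto
  have g: "g m = (\<Oplus>e\<in>?r ` Em m. d m e \<otimes> ?t e)" for m
  proof -
    have "(\<Oplus>e\<in>?r ` Em m. d m e \<otimes> ?t e) = (\<Oplus>e\<in>Em m. d m (?r e) \<otimes> ?t (?r e))"
      using dc tc by (intro finsum_reindex inj) (simp add: Pi_iff)
    also have "\<dots> = g m"
      unfolding g_def
    proof (rule finsum_cong')
      fix e assume e: "e \<in> Em m"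
      have "?t (?r e) = ?t e"
        using uI i by (intro power_prod_cong) auto
      then show "d m (?r e) \<otimes> ?t (?r e) = c e \<otimes> ?t e"
        using dr[OF e] by simp
    qed (use cc tc in \<open>auto simp: Em_def\<close>)
    finally show ?thesis ..
  qed
  have "g m \<in> poly_span R k u I (\<lambda>_. True)" for m
    unfolding g using finEm rexp dk by (intro poly_span_sum[OF k uI]) auto
  then have gF: "g m \<in> F" for m
    using F(1) by blast
  \<comment> \<open>The coefficient polynomial containing the nonzero \<open>c e\<^sub>0\<close>
    cannot vanish, by independence of \<open>I\<close>.\<close>
  have g0: "g (e\<^sub>0 i) \<noteq> \<zero>"
  proof
    assume "g (e\<^sub>0 i) = \<zero>"
    then have sum: "(\<Oplus>e\<in>?r ` Em (e\<^sub>0 i). d (e\<^sub>0 i) e \<otimes> ?t e) \<in> {\<zero>}"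
      unfolding g by simp
    have mem: "e\<^sub>0 \<in> Em (e\<^sub>0 i)"
      using E(5) by (simp add: Em_def)
    have "d (e\<^sub>0 i) (?r e\<^sub>0) = \<zero>"
      by (rule alg_independentD[OF ind finite_imageI[OF finEm] rexp dk sum imageI[OF mem]])
    then show False
      using dr[OF mem] E(6) by simp
  qed
  define n where "n = Max ((\<lambda>e. e i) ` E)"
  have n: "e i \<le> n" if "e \<in> E" for e
    unfolding n_def using E(1) that by (intro Max_ge) auto
  have "\<zero> = (\<Oplus>e\<in>E. c e \<otimes> ((?z [^] e i) \<otimes> ?t e))"
    using E(4) unfolding pp ..
  also have "E = (\<Union>m\<in>{..n}. Em m)"
    using n by (auto simp: Em_def)
  also have "(\<Oplus>e\<in>(\<Union>m\<in>{..n}. Em m). c e \<otimes> ((?z [^] e i) \<otimes> ?t e)) =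
      (\<Oplus>m\<in>{..n}. \<Oplus>e\<in>Em m. c e \<otimes> ((?z [^] e i) \<otimes> ?t e))"
    using finEm cc tc z by (intro add.finprod_UN_disjoint) (auto simp: Em_def pairwise_def disjnt_def)
  also have "\<dots> = (\<Oplus>m\<in>{..n}. g m \<otimes> (?z [^] m))"
  proof (rule finsum_cong')
    fix m assume "m \<in> {..n}"
    have "(\<Oplus>e\<in>Em m. c e \<otimes> ((?z [^] e i) \<otimes> ?t e)) = (\<Oplus>e\<in>Em m. (c e \<otimes> ?t e) \<otimes> (?z [^] m))"
      using cc tc z by (intro finsum_cong') (auto simp: Em_def m_ac)
    also have "\<dots> = g m \<otimes> (?z [^] m)"
      unfolding g_def using finEm cc tc z by (intro finsum_ldistr[symmetric]) (auto simp: Em_def)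
    finally show "(\<Oplus>e\<in>Em m. c e \<otimes> ((?z [^] e i) \<otimes> ?t e)) = g m \<otimes> (?z [^] m)" .
  qed (use gc z in auto)
  finally have sum: "(\<Oplus>m\<in>{..n}. g m \<otimes> (?z [^] m)) = \<zero>" ..
  have "g \<in> {..n} \<rightarrow> F"
    using gF by blast
  then show ?thesis
    by (rule algebraic_of_relation[OF F(2) z _ sum n[OF E(5)] g0])
qed

end

text \<open>Finite generation is stated as the induction principle in which it is applied.
  \<open>R\<close> may be the zero ring, and then it has no primes.\<close>

locale fg_algebra = K: field K + R: cring R + ring_hom_cring K R \<sigma>
  for K :: "('k, 'm) ring_scheme" and R :: "('r, 'n) ring_scheme" and \<sigma> +
  fixes u :: "nat \<Rightarrow> 'r" and n :: nat
  assumes u_closed: "i < n \<Longrightarrow> u i \<in> carrier R"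
    and generated: "subring H R \<Longrightarrow> \<sigma> ` carrier K \<subseteq> H \<Longrightarrow> (\<And>i. i < n \<Longrightarrow> u i \<in> H) \<Longrightarrow> carrier R \<subseteq> H"
begin

abbreviation "k \<equiv> \<sigma> ` carrier K"

lemma subring_k: "subring k R"
  by (rule ring.img_is_subring[OF K.carrier_is_subring])

lemma k_unit:
  assumes "c \<in> k" "c \<noteq> \<zero>\<^bsub>R\<^esub>"
  obtains d where "d \<in> carrier R" "d \<otimes>\<^bsub>R\<^esub> c = \<one>\<^bsub>R\<^esub>"
proof -
  obtain a where a: "a \<in> carrier K" "c = \<sigma> a"
    using assms(1) by blast
  then have "a \<in> carrier K - {\<zero>\<^bsub>K\<^esub>}"
    using assms(2) by auto
  then have "inv\<^bsub>K\<^esub> a \<otimes>\<^bsub>K\<^esub> a = \<one>\<^bsub>K\<^esub>" "inv\<^bsub>K\<^esub> a \<in> carrier K"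
    using K.l_inv_nonzero K.inv_nonzero by auto
  then have "\<sigma> (inv\<^bsub>K\<^esub> a) \<otimes>\<^bsub>R\<^esub> c = \<one>\<^bsub>R\<^esub>" "\<sigma> (inv\<^bsub>K\<^esub> a) \<in> carrier R"
    using a by (simp_all flip: hom_mult)
  then show thesis
    using that by blast
qed

lemma k_notin_prime:
  assumes "primeideal P R" "c \<in> k" "c \<in> P"
  shows "c = \<zero>\<^bsub>R\<^esub>"
proof (rule ccontr)
  interpret P: primeideal P R
    by fact
  assume "c \<noteq> \<zero>\<^bsub>R\<^esub>"
  then obtain d where "d \<in> carrier R" "d \<otimes>\<^bsub>R\<^esub> c = \<one>\<^bsub>R\<^esub>"
    by (rule k_unit[OF assms(2)])
  then have "\<one>\<^bsub>R\<^esub> \<in> P"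
    using P.I_l_closed[OF assms(3)] by metis
  then show False
    using P.one_imp_carrier P.I_notcarr by blast
qed

text \<open>The only exponent vector on the empty set is zero, so a relation is a constant in
  \<open>P\<close>; nonzero constants are units and lie in no prime.\<close>

lemma alg_independent_empty:
  assumes "primeideal P R"
  shows "alg_independent R P k u {}"
  unfolding alg_independent_def
proof (intro allI impI ballI)
  fix E c e
  assume E: "finite E" "E \<subseteq> exponents {}" "c \<in> E \<rightarrow> k" "e \<in> E"
    and sum: "(\<Oplus>\<^bsub>R\<^esub>e\<in>E. c e \<otimes>\<^bsub>R\<^esub> power_prod R u {} e) \<in> P"
  have "E = {e}"
  proof -
    have "exponents {} = {\<lambda>_. 0}"
      by (auto simp: exponents_def fun_eq_iff)
    with E(2) have "E \<subseteq> {\<lambda>_. 0}"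
      by simp
    with E(4) show ?thesis
      by auto
  qed
  moreover have "c e \<in> carrier R"
    using funcset_mem[OF E(3,4)] subringE(1)[OF subring_k] by blast
  ultimately have "c e \<in> P"
    using sum by (simp add: power_prod_def)
  then show "c e = \<zero>\<^bsub>R\<^esub>"
    using k_notin_prime[OF assms] E(3,4) by auto
qed

text \<open>If \<open>I\<close> were a transcendence basis modulo \<open>P\<close>, then for \<open>x \<in> Q - P\<close> the inverse of \<open>x\<close> would be
  a fraction of polynomials with denominator in \<open>k[u\<^sub>I]\<close>; hence \<open>x\<close> divides modulo \<open>P\<close> a nonzero element
  of \<open>k[u\<^sub>I]\<close>, which then lies in \<open>Q\<close>.\<close>

lemma alg_independent_extend:
  assumes P: "primeideal P R" and Q: "primeideal Q R" and "P \<subset> Q" and I: "I \<subseteq> {..<n}"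
    and ind: "alg_independent R Q k u I"
  shows "\<exists>i<n. i \<notin> I \<and> alg_independent R P k u (insert i I)"
proof (rule ccontr)
  assume neg: "\<not> ?thesis"
  interpret P: primeideal P R
    by (rule P)
  interpret Q: primeideal Q R
    by (rule Q)
  obtain L :: "('r set \<times> 'r set) set ring" and \<theta> where "field L" and hom: "\<theta> \<in> ring_hom R L"
    and ker': "\<forall>x\<in>carrier R. \<theta> x = \<zero>\<^bsub>L\<^esub> \<longleftrightarrow> x \<in> P"
    by (rule P.residue_field_at_prime)
  note ker = ker'[rule_format]
  interpret L: field L
    by fact
  interpret h: ring_hom_cring R L \<theta>
    by unfold_locales (rule hom)
  let ?k = "\<theta> ` k" and ?u = "\<lambda>i. \<theta> (u i)"
  have finI: "finite I"
    using I finite_subset by blast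
  have sk: "subring ?k L"
    by (rule h.ring.img_is_subring[OF subring_k])
  have kc: "k \<subseteq> carrier R"
    by auto
  have uI: "u \<in> I \<rightarrow> carrier R"
    using I u_closed by auto
  have uI': "?u \<in> I \<rightarrow> carrier L"
    using uI by auto
  have indL: "alg_independent L {\<zero>\<^bsub>L\<^esub>} ?k ?u I"
    using ker by (intro h.alg_independent_image[OF alg_independent_antimono[OF ind] kc uI]) (use \<open>P \<subset> Q\<close> in auto)
  define A where "A = poly_span L ?k ?u I (\<lambda>_. True)"
  have A: "subring A L"
    unfolding A_def by (rule L.subring_poly_span[OF sk uI'])
  define D where "D = \<theta> ` carrier R"
  have D: "subring D L"
    unfolding D_def by (rule h.ring.img_is_subring[OF R.carrier_is_subring])
  \<comment> \<open>\<open>F\<close> is the field k(u_I). \<open>W\<close> has the same denominators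
    but numerators from the image \<open>D\<close> of \<open>R\<close>; an inverse found in
    \<open>W\<close> therefore has its denominator in k[u_I].\<close>
  define F where "F = {p \<otimes>\<^bsub>L\<^esub> inv\<^bsub>L\<^esub> q |p q. p \<in> A \<and> q \<in> A - {\<zero>\<^bsub>L\<^esub>}}"
  define W where "W = {p \<otimes>\<^bsub>L\<^esub> inv\<^bsub>L\<^esub> q |p q. p \<in> D \<and> q \<in> A - {\<zero>\<^bsub>L\<^esub>}}"
  have AD: "A \<subseteq> D"
  proof
    fix x assume "x \<in> A"
    then show "x \<in> D"
      unfolding A_def
    proof induction
      case (add x c e)
      have "power_prod L ?u I e \<in> D"
        using h.hom_power_prod[OF uI, of e] uI unfolding D_def by (metis R.power_prod_closed imageI)
      moreover have "c \<in> D"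
        using add.hyps(2) kc unfolding D_def by blast
      ultimately show ?case
        using add.IH subringE(6,7)[OF D] by blast
    qed (rule subringE(2)[OF D])
  qed
  have F: "subfield F L"
    unfolding F_def by (rule L.subfield_fractions[OF A])
  have W: "subring W L"
    unfolding W_def by (rule L.subring_fractions[OF D A AD])
  have FW: "F \<subseteq> W"
    unfolding F_def W_def using AD by blast
  have AF: "A \<subseteq> F"
    unfolding F_def using L.fractions_incl[OF A _ subringE(1)[OF A]] by blast
  have DW: "D \<subseteq> W"
    unfolding W_def using L.fractions_incl[OF A _ subringE(1)[OF D]] by blast
  have kA: "?k \<subseteq> A"
  proof
    fix c assume c: "c \<in> ?k"
    then have "c \<otimes>\<^bsub>L\<^esub> power_prod L ?u I (\<lambda>_. 0) \<in> A"
      unfolding A_def by (intro L.poly_span_monom[OF sk uI' _ exponents_zero]) auto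
    then show "c \<in> A"
      using c subringE(1)[OF sk] by (auto simp: L.power_prod_zero[OF uI'])
  qed
  have alg: "(L.algebraic over F) (?u i)" if i: "i < n" for i
  proof (cases "i \<in> I")
    case True
    let ?e = "\<lambda>j. if j = i then 1 else 0 :: nat"
    have "\<one>\<^bsub>L\<^esub> \<otimes>\<^bsub>L\<^esub> power_prod L ?u I ?e \<in> A"
      unfolding A_def using True subringE(3)[OF sk]
      by (intro L.poly_span_monom[OF sk uI']) (auto simp: exponents_def)
    then have "?u i \<in> A"
      using L.power_prod_single[OF finI True uI', of 1] u_closed[OF i] by simp
    then show ?thesis
      using L.algebraic_self[OF subfieldE(1)[OF F]] AF by blast
  next
    case False
    have uiI: "u \<in> insert i I \<rightarrow> carrier R" "?u \<in> insert i I \<rightarrow> carrier L"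
      using I u_closed i by auto
    have "\<not> alg_independent R P k u (insert i I)"
      using neg i False by blast
    then obtain E c e\<^sub>0 where E: "finite E" "E \<subseteq> exponents (insert i I)" "c \<in> E \<rightarrow> k"
      "(\<Oplus>\<^bsub>R\<^esub>e\<in>E. c e \<otimes>\<^bsub>R\<^esub> power_prod R u (insert i I) e) \<in> P" "e\<^sub>0 \<in> E" "c e\<^sub>0 \<noteq> \<zero>\<^bsub>R\<^esub>"
      unfolding alg_independent_def by blast
    have cR: "c \<in> E \<rightarrow> carrier R"
      using E(3) kc by blast
    have "(\<Oplus>\<^bsub>L\<^esub>e\<in>E. \<theta> (c e) \<otimes>\<^bsub>L\<^esub> power_prod L ?u (insert i I) e) = \<zero>\<^bsub>L\<^esub>"
      unfolding h.hom_poly[OF uiI(1) cR, symmetric] using E(4) ker P.Icarr by blast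
    moreover have "\<theta> (c e\<^sub>0) \<noteq> \<zero>\<^bsub>L\<^esub>"
      using E(3,5,6) ker[of "c e\<^sub>0"] k_notin_prime[OF P, of "c e\<^sub>0"] cR by auto
    moreover have "(\<lambda>e. \<theta> (c e)) \<in> E \<rightarrow> ?k"
      using E(3) by blast
    ultimately have "\<not> alg_independent L {\<zero>\<^bsub>L\<^esub>} ?k ?u (insert i I)"
      using alg_independentD[of L "{\<zero>\<^bsub>L\<^esub>}" ?k ?u "insert i I" E "\<lambda>e. \<theta> (c e)" e\<^sub>0] E(1,2,5) by blast
    then show ?thesis
      using AF subfieldE(3)[OF F] unfolding A_def
      by (intro L.algebraic_of_dependent[OF sk finI uiI(2) False indL])
  qed
  define xs where "xs = map ?u [0..<n]"
  \<comment> \<open>Adjoining finitely many algebraic elements to \<open>F\<close> gives a field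
    \<open>G\<close> that contains the image of \<open>R\<close>. It is also contained in the ring
    \<open>W\<close>, so inverses of nonzero images of elements of \<open>R\<close> lie in
    \<open>W\<close>.\<close>
  define G where "G = L.finite_extension F xs"
  have xs: "set xs \<subseteq> carrier L"
    using u_closed by (auto simp: xs_def)
  have G: "subfield G L"
    unfolding G_def using alg by (intro L.finite_extension_is_subfield[OF F xs]) (auto simp: xs_def)
  have FG: "F \<subseteq> G"
    unfolding G_def by (rule L.finite_extension_incl[OF subfieldE(3)[OF F] xs])
  have xsG: "set xs \<subseteq> G"
    unfolding G_def by (rule L.finite_extension_mem[OF subfieldE(1)[OF F] xs])
  have xsW: "set xs \<subseteq> W"
    using DW u_closed by (auto simp: xs_def D_def)
  have GW: "G \<subseteq> W"
    unfolding G_def by (rule L.finite_extension_subring_incl[OF W FW xsW])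
  have "carrier R \<subseteq> {y \<in> carrier R. \<theta> y \<in> G}"
  proof (rule generated)
    note sG = subringE[OF subfieldE(1)[OF G]]
    show "subring {y \<in> carrier R. \<theta> y \<in> G} R"
      using sG by (intro R.subringI) (auto simp: h.hom_a_inv)
    show "k \<subseteq> {y \<in> carrier R. \<theta> y \<in> G}"
      using kA AF FG kc by blast
    show "u i \<in> {y \<in> carrier R. \<theta> y \<in> G}" if "i < n" for i
      using xsG that u_closed by (auto simp: xs_def)
  qed
  then have RG: "\<theta> y \<in> G" if "y \<in> carrier R" for y
    using that by blast
  obtain x where x: "x \<in> Q" "x \<notin> P"
    using \<open>P \<subset> Q\<close> by blast
  then have xR: "x \<in> carrier R"
    using Q.Icarr by blast
  then have x0: "\<theta> x \<in> G - {\<zero>\<^bsub>L\<^esub>}" "\<theta> x \<in> carrier L - {\<zero>\<^bsub>L\<^esub>}"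
    using RG ker x(2) by auto
  then have "inv\<^bsub>L\<^esub> (\<theta> x) \<in> W"
    using L.subfield_m_inv(1)[OF G] GW by blast
  then obtain y q where y: "y \<in> carrier R" "q \<in> A - {\<zero>\<^bsub>L\<^esub>}" "inv\<^bsub>L\<^esub> (\<theta> x) = \<theta> y \<otimes>\<^bsub>L\<^esub> inv\<^bsub>L\<^esub> q"
    unfolding W_def D_def by blast
  have q: "q \<in> carrier L - {\<zero>\<^bsub>L\<^esub>}"
    using y(2) subringE(1)[OF A] by blast
  have "q = (\<theta> x \<otimes>\<^bsub>L\<^esub> inv\<^bsub>L\<^esub> (\<theta> x)) \<otimes>\<^bsub>L\<^esub> q"
    using q x0 by (simp add: L.r_inv_nonzero)
  also have "\<dots> = (\<theta> x \<otimes>\<^bsub>L\<^esub> \<theta> y) \<otimes>\<^bsub>L\<^esub> (inv\<^bsub>L\<^esub> q \<otimes>\<^bsub>L\<^esub> q)"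
    unfolding y(3) using q x0 y(1) L.inv_nonzero[OF q] by (simp add: L.m_assoc)
  also have "\<dots> = \<theta> (x \<otimes>\<^bsub>R\<^esub> y)"
    using q y(1) xR by (simp add: L.l_inv_nonzero)
  finally have q_eq: "q = \<theta> (x \<otimes>\<^bsub>R\<^esub> y)" .
  have "q \<in> poly_span L ?k ?u I (\<lambda>_. True)"
    using y(2) unfolding A_def by (rule DiffD1)
  then have "\<exists>E c. finite E \<and> E \<subseteq> exponents I \<and> c \<in> E \<rightarrow> ?k \<and>
      q = (\<Oplus>\<^bsub>L\<^esub>e\<in>E. c e \<otimes>\<^bsub>L\<^esub> power_prod L ?u I e)"
    by (rule L.poly_span_finsum[OF sk uI']) blast
  then obtain E c where E: "finite E" "E \<subseteq> exponents I" "c \<in> E \<rightarrow> ?k"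
    "q = (\<Oplus>\<^bsub>L\<^esub>e\<in>E. c e \<otimes>\<^bsub>L\<^esub> power_prod L ?u I e)"
    by (elim exE conjE) (rule that)
  have "\<forall>e\<in>E. \<exists>d. d \<in> k \<and> c e = \<theta> d"
    using E(3) by blast
  from bchoice[OF this] obtain d where "\<forall>e\<in>E. d e \<in> k \<and> c e = \<theta> (d e)"
    by (rule exE)
  then have d: "d \<in> E \<rightarrow> k" "\<And>e. e \<in> E \<Longrightarrow> c e = \<theta> (d e)"
    by blast+
  have dR: "d \<in> E \<rightarrow> carrier R"
    using d(1) kc by blast
  \<comment> \<open>\<open>z\<close> lifts the denominator \<open>q\<close> to \<open>R\<close> as a
    polynomial in the \<open>u i\<close> over \<open>k\<close>. It agrees with
    \<open>x \<otimes> y\<close> modulo \<open>P\<close> and so lies in \<open>Q\<close>;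
    independence modulo \<open>Q\<close> makes its coefficients vanish, contradicting that
    \<open>q\<close> is nonzero.\<close>
  define z where "z = (\<Oplus>\<^bsub>R\<^esub>e\<in>E. d e \<otimes>\<^bsub>R\<^esub> power_prod R u I e)"
  have zR: "z \<in> carrier R"
    unfolding z_def using dR uI by (intro R.finsum_closed) (auto simp: Pi_iff)
  have "\<theta> z = (\<Oplus>\<^bsub>L\<^esub>e\<in>E. \<theta> (d e) \<otimes>\<^bsub>L\<^esub> power_prod L ?u I e)"
    unfolding z_def by (rule h.hom_poly[OF uI dR])
  also have "\<dots> = q"
    unfolding E(4) using dR d(2) uI' by (intro L.finsum_cong') (auto simp: Pi_iff)
  finally have zq: "\<theta> z = \<theta> (x \<otimes>\<^bsub>R\<^esub> y)"
    using q_eq by simp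
  have xyR: "x \<otimes>\<^bsub>R\<^esub> y \<in> carrier R" and xyQ: "x \<otimes>\<^bsub>R\<^esub> y \<in> Q"
    using xR y(1) Q.I_r_closed[OF x(1) y(1)] by auto
  have "\<theta> (z \<oplus>\<^bsub>R\<^esub> \<ominus>\<^bsub>R\<^esub> (x \<otimes>\<^bsub>R\<^esub> y)) = \<theta> z \<oplus>\<^bsub>L\<^esub> \<ominus>\<^bsub>L\<^esub> \<theta> (x \<otimes>\<^bsub>R\<^esub> y)"
    using zR xyR by (simp del: hom_mult h.hom_mult)
  also have "\<dots> = \<zero>\<^bsub>L\<^esub>"
    unfolding zq using xyR by (intro L.r_neg h.hom_closed)
  finally have "\<theta> (z \<oplus>\<^bsub>R\<^esub> \<ominus>\<^bsub>R\<^esub> (x \<otimes>\<^bsub>R\<^esub> y)) = \<zero>\<^bsub>L\<^esub>" .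
  then have "z \<oplus>\<^bsub>R\<^esub> \<ominus>\<^bsub>R\<^esub> (x \<otimes>\<^bsub>R\<^esub> y) \<in> Q"
    using ker[of "z \<oplus>\<^bsub>R\<^esub> \<ominus>\<^bsub>R\<^esub> (x \<otimes>\<^bsub>R\<^esub> y)"] zR xyR \<open>P \<subset> Q\<close> by auto
  then have "(z \<oplus>\<^bsub>R\<^esub> \<ominus>\<^bsub>R\<^esub> (x \<otimes>\<^bsub>R\<^esub> y)) \<oplus>\<^bsub>R\<^esub> (x \<otimes>\<^bsub>R\<^esub> y) \<in> Q"
    using xyQ by (rule Q.a_closed)
  then have "z \<in> Q"
    using zR xyR by (simp add: R.a_assoc R.l_neg)
  then have "d e = \<zero>\<^bsub>R\<^esub>" if "e \<in> E" for e
    using alg_independentD[OF ind E(1,2) d(1) _ that] unfolding z_def by blast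
  then have "z = (\<Oplus>\<^bsub>R\<^esub>e\<in>E. \<zero>\<^bsub>R\<^esub>)"
    unfolding z_def using uI by (intro R.finsum_cong') auto
  then have "\<theta> z = \<zero>\<^bsub>L\<^esub>"
    by simp
  then show False
    using zq q_eq y(2) by simp
qed

text \<open>Each step down the chain gains one generator: a set independent modulo
  \<open>P (Suc 0)\<close> can be enlarged to one independent modulo \<open>P 0\<close>.\<close>

theorem independent_of_chain:
  assumes "\<And>i. i \<le> d \<Longrightarrow> primeideal (P i) R" "\<And>i. i < d \<Longrightarrow> P i \<subset> P (Suc i)"
  shows "\<exists>I. I \<subseteq> {..<n} \<and> card I = d \<and> alg_independent R (P 0) k u I"
  using assms
proof (induction d arbitrary: P)
  case 0
  then show ?case
    using alg_independent_empty by (intro exI[of _ "{}"]) auto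
next
  case (Suc d)
  have "\<exists>I. I \<subseteq> {..<n} \<and> card I = d \<and> alg_independent R (P (Suc 0)) k u I"
    using Suc.prems by (intro Suc.IH[of "\<lambda>i. P (Suc i)"]) auto
  then obtain I where I: "I \<subseteq> {..<n}" "card I = d" "alg_independent R (P (Suc 0)) k u I"
    by blast
  have "\<exists>i<n. i \<notin> I \<and> alg_independent R (P 0) k u (insert i I)"
    using Suc.prems by (intro alg_independent_extend[OF _ _ _ I(1,3)]) auto
  then obtain i where "i < n" "i \<notin> I" "alg_independent R (P 0) k u (insert i I)"
    by blast
  moreover have "finite I"
    using I(1) finite_subset by blast
  ultimately show ?case
    using I by (intro exI[of _ "insert i I"]) auto
qed

end


section \<open>Rational points of finitely generated algebras\<close>

text \<open>An ideal maximal among those disjoint from \<open>S\<close> is prime: if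
  \<open>a\<close> and \<open>b\<close> are outside \<open>P\<close>, then \<open>P\<close> together
  with either one generates an element of \<open>S\<close>, and the product of these two elements
  would lie in \<open>P\<close> if \<open>a \<otimes> b\<close> did.\<close>

lemma (in cring) primeideal_avoiding:
  assumes S: "\<one> \<in> S" "\<zero> \<notin> S" "\<And>s t. s \<in> S \<Longrightarrow> t \<in> S \<Longrightarrow> s \<otimes> t \<in> S"
  shows "\<exists>P. primeideal P R \<and> P \<inter> S = {}"
proof -
  let ?A = "{I. ideal I R \<and> I \<inter> S = {}}"
  have "\<exists>P\<in>?A. \<forall>J\<in>?A. P \<subseteq> J \<longrightarrow> J = P"
  proof (rule subset_Zorn_nonempty)
    show "?A \<noteq> {}"
      using zeroideal S(2) by blast
    fix C assume C: "C \<noteq> {}" "subset.chain ?A C"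
    then have "C \<subseteq> ?A" "subset.chain {I. ideal I R} C"
      by (auto simp: subset_chain_def)
    then have "ideal (\<Union>C) R"
      using chain_Union_is_ideal[of C] C(1) by auto
    moreover have "\<Union>C \<inter> S = {}"
      using \<open>C \<subseteq> ?A\<close> by blast
    ultimately show "\<Union>C \<in> ?A"
      by simp
  qed
  then obtain P where P: "ideal P R" "P \<inter> S = {}" and max: "\<forall>J\<in>?A. P \<subseteq> J \<longrightarrow> J = P"
    by auto
  interpret P: ideal P R
    by (rule P(1))
  have hit: "\<exists>p\<in>P. \<exists>r\<in>carrier R. p \<oplus> r \<otimes> a \<in> S" if a: "a \<in> carrier R" "a \<notin> P" for a
  proof (rule ccontr)
    assume neg: "\<not> ?thesis"
    have J: "ideal (P <+> PIdl a) R"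
      by (rule add_ideals[OF P(1) cgenideal_ideal[OF a(1)]])
    have J_eq: "P <+> PIdl a = {p \<oplus> r \<otimes> a |p r. p \<in> P \<and> r \<in> carrier R}"
      by (auto simp: set_add_def' cgenideal_def)
    have "(P <+> PIdl a) \<inter> S = {}"
      unfolding J_eq using neg by blast
    moreover have "P \<subseteq> P <+> PIdl a"
    proof
      fix p assume p: "p \<in> P"
      then have "p = p \<oplus> \<zero> \<otimes> a"
        using a(1) P.Icarr by simp
      then show "p \<in> P <+> PIdl a"
        unfolding J_eq using p by blast
    qed
    ultimately have "P <+> PIdl a = P"
      using max J by simp
    moreover have "\<zero> \<oplus> \<one> \<otimes> a \<in> P <+> PIdl a"
      unfolding J_eq using additive_subgroup.zero_closed[OF P.additive_subgroup_axioms] by blast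
    ultimately show False
      using a by simp
  qed
  have "primeideal P R"
  proof (rule primeidealI[OF P(1) is_cring])
    show "carrier R \<noteq> P"
      using S(1) P(2) by auto
    fix a b assume ab: "a \<in> carrier R" "b \<in> carrier R" "a \<otimes> b \<in> P"
    show "a \<in> P \<or> b \<in> P"
    proof (rule ccontr)
      assume "\<not> ?thesis"
      then obtain p r q s where p: "p \<in> P" "r \<in> carrier R" "p \<oplus> r \<otimes> a \<in> S"
        and q: "q \<in> P" "s \<in> carrier R" "q \<oplus> s \<otimes> b \<in> S"
        using hit ab(1,2) by meson
      have c: "p \<in> carrier R" "q \<in> carrier R"
        using p q P.Icarr by auto
      have "(p \<oplus> r \<otimes> a) \<otimes> (q \<oplus> s \<otimes> b) = (q \<oplus> s \<otimes> b) \<otimes> p \<oplus> ((r \<otimes> a) \<otimes> q \<oplus> (r \<otimes> s) \<otimes> (a \<otimes> b))"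
        using c p(2) q(2) ab by (simp add: l_distr r_distr m_ac a_ac)
      moreover have "(q \<oplus> s \<otimes> b) \<otimes> p \<in> P" "(r \<otimes> a) \<otimes> q \<in> P" "(r \<otimes> s) \<otimes> (a \<otimes> b) \<in> P"
        using c p(1,2) q(1,2) ab by (auto intro!: P.I_l_closed[OF p(1)] P.I_l_closed[OF q(1)] P.I_l_closed[OF ab(3)])
      ultimately have "(p \<oplus> r \<otimes> a) \<otimes> (q \<oplus> s \<otimes> b) \<in> P"
        by (simp only: P.a_closed)
      then show False
        using S(3)[OF p(3) q(3)] P(2) by auto
    qed
  qed
  with P(2) show ?thesis
    by blast
qed

text \<open>Exponent vectors supported on \<open>{i}\<close> are just natural numbers, with
  \<open>ex\<close> as the inverse of \<open>\<lambda>e. e i\<close>, so the sum is a nonzero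
  univariate polynomial.\<close>

lemma (in domain) finite_poly_roots:
  assumes E: "finite E" "E \<subseteq> exponents {i}" and c: "c \<in> E \<rightarrow> carrier R" and e0: "e\<^sub>0 \<in> E" "c e\<^sub>0 \<noteq> \<zero>"
  shows "finite {x \<in> carrier R. (\<Oplus>e\<in>E. c e \<otimes> (x [^] e i)) = \<zero>}"
proof -
  define ex where "ex m = (\<lambda>j. if j = i then m else 0 :: nat)" for m
  have ex: "ex (e i) = e" if "e \<in> E" for e
    using E(2) that by (auto simp: ex_def exponents_def fun_eq_iff subset_iff)
  have inj: "inj_on (\<lambda>e. e i) E"
    by (rule inj_onI) (metis ex)
  define n where "n = Max ((\<lambda>e. e i) ` E)"
  have n: "e i \<le> n" if "e \<in> E" for e
    unfolding n_def using E(1) that by (intro Max_ge) auto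
  define g where "g m = (if ex m \<in> E then c (ex m) else \<zero>)" for m
  have gc: "g m \<in> carrier R" for m
    using c by (auto simp: g_def)
  define p where "p = normalize (map g (rev [0..<Suc n]))"
  have set: "set (map g (rev [0..<Suc n])) \<subseteq> carrier R"
    using gc by auto
  have "p \<noteq> []"
  proof
    assume "p = []"
    then have "normalize (map g (rev [0..<Suc n])) = []"
      by (simp only: p_def)
    then have "set (map g (rev [0..<Suc n])) \<subseteq> {\<zero>}"
      by (rule normalize_eq_Nil)
    moreover have "g (e\<^sub>0 i) \<in> set (map g (rev [0..<Suc n]))"
      using n[OF e0(1)] by (auto simp del: upt_Suc)
    ultimately show False
      using e0 ex[OF e0(1)] by (simp add: g_def subset_iff del: upt_Suc) blast
  qed
  have p: "p \<in> carrier (poly_ring R)"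
    using normalize_gives_polynomial[OF set] by (simp add: univ_poly_def p_def)
  have "eval p x = (\<Oplus>e\<in>E. c e \<otimes> (x [^] e i))" if x: "x \<in> carrier R" for x
  proof -
    have "eval p x = (\<Oplus>m\<in>{..n}. g m \<otimes> (x [^] m))"
      unfolding p_def using eval_normalize[OF set x] eval_map_rev[OF x, of g n] gc by simp
    also have "\<dots> = (\<Oplus>m\<in>(\<lambda>e. e i) ` E. g m \<otimes> (x [^] m))"
    proof (rule add.finprod_mono_neutral_cong_right)
      show "(\<lambda>e. e i) ` E \<subseteq> {..n}"
        using n by auto
      show "g m \<otimes> (x [^] m) = \<zero>" if m: "m \<in> {..n} - (\<lambda>e. e i) ` E" for m
      proof -
        have "ex m \<notin> E"
          using m by (auto simp: ex_def image_iff)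
        then show ?thesis
          using x by (simp add: g_def)
      qed
    qed (use gc x in auto)
    also have "\<dots> = (\<Oplus>e\<in>E. g (e i) \<otimes> (x [^] e i))"
      using gc x by (intro finsum_reindex inj) auto
    also have "\<dots> = (\<Oplus>e\<in>E. c e \<otimes> (x [^] e i))"
      using c x ex by (intro finsum_cong') (auto simp: g_def Pi_iff)
    finally show ?thesis .
  qed
  with \<open>p \<noteq> []\<close> show ?thesis
    by (intro finite_subset[OF _ finite_number_of_roots[OF p]]) (auto simp: is_root_def)
qed

context fg_algebra
begin

definition rational_homs :: "('r \<Rightarrow> 'k) set" where
  "rational_homs = {\<xi> \<in> ring_hom R K. \<forall>a\<in>carrier K. \<xi> (\<sigma> a) = a}"

text \<open>If a coordinate takes infinitely many values on rational points, the elements vanishing at only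
  finitely many of these values form a multiplicative set; the coordinate is transcendental modulo any
  prime avoiding it.\<close>

lemma independent_of_infinite_values:
  assumes i: "i < n" and inf: "infinite ((\<lambda>\<xi>. \<xi> (u i)) ` rational_homs)"
  obtains P where "primeideal P R" "alg_independent R P k u {i}"
proof -
  define Z where "Z s = (\<lambda>\<xi>. \<xi> (u i)) ` {\<xi> \<in> rational_homs. \<xi> s = \<zero>\<^bsub>K\<^esub>}" for s
  define S where "S = {s \<in> carrier R. finite (Z s)}"
  have hom: "\<xi> \<in> ring_hom R K" if "\<xi> \<in> rational_homs" for \<xi>
    using that by (simp add: rational_homs_def)
  have "\<exists>P. primeideal P R \<and> P \<inter> S = {}"
  proof (rule R.primeideal_avoiding)
    have "Z \<one>\<^bsub>R\<^esub> = {}"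
      using ring_hom_one[OF hom] K.zero_not_one unfolding Z_def by fastforce
    then show "\<one>\<^bsub>R\<^esub> \<in> S"
      by (simp add: S_def)
    have "\<xi> \<zero>\<^bsub>R\<^esub> = \<zero>\<^bsub>K\<^esub>" if "\<xi> \<in> rational_homs" for \<xi>
      using ring_hom_zero[OF hom[OF that] R.ring_axioms K.ring_axioms] .
    then have "Z \<zero>\<^bsub>R\<^esub> = (\<lambda>\<xi>. \<xi> (u i)) ` rational_homs"
      by (auto simp: Z_def)
    then show "\<zero>\<^bsub>R\<^esub> \<notin> S"
      using inf by (simp add: S_def)
    fix s t assume st: "s \<in> S" "t \<in> S"
    then have c: "s \<in> carrier R" "t \<in> carrier R"
      by (auto simp: S_def)
    have "\<xi> s = \<zero>\<^bsub>K\<^esub> \<or> \<xi> t = \<zero>\<^bsub>K\<^esub>" if "\<xi> \<in> rational_homs" "\<xi> (s \<otimes>\<^bsub>R\<^esub> t) = \<zero>\<^bsub>K\<^esub>" for \<xi>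
    proof -
      have "\<xi> s \<otimes>\<^bsub>K\<^esub> \<xi> t = \<zero>\<^bsub>K\<^esub>"
        by (simp only: ring_hom_mult[OF hom[OF that(1)] c, symmetric] that(2))
      then show ?thesis
        using ring_hom_closed[OF hom[OF that(1)] c(1)] ring_hom_closed[OF hom[OF that(1)] c(2)]
        by (simp only: K.integral_iff)
    qed
    then have "Z (s \<otimes>\<^bsub>R\<^esub> t) \<subseteq> Z s \<union> Z t"
      unfolding Z_def by blast
    then show "s \<otimes>\<^bsub>R\<^esub> t \<in> S"
      using st c by (auto simp: S_def intro: finite_subset)
  qed
  then obtain P where P: "primeideal P R" "P \<inter> S = {}"
    by blast
  have ui: "u i \<in> carrier R" "u \<in> {i} \<rightarrow> carrier R"
    using u_closed[OF i] by auto
  have "alg_independent R P k u {i}"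
    unfolding alg_independent_def
  proof (intro allI impI ballI)
    fix E c e
    assume E: "finite E" "E \<subseteq> exponents {i}" "c \<in> E \<rightarrow> k" "e \<in> E"
      and sum: "(\<Oplus>\<^bsub>R\<^esub>e\<in>E. c e \<otimes>\<^bsub>R\<^esub> power_prod R u {i} e) \<in> P"
    let ?s = "\<Oplus>\<^bsub>R\<^esub>e\<in>E. c e \<otimes>\<^bsub>R\<^esub> power_prod R u {i} e"
    have "\<forall>e\<in>E. \<exists>d. d \<in> carrier K \<and> c e = \<sigma> d"
      using E(3) by blast
    from bchoice[OF this] obtain d where "\<forall>e\<in>E. d e \<in> carrier K \<and> c e = \<sigma> (d e)"
      by (rule exE)
    then have d: "d \<in> E \<rightarrow> carrier K" "\<And>e. e \<in> E \<Longrightarrow> c e = \<sigma> (d e)"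
      by blast+
    have cR: "c \<in> E \<rightarrow> carrier R"
      using E(3) subringE(1)[OF subring_k] by blast
    have s: "?s \<in> carrier R"
      using cR ui by (intro R.finsum_closed) (auto simp: Pi_iff)
    have eval: "\<xi> ?s = (\<Oplus>\<^bsub>K\<^esub>e\<in>E. d e \<otimes>\<^bsub>K\<^esub> (\<xi> (u i) [^]\<^bsub>K\<^esub> e i))" if \<xi>: "\<xi> \<in> rational_homs" for \<xi>
    proof -
      interpret \<xi>: ring_hom_cring R K \<xi>
        by unfold_locales (rule hom[OF \<xi>])
      have "\<xi> ?s = (\<Oplus>\<^bsub>K\<^esub>e\<in>E. \<xi> (c e) \<otimes>\<^bsub>K\<^esub> power_prod K (\<lambda>i. \<xi> (u i)) {i} e)"
        by (rule \<xi>.hom_poly[OF ui(2) cR])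
      also have "\<dots> = (\<Oplus>\<^bsub>K\<^esub>e\<in>E. d e \<otimes>\<^bsub>K\<^esub> (\<xi> (u i) [^]\<^bsub>K\<^esub> e i))"
      proof (rule K.finsum_cong')
        fix e assume e: "e \<in> E"
        have "\<xi> (c e) = d e"
          using d e \<xi> by (auto simp: rational_homs_def)
        moreover have "power_prod K (\<lambda>i. \<xi> (u i)) {i} e = \<xi> (u i) [^]\<^bsub>K\<^esub> e i"
          using ui(1) unfolding power_prod_def by (subst K.finprod_insert) auto
        ultimately show "\<xi> (c e) \<otimes>\<^bsub>K\<^esub> power_prod K (\<lambda>i. \<xi> (u i)) {i} e = d e \<otimes>\<^bsub>K\<^esub> (\<xi> (u i) [^]\<^bsub>K\<^esub> e i)"
          by simp
      qed (use d ui in auto)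
      finally show ?thesis .
    qed
    show "c e = \<zero>\<^bsub>R\<^esub>"
    \<comment> \<open>At rational points \<open>?s\<close> is a nonzero polynomial in the value of
      \<open>u i\<close>, so it vanishes for only finitely many of these values. That puts
      \<open>?s\<close> into \<open>S\<close>, while it lies in \<open>P\<close>.\<close>
    proof (rule ccontr)
      assume "c e \<noteq> \<zero>\<^bsub>R\<^esub>"
      then have "d e \<noteq> \<zero>\<^bsub>K\<^esub>"
        using d(2)[OF E(4)] by auto
      have "Z ?s \<subseteq> {x \<in> carrier K. (\<Oplus>\<^bsub>K\<^esub>e\<in>E. d e \<otimes>\<^bsub>K\<^esub> (x [^]\<^bsub>K\<^esub> e i)) = \<zero>\<^bsub>K\<^esub>}"
        using eval ring_hom_closed[OF hom ui(1)] by (auto simp: Z_def)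
      moreover have "finite {x \<in> carrier K. (\<Oplus>\<^bsub>K\<^esub>e\<in>E. d e \<otimes>\<^bsub>K\<^esub> (x [^]\<^bsub>K\<^esub> e i)) = \<zero>\<^bsub>K\<^esub>}"
        by (rule K.finite_poly_roots[OF E(1,2) d(1) E(4) \<open>d e \<noteq> \<zero>\<^bsub>K\<^esub>\<close>])
      ultimately have "?s \<in> S"
        using s by (auto simp: S_def intro: finite_subset)
      with sum P(2) show False
        by blast
    qed
  qed
  with P(1) show thesis
    by (rule that)
qed

end


section \<open>Monoid algebras\<close>

lemma (in abelian_monoid) finsum_Times:
  assumes "finite A" "finite C" "\<And>a c. a \<in> A \<Longrightarrow> c \<in> C \<Longrightarrow> h (a, c) \<in> carrier G"
  shows "(\<Oplus>p\<in>A \<times> C. h p) = (\<Oplus>a\<in>A. \<Oplus>c\<in>C. h (a, c))"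
proof -
  have "A \<times> C = (\<Union>a\<in>A. Pair a ` C)"
    by auto
  moreover have "(\<Oplus>p\<in>(\<Union>a\<in>A. Pair a ` C). h p) = (\<Oplus>a\<in>A. \<Oplus>p\<in>Pair a ` C. h p)"
    using assms by (intro add.finprod_UN_disjoint) (auto simp: pairwise_def disjnt_def)
  moreover have "(\<Oplus>a\<in>A. \<Oplus>p\<in>Pair a ` C. h p) = (\<Oplus>a\<in>A. \<Oplus>c\<in>C. h (a, c))"
    using assms by (intro finsum_cong' finsum_reindex) (auto simp: inj_on_def)
  ultimately show ?thesis
    by simp
qed

locale monoid_alg = pointed_monoid B + K: field K
  for B :: "('a, 'm) pmonoid_scheme" and K :: "('k, 'n) ring_scheme"
begin

abbreviation "R \<equiv> monoid_algebra K B"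
abbreviation "supp f \<equiv> {x. f x \<noteq> \<zero>\<^bsub>K\<^esub>}"
abbreviation "basis \<equiv> carrier B - {pzero B}"

text \<open>The linear functional with values \<open>w\<close> on the basis, evaluated at
  \<open>f\<close>. Coefficients of products and evaluation at a band homomorphism are both
  instances, so ring laws reduce to laws of \<open>B\<close> inside \<open>w\<close>.\<close>

definition pair :: "('a \<Rightarrow> 'k) \<Rightarrow> ('a \<Rightarrow> 'k) \<Rightarrow> 'k" where
  "pair f w = (\<Oplus>\<^bsub>K\<^esub>a\<in>supp f. f a \<otimes>\<^bsub>K\<^esub> w a)"

definition ind :: "bool \<Rightarrow> 'k" where
  "ind P = (if P then \<one>\<^bsub>K\<^esub> else \<zero>\<^bsub>K\<^esub>)"

lemma ind_closed [simp]: "ind P \<in> carrier K"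
  by (simp add: ind_def)

lemma R_carrier: "f \<in> carrier R \<longleftrightarrow>
    (\<forall>x. f x \<in> carrier K) \<and> supp f \<subseteq> basis \<and> finite (supp f)"
  unfolding monoid_algebra_def by auto

lemma R_simps: "\<one>\<^bsub>R\<^esub> = scalar K B \<one>\<^bsub>K\<^esub>" "\<zero>\<^bsub>R\<^esub> = (\<lambda>x. \<zero>\<^bsub>K\<^esub>)"
  "f \<oplus>\<^bsub>R\<^esub> g = (\<lambda>x. f x \<oplus>\<^bsub>K\<^esub> g x)"
  by (simp_all add: monoid_algebra_def)

context
  fixes f assumes f: "f \<in> carrier R"
begin

lemma coeff_closed: "f x \<in> carrier K"
  using f by (simp add: R_carrier)

lemma supp_finite: "finite (supp f)"
  using f by (simp add: R_carrier)

lemma supp_carrier: "a \<in> supp f \<Longrightarrow> a \<in> carrier B"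
  using f by (auto simp: R_carrier)

lemma coeff_outside: "x \<notin> basis \<Longrightarrow> f x = \<zero>\<^bsub>K\<^esub>"
  using f by (auto simp: R_carrier)

lemma pair_closed: "w \<in> carrier B \<rightarrow> carrier K \<Longrightarrow> pair f w \<in> carrier K"
  unfolding pair_def using coeff_closed supp_carrier by (intro K.finsum_closed) auto

lemma pair_cong:
  "(\<And>a. a \<in> carrier B \<Longrightarrow> w a = w' a) \<Longrightarrow> w' \<in> carrier B \<rightarrow> carrier K \<Longrightarrow> pair f w = pair f w'"
  unfolding pair_def using coeff_closed supp_carrier by (intro K.finsum_cong') (auto simp: Pi_iff)

lemma pair_superset:
  assumes "finite S" "supp f \<subseteq> S" "S \<subseteq> carrier B" "w \<in> carrier B \<rightarrow> carrier K"
  shows "pair f w = (\<Oplus>\<^bsub>K\<^esub>a\<in>S. f a \<otimes>\<^bsub>K\<^esub> w a)"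
  unfolding pair_def using assms coeff_closed
  by (intro K.add.finprod_mono_neutral_cong_left) (auto simp: Pi_iff subset_iff)

lemma pair_zero: "pair f (\<lambda>_. \<zero>\<^bsub>K\<^esub>) = \<zero>\<^bsub>K\<^esub>"
proof -
  have "pair f (\<lambda>_. \<zero>\<^bsub>K\<^esub>) = (\<Oplus>\<^bsub>K\<^esub>a\<in>supp f. \<zero>\<^bsub>K\<^esub>)"
    unfolding pair_def using coeff_closed by (intro K.finsum_cong') auto
  then show ?thesis
    by simp
qed

lemma pair_plus:
  assumes "w \<in> carrier B \<rightarrow> carrier K" "w' \<in> carrier B \<rightarrow> carrier K"
  shows "pair f (\<lambda>a. w a \<oplus>\<^bsub>K\<^esub> w' a) = pair f w \<oplus>\<^bsub>K\<^esub> pair f w'"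
proof -
  have c: "w a \<in> carrier K" "w' a \<in> carrier K" if "a \<in> supp f" for a
    using assms supp_carrier[OF that] by auto
  have "pair f (\<lambda>a. w a \<oplus>\<^bsub>K\<^esub> w' a) = (\<Oplus>\<^bsub>K\<^esub>a\<in>supp f. (f a \<otimes>\<^bsub>K\<^esub> w a) \<oplus>\<^bsub>K\<^esub> (f a \<otimes>\<^bsub>K\<^esub> w' a))"
    unfolding pair_def using coeff_closed c by (intro K.finsum_cong') (auto simp: K.r_distr)
  also have "\<dots> = pair f w \<oplus>\<^bsub>K\<^esub> pair f w'"
    unfolding pair_def using coeff_closed c by (intro K.finsum_addf) auto
  finally show ?thesis .
qed

lemma pair_smult:
  assumes "w \<in> carrier B \<rightarrow> carrier K" "c \<in> carrier K"
  shows "pair f (\<lambda>a. c \<otimes>\<^bsub>K\<^esub> w a) = c \<otimes>\<^bsub>K\<^esub> pair f w"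
proof -
  have w: "w a \<in> carrier K" if "a \<in> supp f" for a
    using assms supp_carrier[OF that] by auto
  have "pair f (\<lambda>a. c \<otimes>\<^bsub>K\<^esub> w a) = (\<Oplus>\<^bsub>K\<^esub>a\<in>supp f. c \<otimes>\<^bsub>K\<^esub> (f a \<otimes>\<^bsub>K\<^esub> w a))"
    unfolding pair_def using coeff_closed w assms(2) by (intro K.finsum_cong') (auto simp: K.m_lcomm)
  also have "\<dots> = c \<otimes>\<^bsub>K\<^esub> pair f w"
    unfolding pair_def using coeff_closed w assms(2) supp_finite
    by (intro K.finsum_rdistr[symmetric]) auto
  finally show ?thesis .
qed

lemma pair_finsum:
  assumes "finite J" "\<And>j a. j \<in> J \<Longrightarrow> a \<in> carrier B \<Longrightarrow> v j a \<in> carrier K"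
  shows "pair f (\<lambda>a. \<Oplus>\<^bsub>K\<^esub>j\<in>J. v j a) = (\<Oplus>\<^bsub>K\<^esub>j\<in>J. pair f (v j))"
  using assms
proof (induction J rule: finite_induct)
  case empty
  then show ?case
    by (simp add: pair_zero)
next
  case (insert i J)
  have "pair f (\<lambda>a. \<Oplus>\<^bsub>K\<^esub>j\<in>insert i J. v j a) = pair f (\<lambda>a. v i a \<oplus>\<^bsub>K\<^esub> (\<Oplus>\<^bsub>K\<^esub>j\<in>J. v j a))"
    using insert by (intro pair_cong K.finsum_insert) (auto intro!: K.finsum_closed)
  also have "\<dots> = pair f (v i) \<oplus>\<^bsub>K\<^esub> pair f (\<lambda>a. \<Oplus>\<^bsub>K\<^esub>j\<in>J. v j a)"
    using insert by (intro pair_plus) (auto intro!: K.finsum_closed)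
  also have "\<dots> = (\<Oplus>\<^bsub>K\<^esub>j\<in>insert i J. pair f (v j))"
    using insert by (subst K.finsum_insert) (auto intro!: pair_closed)
  finally show ?case .
qed

lemma pair_ind: "x \<in> basis \<Longrightarrow> pair f (\<lambda>a. ind (a = x)) = f x"
proof -
  have "pair f (\<lambda>a. ind (a = x)) = (\<Oplus>\<^bsub>K\<^esub>a\<in>supp f. if x = a then f a else \<zero>\<^bsub>K\<^esub>)"
    unfolding pair_def using coeff_closed by (intro K.finsum_cong') (auto simp: ind_def)
  also have "\<dots> = f x"
  proof (cases "x \<in> supp f")
    case True
    then show ?thesis
      using coeff_closed supp_finite by (intro K.finsum_singleton) auto
  next
    case False
    then have "(\<Oplus>\<^bsub>K\<^esub>a\<in>supp f. if x = a then f a else \<zero>\<^bsub>K\<^esub>) = (\<Oplus>\<^bsub>K\<^esub>a\<in>supp f. \<zero>\<^bsub>K\<^esub>)"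
      by (intro K.finsum_cong') auto
    with False show ?thesis
      by simp
  qed
  finally show ?thesis .
qed

end

lemma pair_swap:
  assumes "f \<in> carrier R" "g \<in> carrier R"
    and "\<And>a b. a \<in> carrier B \<Longrightarrow> b \<in> carrier B \<Longrightarrow> F a b \<in> carrier K"
  shows "pair f (\<lambda>a. pair g (F a)) = pair g (\<lambda>b. pair f (\<lambda>a. F a b))"
proof -
  note cg = coeff_closed[OF assms(2)] and sg = supp_carrier[OF assms(2)]
  have "pair f (\<lambda>a. pair g (F a)) = pair f (\<lambda>a. \<Oplus>\<^bsub>K\<^esub>b\<in>supp g. g b \<otimes>\<^bsub>K\<^esub> F a b)"
    by (simp add: pair_def[of g])
  also have "\<dots> = (\<Oplus>\<^bsub>K\<^esub>b\<in>supp g. pair f (\<lambda>a. g b \<otimes>\<^bsub>K\<^esub> F a b))"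
    using assms(3) sg cg by (intro pair_finsum[OF assms(1) supp_finite[OF assms(2)]]) auto
  also have "\<dots> = (\<Oplus>\<^bsub>K\<^esub>b\<in>supp g. g b \<otimes>\<^bsub>K\<^esub> pair f (\<lambda>a. F a b))"
    using assms(3) sg cg
    by (intro K.finsum_cong' pair_smult[OF assms(1)]) (auto intro!: pair_closed[OF assms(1)])
  finally show ?thesis
    by (simp add: pair_def[of g])
qed

lemma pair_add:
  assumes "f \<in> carrier R" "g \<in> carrier R" "w \<in> carrier B \<rightarrow> carrier K"
  shows "pair (f \<oplus>\<^bsub>R\<^esub> g) w = pair f w \<oplus>\<^bsub>K\<^esub> pair g w"
proof -
  let ?S = "supp f \<union> supp g"
  note c = coeff_closed[OF assms(1)] coeff_closed[OF assms(2)]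
  have S: "finite ?S" "?S \<subseteq> carrier B"
    using supp_finite[OF assms(1)] supp_finite[OF assms(2)] supp_carrier[OF assms(1)] supp_carrier[OF assms(2)]
    by auto
  have w: "w a \<in> carrier K" if "a \<in> ?S" for a
    using that S(2) assms(3) by auto
  have sub: "supp (f \<oplus>\<^bsub>R\<^esub> g) \<subseteq> ?S"
    by (auto simp: R_simps)
  have "f \<oplus>\<^bsub>R\<^esub> g \<in> carrier R"
    using assms(1,2) sub finite_subset[OF sub S(1)] by (auto simp: R_carrier R_simps)
  then have "pair (f \<oplus>\<^bsub>R\<^esub> g) w = (\<Oplus>\<^bsub>K\<^esub>a\<in>?S. (f \<oplus>\<^bsub>R\<^esub> g) a \<otimes>\<^bsub>K\<^esub> w a)"
    by (rule pair_superset[OF _ S(1) sub S(2) assms(3)])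
  also have "\<dots> = (\<Oplus>\<^bsub>K\<^esub>a\<in>?S. (f a \<otimes>\<^bsub>K\<^esub> w a) \<oplus>\<^bsub>K\<^esub> (g a \<otimes>\<^bsub>K\<^esub> w a))"
    using c w by (intro K.finsum_cong') (auto simp: R_simps K.l_distr)
  also have "\<dots> = (\<Oplus>\<^bsub>K\<^esub>a\<in>?S. f a \<otimes>\<^bsub>K\<^esub> w a) \<oplus>\<^bsub>K\<^esub> (\<Oplus>\<^bsub>K\<^esub>a\<in>?S. g a \<otimes>\<^bsub>K\<^esub> w a)"
    using c w by (intro K.finsum_addf) auto
  also have "(\<Oplus>\<^bsub>K\<^esub>a\<in>?S. f a \<otimes>\<^bsub>K\<^esub> w a) = pair f w"
    by (rule pair_superset[OF assms(1) S(1) _ S(2) assms(3), symmetric]) auto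
  also have "(\<Oplus>\<^bsub>K\<^esub>a\<in>?S. g a \<otimes>\<^bsub>K\<^esub> w a) = pair g w"
    by (rule pair_superset[OF assms(2) S(1) _ S(2) assms(3), symmetric]) auto
  finally show ?thesis .
qed

lemma mult_outside: "x \<notin> basis \<Longrightarrow> (f \<otimes>\<^bsub>R\<^esub> g) x = \<zero>\<^bsub>K\<^esub>"
  by (auto simp: monoid_algebra_def)

text \<open>The sum over pairs with product \<open>x\<close> becomes a sum over all pairs weighted
  by an indicator, and thus an iterated pairing.\<close>

lemma mult_coeff:
  assumes f: "f \<in> carrier R" and g: "g \<in> carrier R" and x: "x \<in> basis"
  shows "(f \<otimes>\<^bsub>R\<^esub> g) x = pair f (\<lambda>a. pair g (\<lambda>b. ind (a \<otimes>\<^bsub>B\<^esub> b = x)))"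
proof -
  note cf = coeff_closed[OF f] and cg = coeff_closed[OF g]
  let ?h = "\<lambda>p. f (fst p) \<otimes>\<^bsub>K\<^esub> (g (snd p) \<otimes>\<^bsub>K\<^esub> ind (fst p \<otimes>\<^bsub>B\<^esub> snd p = x))"
  let ?P = "{p. f (fst p) \<noteq> \<zero>\<^bsub>K\<^esub> \<and> g (snd p) \<noteq> \<zero>\<^bsub>K\<^esub> \<and> fst p \<otimes>\<^bsub>B\<^esub> snd p = x}"
  have "(f \<otimes>\<^bsub>R\<^esub> g) x = (\<Oplus>\<^bsub>K\<^esub>p\<in>?P. f (fst p) \<otimes>\<^bsub>K\<^esub> g (snd p))"
    using x by (simp add: monoid_algebra_def)
  also have "\<dots> = (\<Oplus>\<^bsub>K\<^esub>p\<in>supp f \<times> supp g. ?h p)"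
    using supp_finite[OF f] supp_finite[OF g] cf cg
    by (intro K.add.finprod_mono_neutral_cong_left) (auto simp: ind_def)
  also have "\<dots> = (\<Oplus>\<^bsub>K\<^esub>a\<in>supp f. \<Oplus>\<^bsub>K\<^esub>b\<in>supp g. ?h (a, b))"
    using supp_finite[OF f] supp_finite[OF g] cf cg by (intro K.finsum_Times) auto
  also have "\<dots> = pair f (\<lambda>a. pair g (\<lambda>b. ind (a \<otimes>\<^bsub>B\<^esub> b = x)))"
    unfolding pair_def fst_conv snd_conv
    using supp_finite[OF g] cf cg by (intro K.finsum_cong' K.finsum_rdistr[symmetric]) (auto intro!: K.finsum_closed)
  finally show ?thesis .
qed

lemma mult_supp:
  assumes f: "f \<in> carrier R" and g: "g \<in> carrier R"
  shows "supp (f \<otimes>\<^bsub>R\<^esub> g) \<subseteq> (\<lambda>(a, b). a \<otimes>\<^bsub>B\<^esub> b) ` (supp f \<times> supp g) \<inter> basis" (is "_ \<subseteq> ?X")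
proof
  fix x assume x: "x \<in> supp (f \<otimes>\<^bsub>R\<^esub> g)"
  then have xb: "x \<in> basis"
    using mult_outside by blast
  have "{p. f (fst p) \<noteq> \<zero>\<^bsub>K\<^esub> \<and> g (snd p) \<noteq> \<zero>\<^bsub>K\<^esub> \<and> fst p \<otimes>\<^bsub>B\<^esub> snd p = x} \<noteq> {}"
  proof
    assume e: "{p. f (fst p) \<noteq> \<zero>\<^bsub>K\<^esub> \<and> g (snd p) \<noteq> \<zero>\<^bsub>K\<^esub> \<and> fst p \<otimes>\<^bsub>B\<^esub> snd p = x} = {}"
    have "(f \<otimes>\<^bsub>R\<^esub> g) x = \<zero>\<^bsub>K\<^esub>"
      using xb unfolding monoid_algebra_def by (simp add: e)
    with x show False
      by simp
  qed
  with xb show "x \<in> ?X"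
    by force
qed

lemma mult_closed:
  assumes f: "f \<in> carrier R" and g: "g \<in> carrier R"
  shows "f \<otimes>\<^bsub>R\<^esub> g \<in> carrier R"
proof -
  have "finite (supp (f \<otimes>\<^bsub>R\<^esub> g))" "supp (f \<otimes>\<^bsub>R\<^esub> g) \<subseteq> basis"
    using mult_supp[OF f g] supp_finite[OF f] supp_finite[OF g] by (auto intro: finite_subset)
  moreover have "(f \<otimes>\<^bsub>R\<^esub> g) x \<in> carrier K" for x
  proof (cases "x \<in> basis")
    case True
    then show ?thesis
      unfolding mult_coeff[OF f g True] by (intro pair_closed[OF f] Pi_I pair_closed[OF g]) auto
  qed (simp add: mult_outside)
  ultimately show ?thesis
    by (simp add: R_carrier)
qed

lemma pair_mult:
  assumes f: "f \<in> carrier R" and g: "g \<in> carrier R"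
    and w: "w \<in> carrier B \<rightarrow> carrier K" "w (pzero B) = \<zero>\<^bsub>K\<^esub>"
  shows "pair (f \<otimes>\<^bsub>R\<^esub> g) w = pair f (\<lambda>a. pair g (\<lambda>b. w (a \<otimes>\<^bsub>B\<^esub> b)))"
proof -
  let ?X = "(\<lambda>(a, b). a \<otimes>\<^bsub>B\<^esub> b) ` (supp f \<times> supp g) \<inter> basis"
  have X: "finite ?X" "?X \<subseteq> carrier B"
    using supp_finite[OF f] supp_finite[OF g] by auto
  have wX: "w x \<in> carrier K" if "x \<in> ?X" for x
    using that w(1) by auto
  have cg: "pair g (\<lambda>b. ind (a \<otimes>\<^bsub>B\<^esub> b = x)) \<in> carrier K" for a x
    by (intro pair_closed[OF g]) auto
  have cfg: "pair f (\<lambda>a. pair g (\<lambda>b. ind (a \<otimes>\<^bsub>B\<^esub> b = x))) \<in> carrier K" for x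
    using cg by (intro pair_closed[OF f]) auto
  have "pair (f \<otimes>\<^bsub>R\<^esub> g) w = (\<Oplus>\<^bsub>K\<^esub>x\<in>?X. (f \<otimes>\<^bsub>R\<^esub> g) x \<otimes>\<^bsub>K\<^esub> w x)"
    by (rule pair_superset[OF mult_closed[OF f g] X(1) mult_supp[OF f g] X(2) w(1)])
  also have "\<dots> = (\<Oplus>\<^bsub>K\<^esub>x\<in>?X. w x \<otimes>\<^bsub>K\<^esub> pair f (\<lambda>a. pair g (\<lambda>b. ind (a \<otimes>\<^bsub>B\<^esub> b = x))))"
    using wX cfg by (intro K.finsum_cong') (auto simp: mult_coeff[OF f g] K.m_comm)
  also have "\<dots> = (\<Oplus>\<^bsub>K\<^esub>x\<in>?X. pair f (\<lambda>a. pair g (\<lambda>b. w x \<otimes>\<^bsub>K\<^esub> ind (a \<otimes>\<^bsub>B\<^esub> b = x))))"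
  proof (rule K.finsum_cong'[OF refl])
    show "(\<lambda>x. pair f (\<lambda>a. pair g (\<lambda>b. w x \<otimes>\<^bsub>K\<^esub> ind (a \<otimes>\<^bsub>B\<^esub> b = x)))) \<in> ?X \<rightarrow> carrier K"
      by (intro Pi_I pair_closed[OF f] pair_closed[OF g] K.m_closed wX ind_closed)
    fix x assume x: "x \<in> ?X"
    have "pair f (\<lambda>a. pair g (\<lambda>b. w x \<otimes>\<^bsub>K\<^esub> ind (a \<otimes>\<^bsub>B\<^esub> b = x))) =
        pair f (\<lambda>a. w x \<otimes>\<^bsub>K\<^esub> pair g (\<lambda>b. ind (a \<otimes>\<^bsub>B\<^esub> b = x)))"
      using wX[OF x] cg by (intro pair_cong[OF f] pair_smult[OF g]) auto
    also have "\<dots> = w x \<otimes>\<^bsub>K\<^esub> pair f (\<lambda>a. pair g (\<lambda>b. ind (a \<otimes>\<^bsub>B\<^esub> b = x)))"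
      using wX[OF x] cg by (intro pair_smult[OF f]) auto
    finally show "w x \<otimes>\<^bsub>K\<^esub> pair f (\<lambda>a. pair g (\<lambda>b. ind (a \<otimes>\<^bsub>B\<^esub> b = x))) =
        pair f (\<lambda>a. pair g (\<lambda>b. w x \<otimes>\<^bsub>K\<^esub> ind (a \<otimes>\<^bsub>B\<^esub> b = x)))" ..
  qed
  also have "\<dots> = pair f (\<lambda>a. \<Oplus>\<^bsub>K\<^esub>x\<in>?X. pair g (\<lambda>b. w x \<otimes>\<^bsub>K\<^esub> ind (a \<otimes>\<^bsub>B\<^esub> b = x)))"
    using wX by (intro pair_finsum[OF f X(1), symmetric] pair_closed[OF g]) auto
  also have "\<dots> = pair f (\<lambda>a. pair g (\<lambda>b. \<Oplus>\<^bsub>K\<^esub>x\<in>?X. w x \<otimes>\<^bsub>K\<^esub> ind (a \<otimes>\<^bsub>B\<^esub> b = x)))"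
    using wX by (intro pair_cong[OF f] pair_finsum[OF g X(1), symmetric] Pi_I pair_closed[OF g])
      (auto intro!: K.finsum_closed)
  also have "\<dots> = pair f (\<lambda>a. pair g (\<lambda>b. w (a \<otimes>\<^bsub>B\<^esub> b)))"
    unfolding pair_def
  proof (intro K.finsum_cong' refl Pi_I)
    fix a assume a: "a \<in> supp f"
    have ac: "a \<in> carrier B"
      using a supp_carrier[OF f] by blast
    have wab: "w (a \<otimes>\<^bsub>B\<^esub> b) \<in> carrier K" if "b \<in> supp g" for b
      using w(1) ac supp_carrier[OF g that] by auto
    then show "f a \<otimes>\<^bsub>K\<^esub> (\<Oplus>\<^bsub>K\<^esub>b\<in>supp g. g b \<otimes>\<^bsub>K\<^esub> w (a \<otimes>\<^bsub>B\<^esub> b)) \<in> carrier K"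
      using coeff_closed[OF f] coeff_closed[OF g] by (auto intro!: K.finsum_closed)
    have "(\<Oplus>\<^bsub>K\<^esub>b\<in>supp g. g b \<otimes>\<^bsub>K\<^esub> (\<Oplus>\<^bsub>K\<^esub>x\<in>?X. w x \<otimes>\<^bsub>K\<^esub> ind (a \<otimes>\<^bsub>B\<^esub> b = x))) =
        (\<Oplus>\<^bsub>K\<^esub>b\<in>supp g. g b \<otimes>\<^bsub>K\<^esub> w (a \<otimes>\<^bsub>B\<^esub> b))"
    proof (rule K.finsum_cong')
      fix b assume b: "b \<in> supp g"
      have "(\<Oplus>\<^bsub>K\<^esub>x\<in>?X. w x \<otimes>\<^bsub>K\<^esub> ind (a \<otimes>\<^bsub>B\<^esub> b = x)) =
          (\<Oplus>\<^bsub>K\<^esub>x\<in>?X. if a \<otimes>\<^bsub>B\<^esub> b = x then w x else \<zero>\<^bsub>K\<^esub>)"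
        using wX by (intro K.finsum_cong') (auto simp: ind_def)
      \<comment> \<open>A product outside \<open>?X\<close> must be zero in \<open>B\<close>; then
        the sum is zero and so is \<open>w\<close> there.\<close>
      also have "\<dots> = w (a \<otimes>\<^bsub>B\<^esub> b)"
      proof (cases "a \<otimes>\<^bsub>B\<^esub> b = pzero B")
        case True
        then have "(\<Oplus>\<^bsub>K\<^esub>x\<in>?X. if a \<otimes>\<^bsub>B\<^esub> b = x then w x else \<zero>\<^bsub>K\<^esub>) = (\<Oplus>\<^bsub>K\<^esub>x\<in>?X. \<zero>\<^bsub>K\<^esub>)"
          by (intro K.finsum_cong') auto
        with True show ?thesis
          by (simp add: w(2))
      next
        case False
        then have "a \<otimes>\<^bsub>B\<^esub> b \<in> ?X"
          using a b ac supp_carrier[OF g b] by force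
        then show ?thesis
          using X(1) wX by (intro K.finsum_singleton) auto
      qed
      finally show "g b \<otimes>\<^bsub>K\<^esub> (\<Oplus>\<^bsub>K\<^esub>x\<in>?X. w x \<otimes>\<^bsub>K\<^esub> ind (a \<otimes>\<^bsub>B\<^esub> b = x)) = g b \<otimes>\<^bsub>K\<^esub> w (a \<otimes>\<^bsub>B\<^esub> b)"
        by simp
    qed (use wab coeff_closed[OF g] in auto)
    then show "f a \<otimes>\<^bsub>K\<^esub> (\<Oplus>\<^bsub>K\<^esub>b\<in>supp g. g b \<otimes>\<^bsub>K\<^esub> (\<Oplus>\<^bsub>K\<^esub>x\<in>?X. w x \<otimes>\<^bsub>K\<^esub> ind (a \<otimes>\<^bsub>B\<^esub> b = x))) =
        f a \<otimes>\<^bsub>K\<^esub> (\<Oplus>\<^bsub>K\<^esub>b\<in>supp g. g b \<otimes>\<^bsub>K\<^esub> w (a \<otimes>\<^bsub>B\<^esub> b))"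
      by simp
  qed
  finally show ?thesis .
qed

text \<open>At \<open>b = pzero B\<close> this is the zero function, as the zero of \<open>B\<close>
  is identified with the zero of the algebra.\<close>

definition single :: "'k \<Rightarrow> 'a \<Rightarrow> 'a \<Rightarrow> 'k" where
  "single c b = (\<lambda>x. if x = b \<and> x \<noteq> pzero B then c else \<zero>\<^bsub>K\<^esub>)"

lemma scalar_eq_single: "scalar K B c = single c \<one>\<^bsub>B\<^esub>"
  by (simp add: scalar_def single_def)

lemma single_closed: "c \<in> carrier K \<Longrightarrow> b \<in> carrier B \<Longrightarrow> single c b \<in> carrier R"
proof -
  have "supp (single c b) \<subseteq> {b}"
    by (auto simp: single_def)
  then show "c \<in> carrier K \<Longrightarrow> b \<in> carrier B \<Longrightarrow> single c b \<in> carrier R"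
    using finite_subset by (fastforce simp: R_carrier single_def)
qed

lemma pair_single:
  assumes "c \<in> carrier K" "b \<in> carrier B" "w \<in> carrier B \<rightarrow> carrier K" "w (pzero B) = \<zero>\<^bsub>K\<^esub>"
  shows "pair (single c b) w = c \<otimes>\<^bsub>K\<^esub> w b"
proof -
  have "pair (single c b) w = (\<Oplus>\<^bsub>K\<^esub>a\<in>{b}. single c b a \<otimes>\<^bsub>K\<^esub> w a)"
    using assms by (intro pair_superset single_closed) (auto simp: single_def)
  also have "\<dots> = single c b b \<otimes>\<^bsub>K\<^esub> w b"
    using assms by (auto simp: single_def Pi_iff)
  also have "\<dots> = c \<otimes>\<^bsub>K\<^esub> w b"
    using assms by (auto simp: single_def)
  finally show ?thesis .
qed

text \<open>The laws of multiplication are checked coefficientwise: \<open>mult_coeff\<close> turns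
  them into laws of \<open>B\<close> under an indicator. Commutativity also uses
  \<open>pair_swap\<close>, distributivity \<open>pair_add\<close>, and associativity
  \<open>pair_mult\<close>.\<close>

lemma monoid_algebra_cring: "cring R"
proof (intro cringI abelian_groupI comm_monoidI)
  have ext: "f = g" if "f \<in> carrier R" "g \<in> carrier R" "\<And>x. x \<in> basis \<Longrightarrow> f x = g x" for f g
    using that coeff_outside by (intro ext) metis
  have add_closed: "f \<oplus>\<^bsub>R\<^esub> g \<in> carrier R" if "f \<in> carrier R" "g \<in> carrier R" for f g
  proof -
    have "supp (f \<oplus>\<^bsub>R\<^esub> g) \<subseteq> supp f \<union> supp g"
      by (auto simp: R_simps)
    moreover from this have "finite (supp (f \<oplus>\<^bsub>R\<^esub> g))"
      using supp_finite[OF that(1)] supp_finite[OF that(2)] by (auto intro: finite_subset)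
    ultimately show ?thesis
      using that by (auto simp: R_carrier R_simps)
  qed
  show "\<zero>\<^bsub>R\<^esub> \<in> carrier R"
    by (simp add: R_carrier R_simps)
  show one: "\<one>\<^bsub>R\<^esub> \<in> carrier R"
    by (simp add: R_simps scalar_eq_single single_closed)
  have zero_mult: "pzero B \<otimes>\<^bsub>B\<^esub> b \<noteq> x" if "x \<in> basis" "b \<in> carrier B" for b x
    using that pzero_mult by auto
  fix f g assume f: "f \<in> carrier R" and g: "g \<in> carrier R"
  note cf = coeff_closed[OF f] and cg = coeff_closed[OF g]
  show "f \<oplus>\<^bsub>R\<^esub> g \<in> carrier R"
    by (rule add_closed[OF f g])
  show "f \<otimes>\<^bsub>R\<^esub> g \<in> carrier R"
    by (rule mult_closed[OF f g])
  show "f \<oplus>\<^bsub>R\<^esub> g = g \<oplus>\<^bsub>R\<^esub> f"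
    using cf cg by (auto simp: R_simps K.a_comm)
  show "\<zero>\<^bsub>R\<^esub> \<oplus>\<^bsub>R\<^esub> f = f"
    using cf by (simp add: R_simps)
  show "\<exists>h\<in>carrier R. h \<oplus>\<^bsub>R\<^esub> f = \<zero>\<^bsub>R\<^esub>"
  proof
    have "supp (\<lambda>x. \<ominus>\<^bsub>K\<^esub> f x) \<subseteq> supp f"
      by auto
    then show "(\<lambda>x. \<ominus>\<^bsub>K\<^esub> f x) \<in> carrier R"
      using f finite_subset by (fastforce simp: R_carrier)
    show "(\<lambda>x. \<ominus>\<^bsub>K\<^esub> f x) \<oplus>\<^bsub>R\<^esub> f = \<zero>\<^bsub>R\<^esub>"
      using cf by (simp add: R_simps K.l_neg)
  qed
  show "f \<otimes>\<^bsub>R\<^esub> g = g \<otimes>\<^bsub>R\<^esub> f"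
  proof (rule ext[OF mult_closed[OF f g] mult_closed[OF g f]])
    fix x assume x: "x \<in> basis"
    have "(f \<otimes>\<^bsub>R\<^esub> g) x = pair g (\<lambda>b. pair f (\<lambda>a. ind (a \<otimes>\<^bsub>B\<^esub> b = x)))"
      unfolding mult_coeff[OF f g x] by (rule pair_swap[OF f g]) simp
    also have "\<dots> = (g \<otimes>\<^bsub>R\<^esub> f) x"
      unfolding mult_coeff[OF g f x]
      by (intro pair_cong[OF g] pair_cong[OF f] Pi_I pair_closed[OF f]) (auto simp: m_comm)
    finally show "(f \<otimes>\<^bsub>R\<^esub> g) x = (g \<otimes>\<^bsub>R\<^esub> f) x" .
  qed
  show "\<one>\<^bsub>R\<^esub> \<otimes>\<^bsub>R\<^esub> f = f"
  proof (rule ext[OF mult_closed[OF one f] f])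
    fix x assume x: "x \<in> basis"
    have "(\<one>\<^bsub>R\<^esub> \<otimes>\<^bsub>R\<^esub> f) x = pair (single \<one>\<^bsub>K\<^esub> \<one>\<^bsub>B\<^esub>) (\<lambda>a. pair f (\<lambda>b. ind (a \<otimes>\<^bsub>B\<^esub> b = x)))"
      unfolding mult_coeff[OF one f x] by (simp add: R_simps scalar_eq_single)
    also have "\<dots> = \<one>\<^bsub>K\<^esub> \<otimes>\<^bsub>K\<^esub> pair f (\<lambda>b. ind (\<one>\<^bsub>B\<^esub> \<otimes>\<^bsub>B\<^esub> b = x))"
    proof (rule pair_single)
      have "pair f (\<lambda>b. ind (pzero B \<otimes>\<^bsub>B\<^esub> b = x)) = pair f (\<lambda>_. \<zero>\<^bsub>K\<^esub>)"
        using zero_mult[OF x] by (intro pair_cong[OF f]) (auto simp: ind_def)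
      then show "pair f (\<lambda>b. ind (pzero B \<otimes>\<^bsub>B\<^esub> b = x)) = \<zero>\<^bsub>K\<^esub>"
        by (simp add: pair_zero[OF f])
    qed (auto intro!: pair_closed[OF f])
    also have "\<dots> = pair f (\<lambda>b. ind (\<one>\<^bsub>B\<^esub> \<otimes>\<^bsub>B\<^esub> b = x))"
      by (intro K.l_one pair_closed[OF f]) simp
    also have "\<dots> = pair f (\<lambda>b. ind (b = x))"
      by (intro pair_cong[OF f]) auto
    also have "\<dots> = f x"
      by (rule pair_ind[OF f x])
    finally show "(\<one>\<^bsub>R\<^esub> \<otimes>\<^bsub>R\<^esub> f) x = f x" .
  qed
  fix h assume h: "h \<in> carrier R"
  note ch = coeff_closed[OF h]
  show "(f \<oplus>\<^bsub>R\<^esub> g) \<oplus>\<^bsub>R\<^esub> h = f \<oplus>\<^bsub>R\<^esub> (g \<oplus>\<^bsub>R\<^esub> h)"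
    using cf cg ch by (simp add: R_simps K.a_assoc)
  show "(f \<oplus>\<^bsub>R\<^esub> g) \<otimes>\<^bsub>R\<^esub> h = f \<otimes>\<^bsub>R\<^esub> h \<oplus>\<^bsub>R\<^esub> g \<otimes>\<^bsub>R\<^esub> h"
  proof (rule ext[OF mult_closed[OF add_closed[OF f g] h] add_closed[OF mult_closed[OF f h] mult_closed[OF g h]]])
    fix x assume x: "x \<in> basis"
    show "((f \<oplus>\<^bsub>R\<^esub> g) \<otimes>\<^bsub>R\<^esub> h) x = (f \<otimes>\<^bsub>R\<^esub> h \<oplus>\<^bsub>R\<^esub> g \<otimes>\<^bsub>R\<^esub> h) x"
      unfolding mult_coeff[OF add_closed[OF f g] h x] R_simps(3)[of "f \<otimes>\<^bsub>R\<^esub> h"]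
        mult_coeff[OF f h x] mult_coeff[OF g h x]
      by (intro pair_add[OF f g] Pi_I pair_closed[OF h]) simp
  qed
  show "(f \<otimes>\<^bsub>R\<^esub> g) \<otimes>\<^bsub>R\<^esub> h = f \<otimes>\<^bsub>R\<^esub> (g \<otimes>\<^bsub>R\<^esub> h)"
  proof (rule ext[OF mult_closed[OF mult_closed[OF f g] h] mult_closed[OF f mult_closed[OF g h]]])
    fix x assume x: "x \<in> basis"
    have "((f \<otimes>\<^bsub>R\<^esub> g) \<otimes>\<^bsub>R\<^esub> h) x = pair (f \<otimes>\<^bsub>R\<^esub> g) (\<lambda>d. pair h (\<lambda>c. ind (d \<otimes>\<^bsub>B\<^esub> c = x)))"
      by (rule mult_coeff[OF mult_closed[OF f g] h x])
    also have "\<dots> = pair f (\<lambda>a. pair g (\<lambda>b. pair h (\<lambda>c. ind ((a \<otimes>\<^bsub>B\<^esub> b) \<otimes>\<^bsub>B\<^esub> c = x))))"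
    proof (rule pair_mult[OF f g])
      have "pair h (\<lambda>c. ind (pzero B \<otimes>\<^bsub>B\<^esub> c = x)) = pair h (\<lambda>_. \<zero>\<^bsub>K\<^esub>)"
        using zero_mult[OF x] by (intro pair_cong[OF h]) (auto simp: ind_def)
      then show "pair h (\<lambda>c. ind (pzero B \<otimes>\<^bsub>B\<^esub> c = x)) = \<zero>\<^bsub>K\<^esub>"
        by (simp add: pair_zero[OF h])
    qed (auto intro!: pair_closed[OF h])
    also have "\<dots> = pair f (\<lambda>a. pair (g \<otimes>\<^bsub>R\<^esub> h) (\<lambda>d. ind (a \<otimes>\<^bsub>B\<^esub> d = x)))"
    proof (rule pair_cong[OF f])
      fix a assume a: "a \<in> carrier B"
      have "pair (g \<otimes>\<^bsub>R\<^esub> h) (\<lambda>d. ind (a \<otimes>\<^bsub>B\<^esub> d = x)) =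
          pair g (\<lambda>b. pair h (\<lambda>c. ind (a \<otimes>\<^bsub>B\<^esub> (b \<otimes>\<^bsub>B\<^esub> c) = x)))"
        using zero_mult[OF x a] a pzero_closed by (intro pair_mult[OF g h]) (auto simp: ind_def m_comm)
      also have "\<dots> = pair g (\<lambda>b. pair h (\<lambda>c. ind ((a \<otimes>\<^bsub>B\<^esub> b) \<otimes>\<^bsub>B\<^esub> c = x)))"
        using a by (intro pair_cong[OF g] pair_cong[OF h] Pi_I pair_closed[OF h]) (auto simp: m_assoc)
      finally show "pair g (\<lambda>b. pair h (\<lambda>c. ind ((a \<otimes>\<^bsub>B\<^esub> b) \<otimes>\<^bsub>B\<^esub> c = x))) =
        pair (g \<otimes>\<^bsub>R\<^esub> h) (\<lambda>d. ind (a \<otimes>\<^bsub>B\<^esub> d = x))" ..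
    qed (auto intro!: pair_closed[OF mult_closed[OF g h]])
    also have "\<dots> = (f \<otimes>\<^bsub>R\<^esub> (g \<otimes>\<^bsub>R\<^esub> h)) x"
      by (rule mult_coeff[OF f mult_closed[OF g h] x, symmetric])
    finally show "((f \<otimes>\<^bsub>R\<^esub> g) \<otimes>\<^bsub>R\<^esub> h) x = (f \<otimes>\<^bsub>R\<^esub> (g \<otimes>\<^bsub>R\<^esub> h)) x" .
  qed
qed

end


section \<open>The algebra of a band\<close>

definition multiset_value :: "('k, 'n) ring_scheme \<Rightarrow> ('a \<Rightarrow> 'k) \<Rightarrow> 'a multiset \<Rightarrow> 'k" where
  "multiset_value K g M = (\<Oplus>\<^bsub>K\<^esub>b\<in>set_mset M. [count M b] \<cdot>\<^bsub>K\<^esub> g b)"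

lemma (in abelian_group) multiset_value_add:
  assumes "\<And>b. b \<in># add_mset a M \<Longrightarrow> g b \<in> carrier G"
  shows "multiset_value G g (add_mset a M) = g a \<oplus> multiset_value G g M"
proof -
  let ?A = "set_mset M - {a}"
  have c: "g a \<in> carrier G" "\<And>b. b \<in> ?A \<Longrightarrow> g b \<in> carrier G"
    using assms by auto
  have rest: "(\<Oplus>b\<in>?A. [count (add_mset a M) b] \<cdot> g b) = (\<Oplus>b\<in>?A. [count M b] \<cdot> g b)"
    using c(2) by (intro finsum_cong') auto
  have S: "(\<Oplus>b\<in>?A. [count M b] \<cdot> g b) \<in> carrier G"
    using c(2) by (intro finsum_closed) auto
  have "multiset_value G g (add_mset a M) = (\<Oplus>b\<in>insert a ?A. [count (add_mset a M) b] \<cdot> g b)"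
    by (simp add: multiset_value_def)
  also have "\<dots> = [count (add_mset a M) a] \<cdot> g a \<oplus> (\<Oplus>b\<in>?A. [count (add_mset a M) b] \<cdot> g b)"
    using c by (intro finsum_insert) auto
  also have "\<dots> = [Suc (count M a)] \<cdot> g a \<oplus> (\<Oplus>b\<in>?A. [count M b] \<cdot> g b)"
    unfolding rest by simp
  also have "\<dots> = g a \<oplus> ([count M a] \<cdot> g a \<oplus> (\<Oplus>b\<in>?A. [count M b] \<cdot> g b))"
    using c S by (simp add: a_ac)
  also have "[count M a] \<cdot> g a \<oplus> (\<Oplus>b\<in>?A. [count M b] \<cdot> g b) = multiset_value G g M"
  proof (cases "a \<in># M")
    case True
    then have "multiset_value G g M = (\<Oplus>b\<in>insert a ?A. [count M b] \<cdot> g b)"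
      by (simp add: multiset_value_def insert_absorb)
    then show ?thesis
      using c by (subst (asm) finsum_insert) auto
  next
    case False
    then have "?A = set_mset M" "count M a = 0"
      by (auto simp: not_in_iff)
    then show ?thesis
      using c(1) S by (simp add: multiset_value_def)
  qed
  finally show ?thesis .
qed

lemma (in abelian_group) multiset_value_closed:
  "(\<And>b. b \<in># M \<Longrightarrow> g b \<in> carrier G) \<Longrightarrow> multiset_value G g M \<in> carrier G"
  unfolding multiset_value_def by (intro finsum_closed) auto

lemma (in ring_hom_cring) hom_multiset_value:
  assumes "\<And>b. b \<in># M \<Longrightarrow> g b \<in> carrier R"
  shows "h (multiset_value R g M) = multiset_value S (\<lambda>b. h (g b)) M"
  using assms
proof (induction M)
  case empty
  then show ?case
    by (simp add: multiset_value_def)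
next
  case (add a M)
  then have c: "g a \<in> carrier R" "multiset_value R g M \<in> carrier R"
    and IH: "h (multiset_value R g M) = multiset_value S (\<lambda>b. h (g b)) M"
    by (auto intro!: R.multiset_value_closed)
  have "multiset_value S (\<lambda>b. h (g b)) (add_mset a M) = h (g a) \<oplus>\<^bsub>S\<^esub> multiset_value S (\<lambda>b. h (g b)) M"
    by (intro S.multiset_value_add hom_closed add.prems)
  moreover have "multiset_value R g (add_mset a M) = g a \<oplus>\<^bsub>R\<^esub> multiset_value R g M"
    by (intro R.multiset_value_add add.prems)
  ultimately show ?case
    using c IH by simp
qed

text \<open>The map \<open>g\<close> may merge different entries, so the multiplicities on the two
  sides do not correspond. Adding one entry at a time avoids regrouping.\<close>

lemma (in abelian_group) multiset_value_nonzero_image: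
  assumes "\<And>b. b \<in># M \<Longrightarrow> g b \<in> carrier G"
  shows "multiset_value G (\<lambda>x. x) (filter_mset (\<lambda>x. x \<noteq> \<zero>) (image_mset g M)) = multiset_value G g M"
  using assms
proof (induction M)
  case empty
  then show ?case
    by (simp add: multiset_value_def)
next
  case (add a M)
  then have c: "g a \<in> carrier G" "multiset_value G g M \<in> carrier G"
    and IH: "multiset_value G (\<lambda>x. x) (filter_mset (\<lambda>x. x \<noteq> \<zero>) (image_mset g M)) = multiset_value G g M"
    by (auto intro!: multiset_value_closed)
  have step: "multiset_value G g (add_mset a M) = g a \<oplus> multiset_value G g M"
    by (intro multiset_value_add add.prems)
  show ?case
  proof (cases "g a = \<zero>")
    case True
    then show ?thesis
      using IH c by (simp add: step)
  next
    case False
    have "multiset_value G (\<lambda>x. x) (add_mset (g a) (filter_mset (\<lambda>x. x \<noteq> \<zero>) (image_mset g M))) =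
        g a \<oplus> multiset_value G (\<lambda>x. x) (filter_mset (\<lambda>x. x \<noteq> \<zero>) (image_mset g M))"
      using add.prems by (intro multiset_value_add) auto
    with False show ?thesis
      using IH by (simp add: step)
  qed
qed

lemma ring_band_null_iff:
  assumes "field K" and "\<And>b. b \<in># M \<Longrightarrow> g b \<in> carrier K"
  shows "formal_sum (ring_band K) (image_mset g M) \<in> nullset (ring_band K) \<longleftrightarrow>
    multiset_value K g M = \<zero>\<^bsub>K\<^esub>"
proof -
  interpret field K by fact
  let ?N = "filter_mset (\<lambda>x. x \<noteq> \<zero>\<^bsub>K\<^esub>) (image_mset g M)"
  have "formal_sum (ring_band K) (image_mset g M) = ?N"
    by (simp add: formal_sum_def ring_band_def)
  moreover have "set_mset ?N \<subseteq> carrier K - {\<zero>\<^bsub>K\<^esub>}"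
    using assms(2) by auto
  ultimately have "formal_sum (ring_band K) (image_mset g M) \<in> nullset (ring_band K) \<longleftrightarrow>
      multiset_value K (\<lambda>x. x) ?N = \<zero>\<^bsub>K\<^esub>"
    by (simp add: ring_band_def multiset_value_def)
  then show ?thesis
    using multiset_value_nonzero_image[of M g] assms(2) by simp
qed

section \<open>The quotient algebra of a band and its homomorphisms\<close>

locale band_algebra = band B + K: field K
  for B :: "('a, 'm) band_scheme" and K :: "('k, 'n) ring_scheme"

sublocale band_algebra \<subseteq> monoid_alg B K ..

context band_algebra
begin

sublocale R: cring R
  by (rule monoid_algebra_cring)

abbreviation "\<delta> b \<equiv> single \<one>\<^bsub>K\<^esub> b"

lemma ext_R: "f \<in> carrier R \<Longrightarrow> g \<in> carrier R \<Longrightarrow> (\<And>x. x \<in> basis \<Longrightarrow> f x = g x) \<Longrightarrow> f = g"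
  using coeff_outside by (intro ext) metis

lemma single_mult:
  assumes "c \<in> carrier K" "d \<in> carrier K" "a \<in> carrier B" "b \<in> carrier B"
  shows "single c a \<otimes>\<^bsub>R\<^esub> single d b = single (c \<otimes>\<^bsub>K\<^esub> d) (a \<otimes>\<^bsub>B\<^esub> b)"
proof (rule ext_R)
  note s = single_closed[OF assms(1,3)] single_closed[OF assms(2,4)]
  show "single c a \<otimes>\<^bsub>R\<^esub> single d b \<in> carrier R"
    by (rule mult_closed[OF s])
  show "single (c \<otimes>\<^bsub>K\<^esub> d) (a \<otimes>\<^bsub>B\<^esub> b) \<in> carrier R"
    using assms by (intro single_closed) auto
  fix x assume x: "x \<in> basis"
  have z: "ind (pzero B \<otimes>\<^bsub>B\<^esub> b' = x) = \<zero>\<^bsub>K\<^esub>" "ind (b' \<otimes>\<^bsub>B\<^esub> pzero B = x) = \<zero>\<^bsub>K\<^esub>" if "b' \<in> carrier B" for b'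
    using that x pzero_mult[OF that] m_comm[OF that pzero_closed] by (auto simp: ind_def)
  have inner: "pair (single d b) (\<lambda>b'. ind (a' \<otimes>\<^bsub>B\<^esub> b' = x)) = d \<otimes>\<^bsub>K\<^esub> ind (a' \<otimes>\<^bsub>B\<^esub> b = x)"
    if "a' \<in> carrier B" for a'
    using assms z(2)[OF that] by (intro pair_single) auto
  have "(single c a \<otimes>\<^bsub>R\<^esub> single d b) x =
      pair (single c a) (\<lambda>a'. pair (single d b) (\<lambda>b'. ind (a' \<otimes>\<^bsub>B\<^esub> b' = x)))"
    by (rule mult_coeff[OF s x])
  also have "\<dots> = pair (single c a) (\<lambda>a'. d \<otimes>\<^bsub>K\<^esub> ind (a' \<otimes>\<^bsub>B\<^esub> b = x))"
    using inner assms by (intro pair_cong[OF s(1)]) auto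
  also have "\<dots> = c \<otimes>\<^bsub>K\<^esub> (d \<otimes>\<^bsub>K\<^esub> ind (a \<otimes>\<^bsub>B\<^esub> b = x))"
    using assms z(1)[OF assms(4)] by (intro pair_single) auto
  also have "\<dots> = single (c \<otimes>\<^bsub>K\<^esub> d) (a \<otimes>\<^bsub>B\<^esub> b) x"
    using assms x by (auto simp: ind_def single_def)
  finally show "(single c a \<otimes>\<^bsub>R\<^esub> single d b) x = single (c \<otimes>\<^bsub>K\<^esub> d) (a \<otimes>\<^bsub>B\<^esub> b) x" .
qed

lemma scalar_hom: "scalar K B \<in> ring_hom K R"
proof (rule ring_hom_memI)
  show "scalar K B c \<in> carrier R" if "c \<in> carrier K" for c
    unfolding scalar_eq_single using that by (intro single_closed) auto
  show "scalar K B (c \<otimes>\<^bsub>K\<^esub> d) = scalar K B c \<otimes>\<^bsub>R\<^esub> scalar K B d"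
    if "c \<in> carrier K" "d \<in> carrier K" for c d
    unfolding scalar_eq_single using single_mult[OF that one_closed one_closed] by simp
qed (auto simp: R_simps scalar_def)

lemma single_eq: "c \<in> carrier K \<Longrightarrow> b \<in> carrier B \<Longrightarrow> single c b = scalar K B c \<otimes>\<^bsub>R\<^esub> \<delta> b"
  unfolding scalar_eq_single using single_mult[of c "\<one>\<^bsub>K\<^esub>" "\<one>\<^bsub>B\<^esub>" b] by simp

lemma single_pzero: "single c (pzero B) = \<zero>\<^bsub>R\<^esub>"
  by (auto simp: single_def R_simps)

lemma delta_closed: "b \<in> carrier B \<Longrightarrow> \<delta> b \<in> carrier R"
  by (simp add: single_closed)

text \<open>The elements of \<open>B\<close> whose basis vector lies in \<open>H\<close> form a
  submonoid containing the generators, hence all of \<open>B\<close>. A general element is then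
  built by removing one point of its support at a time.\<close>

lemma R_generated:
  assumes gen: "generators B as" and H: "subring H R"
    and "scalar K B ` carrier K \<subseteq> H" "\<And>i. i < length as \<Longrightarrow> \<delta> (as ! i) \<in> H"
  shows "carrier R \<subseteq> H"
proof
  have "submonoid {b \<in> carrier B. \<delta> b \<in> H} B"
  proof
    show "\<one>\<^bsub>B\<^esub> \<in> {b \<in> carrier B. \<delta> b \<in> H}"
      using subringE(3)[OF H] by (simp add: R_simps scalar_eq_single)
    show "a \<otimes>\<^bsub>B\<^esub> b \<in> {b \<in> carrier B. \<delta> b \<in> H}"
      if "a \<in> {b \<in> carrier B. \<delta> b \<in> H}" "b \<in> {b \<in> carrier B. \<delta> b \<in> H}" for a b
      using that single_mult[of "\<one>\<^bsub>K\<^esub>" "\<one>\<^bsub>K\<^esub>" a b] subringE(6)[OF H, of "\<delta> a" "\<delta> b"] by simp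
  qed auto
  moreover have "pzero B \<in> {b \<in> carrier B. \<delta> b \<in> H}"
    using pzero_closed subringE(2)[OF H] by (simp add: single_pzero)
  moreover have "as ! i \<in> {b \<in> carrier B. \<delta> b \<in> H}" if "i < length as" for i
    using assms(4)[OF that] gen that by (auto simp: generators_def)
  ultimately have \<delta>H: "\<delta> b \<in> H" if "b \<in> carrier B" for b
    using generators_induct[OF gen, of "{b \<in> carrier B. \<delta> b \<in> H}" b] that by blast
  have "f \<in> H" if "f \<in> carrier R" for f
    using that
  proof (induction "card (supp f)" arbitrary: f)
    case 0
    then have "f = \<zero>\<^bsub>R\<^esub>"
      using supp_finite[OF 0(2)] by (auto simp: R_simps)
    then show ?case
      using subringE(2)[OF H] by simp
  next
    case (Suc m)
    then obtain b where b: "b \<in> supp f"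
      by fastforce
    then have bb: "b \<in> basis"
      using Suc.prems by (auto simp: R_carrier)
    define g where "g = f(b := \<zero>\<^bsub>K\<^esub>)"
    have supp: "supp g = supp f - {b}"
      by (auto simp: g_def)
    have g: "g \<in> carrier R"
      using Suc.prems supp by (auto simp: R_carrier g_def)
    have "card (supp g) = m"
      using supp Suc.hyps(2) b by simp
    then have "g \<in> H"
      using Suc.hyps(1) g by blast
    moreover have "scalar K B (f b) \<otimes>\<^bsub>R\<^esub> \<delta> b \<in> H"
      using assms(3) coeff_closed[OF Suc.prems] \<delta>H bb by (intro subringE(6)[OF H]) auto
    moreover have "f = scalar K B (f b) \<otimes>\<^bsub>R\<^esub> \<delta> b \<oplus>\<^bsub>R\<^esub> g"
      using coeff_closed[OF Suc.prems] bb single_eq[of "f b" b, symmetric]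
      by (auto simp: R_simps g_def single_def)
    ultimately show ?case
      using subringE(7)[OF H] by metis
  qed
  then show "f \<in> H" if "f \<in> carrier R" for f
    using that by blast
qed

lemma multiset_value_delta:
  assumes "set_mset M \<subseteq> basis"
  shows "formal_sum_in_algebra K M = multiset_value R \<delta> M"
  using assms
proof (induction M)
  case empty
  then show ?case
    by (simp add: formal_sum_in_algebra_def multiset_value_def R_simps)
next
  case (add a M)
  have "multiset_value R \<delta> (add_mset a M) = \<delta> a \<oplus>\<^bsub>R\<^esub> multiset_value R \<delta> M"
    using add.prems by (intro R.multiset_value_add delta_closed) auto
  also have "\<dots> = formal_sum_in_algebra K (add_mset a M)"
  proof
    fix x
    have "multiset_value R \<delta> M x = [count M x] \<cdot>\<^bsub>K\<^esub> \<one>\<^bsub>K\<^esub>"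
      using add by (metis (no_types, lifting) formal_sum_in_algebra_def add_mset_commute insert_subset set_mset_add_mset_insert)
    then show "(\<delta> a \<oplus>\<^bsub>R\<^esub> multiset_value R \<delta> M) x = formal_sum_in_algebra K (add_mset a M) x"
      using add.prems by (simp add: R_simps formal_sum_in_algebra_def single_def K.add.m_comm)
  qed
  finally show ?case ..
qed

lemma formal_sum_closed: "M \<in> nullset B \<Longrightarrow> formal_sum_in_algebra K M \<in> carrier R"
  using multiset_value_delta[OF nullset_subset] nullset_subset
  by (auto intro!: R.multiset_value_closed delta_closed)

sublocale I: ideal "null_ideal K B" R
  unfolding null_ideal_def using formal_sum_closed by (intro R.genideal_ideal) auto

lemma rho_eq: "rho K B = R Quot null_ideal K B"
  by (simp add: rho_def)

sublocale rho: cring "rho K B"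
  unfolding rho_eq by (rule I.quotient_is_cring[OF R.is_cring])

definition proj :: "('a \<Rightarrow> 'k) \<Rightarrow> ('a \<Rightarrow> 'k) set" where
  "proj f = null_ideal K B +>\<^bsub>R\<^esub> f"

lemma proj_hom: "proj \<in> ring_hom R (rho K B)"
  unfolding rho_eq proj_def[abs_def] using I.rcos_ring_hom .

sublocale proj: ring_hom_cring R "rho K B" proj
  by unfold_locales (rule proj_hom)

lemma proj_surj: "y \<in> carrier (rho K B) \<Longrightarrow> \<exists>f\<in>carrier R. y = proj f"
  by (auto simp: rho_eq proj_def FactRing_def A_RCOSETS_def')

lemma proj_null:
  assumes "M \<in> nullset B"
  shows "multiset_value (rho K B) (\<lambda>b. proj (\<delta> b)) M = \<zero>\<^bsub>rho K B\<^esub>"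
proof -
  have "multiset_value (rho K B) (\<lambda>b. proj (\<delta> b)) M = proj (multiset_value R \<delta> M)"
    using nullset_subset[OF assms] by (intro proj.hom_multiset_value[symmetric] delta_closed) auto
  also have "\<dots> = proj (formal_sum_in_algebra K M)"
    using multiset_value_delta[OF nullset_subset[OF assms]] by simp
  also have "formal_sum_in_algebra K M \<in> null_ideal K B"
    unfolding null_ideal_def using R.genideal_self[of "formal_sum_in_algebra K ` nullset B"]
      formal_sum_closed assms by blast
  then have "proj (formal_sum_in_algebra K M) = \<zero>\<^bsub>rho K B\<^esub>"
    unfolding proj_def rho_eq by (simp add: I.a_rcos_const FactRing_def)
  finally show ?thesis .
qed

lemma fg_algebra_rho:
  assumes gen: "generators B as"
  shows "fg_algebra K (rho K B) (\<lambda>c. proj (scalar K B c)) (\<lambda>i. proj (\<delta> (as ! i))) (length as)"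
proof -
  have as: "as ! i \<in> carrier B" if "i < length as" for i
    using gen that by (auto simp: generators_def)
  have hom: "(\<lambda>c. proj (scalar K B c)) \<in> ring_hom K (rho K B)"
    using ring_hom_trans[OF scalar_hom proj_hom] by (simp add: comp_def)
  show ?thesis
  proof (intro fg_algebra.intro fg_algebra_axioms.intro ring_hom_cring.intro ring_hom_cring_axioms.intro
      K.field_axioms rho.cring_axioms K.is_cring hom)
    show "proj (\<delta> (as ! i)) \<in> carrier (rho K B)" if "i < length as" for i
      using as[OF that] by (intro proj.hom_closed delta_closed)
    fix H assume H: "subring H (rho K B)" "(\<lambda>c. proj (scalar K B c)) ` carrier K \<subseteq> H"
      "\<And>i. i < length as \<Longrightarrow> proj (\<delta> (as ! i)) \<in> H"
    note sH = subringE[OF H(1)]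
    have "carrier R \<subseteq> {f \<in> carrier R. proj f \<in> H}"
    proof (rule R_generated[OF gen])
      show "subring {f \<in> carrier R. proj f \<in> H} R"
        using sH by (intro R.subringI) (auto simp: proj.hom_a_inv)
      show "scalar K B ` carrier K \<subseteq> {f \<in> carrier R. proj f \<in> H}"
        using H(2) ring_hom_closed[OF scalar_hom] by auto
      show "\<delta> (as ! i) \<in> {f \<in> carrier R. proj f \<in> H}" if "i < length as" for i
        using H(3)[OF that] as[OF that] delta_closed by blast
    qed
    then show "carrier (rho K B) \<subseteq> H"
      using proj_surj by blast
  qed
qed

text \<open>This is the direction of \<open>X(K) = Hom(B, K)\<close> from band homomorphisms to
  points: pairing with \<open>g\<close> is a ring homomorphism on the monoid algebra that kills the
  formal sums of the nullset, so it factors through the quotient.\<close>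

lemma rho_lift:
  assumes g: "g \<in> band_Hom B (ring_band K)"
  obtains h where "h \<in> ring_hom (rho K B) K" "\<And>c. c \<in> carrier K \<Longrightarrow> h (proj (scalar K B c)) = c"
    "\<And>b. b \<in> carrier B \<Longrightarrow> h (proj (\<delta> b)) = g b"
proof -
  have g_closed: "g \<in> carrier B \<rightarrow> carrier K" and g_zero: "g (pzero B) = \<zero>\<^bsub>K\<^esub>" and g_one: "g \<one>\<^bsub>B\<^esub> = \<one>\<^bsub>K\<^esub>"
    and g_mult: "\<And>a b. a \<in> carrier B \<Longrightarrow> b \<in> carrier B \<Longrightarrow> g (a \<otimes>\<^bsub>B\<^esub> b) = g a \<otimes>\<^bsub>K\<^esub> g b"
    and g_null: "\<And>M. M \<in> nullset B \<Longrightarrow> formal_sum (ring_band K) (image_mset g M) \<in> nullset (ring_band K)"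
    using g by (auto simp: band_Hom_def hom_def ring_band_def)
  define e where "e f = pair f g" for f
  have e_single: "e (single c b) = c \<otimes>\<^bsub>K\<^esub> g b" if "c \<in> carrier K" "b \<in> carrier B" for c b
    unfolding e_def by (rule pair_single[OF that g_closed g_zero])
  have e_hom: "e \<in> ring_hom R K"
  proof (rule ring_hom_memI)
    fix f f' assume f: "f \<in> carrier R" "f' \<in> carrier R"
    show "e f \<in> carrier K"
      unfolding e_def by (rule pair_closed[OF f(1) g_closed])
    show "e (f \<oplus>\<^bsub>R\<^esub> f') = e f \<oplus>\<^bsub>K\<^esub> e f'"
      unfolding e_def by (rule pair_add[OF f g_closed])
    have gf': "e f' \<in> carrier K"
      unfolding e_def by (rule pair_closed[OF f(2) g_closed])
    have "e (f \<otimes>\<^bsub>R\<^esub> f') = pair f (\<lambda>a. pair f' (\<lambda>b. g (a \<otimes>\<^bsub>B\<^esub> b)))"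
      unfolding e_def by (rule pair_mult[OF f g_closed g_zero])
    also have "\<dots> = pair f (\<lambda>a. e f' \<otimes>\<^bsub>K\<^esub> g a)"
    proof (rule pair_cong[OF f(1)])
      fix a assume a: "a \<in> carrier B"
      then have ga: "g a \<in> carrier K"
        using g_closed by blast
      have "pair f' (\<lambda>b. g (a \<otimes>\<^bsub>B\<^esub> b)) = pair f' (\<lambda>b. g a \<otimes>\<^bsub>K\<^esub> g b)"
        using ga g_closed g_mult[OF a] by (intro pair_cong[OF f(2)]) auto
      also have "\<dots> = g a \<otimes>\<^bsub>K\<^esub> e f'"
        unfolding e_def by (rule pair_smult[OF f(2) g_closed ga])
      finally show "pair f' (\<lambda>b. g (a \<otimes>\<^bsub>B\<^esub> b)) = e f' \<otimes>\<^bsub>K\<^esub> g a"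
        using ga gf' by (simp add: K.m_comm)
    qed (use gf' g_closed in auto)
    also have "\<dots> = e f' \<otimes>\<^bsub>K\<^esub> e f"
      unfolding e_def by (rule pair_smult[OF f(1) g_closed gf'[unfolded e_def]])
    finally show "e (f \<otimes>\<^bsub>R\<^esub> f') = e f \<otimes>\<^bsub>K\<^esub> e f'"
      using pair_closed[OF f(1) g_closed] gf' by (simp add: e_def K.m_comm)
  next
    show "e \<one>\<^bsub>R\<^esub> = \<one>\<^bsub>K\<^esub>"
      by (simp add: R_simps scalar_eq_single e_single g_one)
  qed
  interpret e: ring_hom_cring R K e
    by unfold_locales (rule e_hom)
  have ker: "ideal (a_kernel R K e) R"
    by (rule e.ring.kernel_is_ideal)
  have ker_iff: "f \<in> a_kernel R K e \<longleftrightarrow> f \<in> carrier R \<and> e f = \<zero>\<^bsub>K\<^esub>" for f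
    unfolding a_kernel_def' by blast
  have "formal_sum_in_algebra K ` nullset B \<subseteq> a_kernel R K e"
  proof
    fix f assume "f \<in> formal_sum_in_algebra K ` nullset B"
    then obtain M where M: "M \<in> nullset B" "f = formal_sum_in_algebra K M"
      by blast
    have carr: "b \<in> carrier B" if "b \<in># M" for b
      using nullset_subset[OF M(1)] that by blast
    have gb: "e (\<delta> b) = g b" if "b \<in> carrier B" for b
      using e_single[OF K.one_closed that] K.l_one[OF funcset_mem[OF g_closed that]] by simp
    have "e f = multiset_value K (\<lambda>b. e (\<delta> b)) M"
      unfolding M(2) multiset_value_delta[OF nullset_subset[OF M(1)]]
      using carr by (intro e.hom_multiset_value delta_closed) auto
    also have "\<dots> = multiset_value K g M"
      unfolding multiset_value_def using carr gb g_closed by (intro K.finsum_cong') (auto simp: Pi_iff)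
    also have "\<dots> = \<zero>\<^bsub>K\<^esub>"
      using g_null[OF M(1)] ring_band_null_iff[OF K.field_axioms, of M g] carr g_closed by blast
    finally show "f \<in> a_kernel R K e"
      unfolding ker_iff using formal_sum_closed[OF M(1)] M(2) by blast
  qed
  then have I_ker: "null_ideal K B \<subseteq> a_kernel R K e"
    unfolding null_ideal_def by (rule R.genideal_minimal[OF ker])
  \<comment> \<open>Elements of the quotient are cosets, and \<open>e\<close> is constant on each
    coset because the null ideal lies in its kernel.\<close>
  define h where "h y = the_elem (e ` y)" for y
  have h: "h (proj f) = e f" if f: "f \<in> carrier R" for f
  proof -
    have "e x = e f" if x: "x \<in> proj f" for x
    proof -
      obtain i where i: "i \<in> null_ideal K B" "x = i \<oplus>\<^bsub>R\<^esub> f"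
        using x unfolding proj_def a_r_coset_def' by blast
      then have "i \<in> carrier R" "e i = \<zero>\<^bsub>K\<^esub>"
        using I_ker unfolding subset_iff ker_iff by blast+
      moreover have "e f \<in> carrier K"
        by (rule e.hom_closed[OF f])
      ultimately show ?thesis
        unfolding i(2) using e.hom_add[of i f] f K.l_zero[of "e f"] by metis
    qed
    moreover have "f \<in> proj f"
      unfolding proj_def using f by (rule I.a_rcos_self)
    ultimately have "e ` proj f = {e f}"
      by blast
    then show ?thesis
      by (simp add: h_def)
  qed
  have "h \<in> ring_hom (rho K B) K"
  proof (rule ring_hom_memI)
    fix x y assume x: "x \<in> carrier (rho K B)" and y: "y \<in> carrier (rho K B)"
    obtain f where f: "f \<in> carrier R" "x = proj f"
      using proj_surj[OF x] by (elim bexE) (rule that)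
    obtain f' where f': "f' \<in> carrier R" "y = proj f'"
      using proj_surj[OF y] by (elim bexE) (rule that)
    show "h x \<in> carrier K"
      unfolding f(2) h[OF f(1)] by (rule e.hom_closed[OF f(1)])
    show "h (x \<otimes>\<^bsub>rho K B\<^esub> y) = h x \<otimes>\<^bsub>K\<^esub> h y"
      unfolding f(2) f'(2) proj.hom_mult[OF f(1) f'(1), symmetric] h[OF f(1)] h[OF f'(1)]
        h[OF R.m_closed[OF f(1) f'(1)]] by (rule e.hom_mult[OF f(1) f'(1)])
    show "h (x \<oplus>\<^bsub>rho K B\<^esub> y) = h x \<oplus>\<^bsub>K\<^esub> h y"
      unfolding f(2) f'(2) proj.hom_add[OF f(1) f'(1), symmetric] h[OF f(1)] h[OF f'(1)]
        h[OF R.a_closed[OF f(1) f'(1)]] by (rule e.hom_add[OF f(1) f'(1)])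
  next
    show "h \<one>\<^bsub>rho K B\<^esub> = \<one>\<^bsub>K\<^esub>"
      unfolding proj.hom_one[symmetric] h[OF R.one_closed] by (rule e.hom_one)
  qed
  moreover have "h (proj (scalar K B c)) = c" if "c \<in> carrier K" for c
    using that h[OF ring_hom_closed[OF scalar_hom that]] e_single[OF that one_closed]
    by (simp add: scalar_eq_single g_one)
  moreover have "h (proj (\<delta> b)) = g b" if "b \<in> carrier B" for b
    using h[OF delta_closed[OF that]] e_single[OF K.one_closed that] K.l_one[OF funcset_mem[OF g_closed that]]
    by simp
  ultimately show thesis
    by (rule that)
qed

end

context fg_algebra
begin

text \<open>The equalizer of two homomorphisms is a subring; it contains the constants and the
  generators.\<close>

lemma rational_homs_eqI:
  assumes "\<xi> \<in> rational_homs" "\<xi>' \<in> rational_homs" "\<And>i. i < n \<Longrightarrow> \<xi> (u i) = \<xi>' (u i)" "x \<in> carrier R"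
  shows "\<xi> x = \<xi>' x"
proof -
  have hom: "\<xi> \<in> ring_hom R K" "\<xi>' \<in> ring_hom R K"
    and \<sigma>: "\<And>a. a \<in> carrier K \<Longrightarrow> \<xi> (\<sigma> a) = \<xi>' (\<sigma> a)"
    using assms(1,2) by (auto simp: rational_homs_def)
  interpret \<xi>: ring_hom_cring R K \<xi>
    by unfold_locales (rule hom)
  interpret \<xi>': ring_hom_cring R K \<xi>'
    by unfold_locales (rule hom)
  have "subring {x \<in> carrier R. \<xi> x = \<xi>' x} R"
    by (intro R.subringI) auto
  then have "carrier R \<subseteq> {x \<in> carrier R. \<xi> x = \<xi>' x}"
    by (rule generated) (use \<sigma> u_closed assms(3) in auto)
  with assms(4) show ?thesis
    by blast
qed

end

lemma band_Hom_eqI: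
  assumes B: "band B" and gen: "generators B as" and f: "f \<in> band_Hom B C" "g \<in> band_Hom B C"
    and eq: "\<And>i. i < length as \<Longrightarrow> f (as ! i) = g (as ! i)"
  shows "f = g"
proof -
  interpret band B
    by (rule B)
  have hom: "f \<in> hom B C" "g \<in> hom B C" and ext: "f \<in> extensional (carrier B)" "g \<in> extensional (carrier B)"
    and const: "f (pzero B) = g (pzero B)" "f \<one>\<^bsub>B\<^esub> = g \<one>\<^bsub>B\<^esub>"
    using f by (auto simp: band_Hom_def)
  let ?H = "{b \<in> carrier B. f b = g b}"
  have "submonoid ?H B"
    using const(2) hom_mult[OF hom(1)] hom_mult[OF hom(2)] by unfold_locales auto
  moreover have "pzero B \<in> ?H"
    using pzero_closed const(1) by simp
  moreover have "as ! i \<in> ?H" if "i < length as" for i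
    using gen that eq by (auto simp: generators_def)
  ultimately have "b \<in> ?H" if "b \<in> carrier B" for b
    using generators_induct[OF gen, of ?H b] that by blast
  then show ?thesis
    using ext by (intro extensionalityI) auto
qed

section \<open>Comparison of dimensions and finiteness of rational points\<close>

context band_algebra
begin

text \<open>The bridge between the algebraic and the tropical side: the map to the residue field of
  \<open>P\<close> restricts to a field-valued point of \<open>B\<close>, and independence modulo
  \<open>P\<close> becomes independence over the image of \<open>K\<close> in that field.\<close>

lemma card_independent_mod_prime_le:
  assumes gen: "generators B as" and P: "primeideal P (rho K B)" and I: "I \<subseteq> {..<length as}"
    and ind: "alg_independent (rho K B) P ((\<lambda>c. proj (scalar K B c)) ` carrier K) (\<lambda>i. proj (\<delta> (as ! i))) I"
    and dim: "covering_dim_le (Sigma_space B as) n"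
  shows "int (card I) \<le> n"
proof -
  interpret P: primeideal P "rho K B"
    by (rule P)
  obtain L :: "(('a \<Rightarrow> 'k) set set \<times> ('a \<Rightarrow> 'k) set set) set ring" and \<theta> where
    L: "field L" and \<theta>: "\<theta> \<in> ring_hom (rho K B) L"
    and ker: "\<forall>x\<in>carrier (rho K B). \<theta> x = \<zero>\<^bsub>L\<^esub> \<longleftrightarrow> x \<in> P"
    by (rule P.residue_field_at_prime)
  interpret L: field L
    by (rule L)
  interpret \<theta>: ring_hom_cring "rho K B" L \<theta>
    by unfold_locales (rule \<theta>)
  let ?\<sigma> = "\<lambda>c. proj (scalar K B c)" and ?u = "\<lambda>b. proj (\<delta> b)"
  have \<sigma>: "?\<sigma> \<in> ring_hom K (rho K B)"
    using ring_hom_trans[OF scalar_hom proj_hom] by (simp add: comp_def)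
  have u_closed: "?u b \<in> carrier (rho K B)" if "b \<in> carrier B" for b
    by (rule proj.hom_closed[OF delta_closed[OF that]])
  have point: "band_point B L (\<lambda>b. \<theta> (?u b))"
  proof (intro band_point.intro band_point_axioms.intro band_axioms L)
    fix a assume a: "a \<in> carrier B"
    show "\<theta> (?u a) \<in> carrier L"
      by (rule \<theta>.hom_closed[OF u_closed[OF a]])
    fix b assume b: "b \<in> carrier B"
    have "\<delta> (a \<otimes>\<^bsub>B\<^esub> b) = \<delta> a \<otimes>\<^bsub>R\<^esub> \<delta> b"
      using single_mult[OF K.one_closed K.one_closed a b] by simp
    then show "\<theta> (?u (a \<otimes>\<^bsub>B\<^esub> b)) = \<theta> (?u a) \<otimes>\<^bsub>L\<^esub> \<theta> (?u b)"
      by (simp only: proj.hom_mult[OF delta_closed[OF a] delta_closed[OF b]]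
          \<theta>.hom_mult[OF u_closed[OF a] u_closed[OF b]])
  next
    have "\<delta> \<one>\<^bsub>B\<^esub> = \<one>\<^bsub>R\<^esub>"
      by (simp add: R_simps scalar_eq_single)
    then show "\<theta> (?u \<one>\<^bsub>B\<^esub>) = \<one>\<^bsub>L\<^esub>"
      by (simp only: proj.hom_one \<theta>.hom_one)
    show "\<theta> (?u (pzero B)) = \<zero>\<^bsub>L\<^esub>"
      by (simp only: single_pzero proj.hom_zero \<theta>.hom_zero)
    fix N assume N: "N \<in> nullset B"
    have "\<theta> (multiset_value (rho K B) ?u N) = multiset_value L (\<lambda>b. \<theta> (?u b)) N"
      using nullset_subset[OF N] by (intro \<theta>.hom_multiset_value u_closed) auto
    then have "multiset_value L (\<lambda>b. \<theta> (?u b)) N = \<zero>\<^bsub>L\<^esub>"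
      by (simp only: proj_null[OF N] \<theta>.hom_zero)
    then show "(\<Oplus>\<^bsub>L\<^esub>b\<in>set_mset N. [count N b] \<cdot>\<^bsub>L\<^esub> \<theta> (?u b)) = \<zero>\<^bsub>L\<^esub>"
      by (simp only: multiset_value_def)
  qed
  have "ring_hom_ring K L (\<lambda>c. \<theta> (?\<sigma> c))"
    using ring_hom_trans[OF \<sigma> \<theta>] K.ring_axioms L.ring_axioms
    by (intro ring_hom_ringI2) (simp_all add: comp_def)
  then have "subfield ((\<lambda>c. \<theta> (?\<sigma> c)) ` carrier K) L"
    by (rule ring_hom_ring.img_is_subfield(2)[OF _ K.carrier_is_subfield L.one_not_zero])
  then have k: "subfield (\<theta> ` ?\<sigma> ` carrier K) L"
    unfolding image_image .
  have "alg_independent L {\<zero>\<^bsub>L\<^esub>} (\<theta> ` ?\<sigma> ` carrier K) (\<lambda>i. \<theta> (?u (as ! i))) I"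
  proof (rule \<theta>.alg_independent_image[OF ind])
    show "?\<sigma> ` carrier K \<subseteq> carrier (rho K B)"
      using ring_hom_closed[OF \<sigma>] by blast
    show "(\<lambda>i. ?u (as ! i)) \<in> I \<rightarrow> carrier (rho K B)"
    proof
      fix i assume "i \<in> I"
      then have "as ! i \<in> set as"
        using I by auto
      then show "?u (as ! i) \<in> carrier (rho K B)"
        using gen by (intro u_closed) (auto simp: generators_def)
    qed
    show "x \<in> P" if "x \<in> carrier (rho K B)" "\<theta> x = \<zero>\<^bsub>L\<^esub>" for x
      using bspec[OF ker that(1)] that(2) by (rule iffD1)
  qed
  then show ?thesis
    by (rule band_point.card_independent_le[OF point gen k I _ dim])
qed

text \<open>The supremum and the infimum are compared member by member: a chain of length
  \<open>d\<close> yields \<open>d\<close> generators independent modulo its smallest prime, and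
  \<open>d \<le> n\<close> for each admissible bound \<open>n\<close>.\<close>

lemma krull_dim_le_covering_dim:
  assumes gen: "generators B as"
  shows "krull_dim (Spec (rho K B)) \<le> covering_dim (Sigma_space B as)"
  unfolding krull_dim_def covering_dim_def
proof (intro Sup_least Inf_greatest)
  fix x y
  assume "x \<in> {ereal (real d) |d. \<exists>P. (\<forall>i\<le>d. P i \<in> Spec (rho K B)) \<and> (\<forall>i<d. P i \<subset> P (Suc i))}"
    and "y \<in> {ereal (real_of_int n) |n. - 1 \<le> n \<and> covering_dim_le (Sigma_space B as) n}"
  then obtain d P n where x: "x = ereal (real d)" and P: "\<forall>i\<le>d. primeideal (P i) (rho K B)" "\<forall>i<d. P i \<subset> P (Suc i)"
    and y: "y = ereal (real_of_int n)" and n: "covering_dim_le (Sigma_space B as) n"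
    by (auto simp: Spec_def)
  have "\<exists>I. I \<subseteq> {..<length as} \<and> card I = d \<and> alg_independent (rho K B) (P 0)
      ((\<lambda>c. proj (scalar K B c)) ` carrier K) (\<lambda>i. proj (\<delta> (as ! i))) I"
    by (rule fg_algebra.independent_of_chain[OF fg_algebra_rho[OF gen]]) (simp_all add: P)
  then have "int d \<le> n"
    using card_independent_mod_prime_le[OF gen _ _ _ n] P(1) by blast
  then show "x \<le> y"
    by (simp add: x y)
qed

context
  fixes as :: "'a list"
  assumes gen: "generators B as" and dim: "covering_dim_le (Sigma_space B as) 0"
begin

interpretation rho: fg_algebra K "rho K B" "\<lambda>c. proj (scalar K B c)" "\<lambda>i. proj (\<delta> (as ! i))" "length as"
  by (rule fg_algebra_rho[OF gen])

definition coordinate_values :: "nat \<Rightarrow> 'k set" where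
  "coordinate_values i = (\<lambda>\<xi>. \<xi> (proj (\<delta> (as ! i)))) ` rho.rational_homs"

text \<open>Infinitely many values would make the single generator \<open>i\<close> independent
  modulo some prime, which forces dimension at least 1.\<close>

lemma finite_coordinate_values:
  assumes i: "i < length as"
  shows "finite (coordinate_values i)"
proof (rule ccontr)
  assume "infinite (coordinate_values i)"
  then obtain P where "primeideal P (rho K B)"
      "alg_independent (rho K B) P ((\<lambda>c. proj (scalar K B c)) ` carrier K) (\<lambda>i. proj (\<delta> (as ! i))) {i}"
    unfolding coordinate_values_def by (rule rho.independent_of_infinite_values[OF i])
  then have "int (card {i}) \<le> 0"
    using i by (intro card_independent_mod_prime_le[OF gen _ _ _ dim]) auto
  then show False
    by simp
qed

lemma finite_rational_points: "finite (rational_points K B)"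
proof (rule inj_on_finite)
  have hom: "h \<in> rho.rational_homs" if "h \<in> rational_points K B" for h
    unfolding rho.rational_homs_def using that by (simp add: rational_points_def proj_def)
  show "finite (PiE {..<length as} coordinate_values)"
    by (intro finite_PiE finite_coordinate_values) auto
  show "(\<lambda>h. \<lambda>i\<in>{..<length as}. h (proj (\<delta> (as ! i)))) ` rational_points K B \<subseteq> PiE {..<length as} coordinate_values"
    unfolding image_subset_iff restrict_PiE_iff coordinate_values_def using hom by (intro ballI imageI)
  show "inj_on (\<lambda>h. \<lambda>i\<in>{..<length as}. h (proj (\<delta> (as ! i)))) (rational_points K B)"
  proof (rule inj_onI)
    fix h h' assume h: "h \<in> rational_points K B" "h' \<in> rational_points K B"
      and eq: "(\<lambda>i\<in>{..<length as}. h (proj (\<delta> (as ! i)))) = (\<lambda>i\<in>{..<length as}. h' (proj (\<delta> (as ! i))))"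
    have "h (proj (\<delta> (as ! i))) = h' (proj (\<delta> (as ! i)))" if "i < length as" for i
      using fun_cong[OF eq, of i] that by simp
    then have "h x = h' x" if "x \<in> carrier (rho K B)" for x
      by (rule rho.rational_homs_eqI[OF hom[OF h(1)] hom[OF h(2)] _ that])
    then show "h = h'"
      using h unfolding rational_points_def by (intro extensionalityI[of h "carrier (rho K B)"]) simp_all
  qed
qed

text \<open>By \<open>rho_lift\<close>, a homomorphism to \<open>K\<close> has the same coordinates
  as some rational homomorphism. It is determined by these coordinates, for which only finitely many
  tuples are possible.\<close>

lemma finite_band_Hom_ring_band: "finite (band_Hom B (ring_band K))"
proof (rule inj_on_finite)
  show "finite (PiE {..<length as} coordinate_values)"
    by (intro finite_PiE finite_coordinate_values) auto
  have vals: "g (as ! i) \<in> coordinate_values i" if g: "g \<in> band_Hom B (ring_band K)" and i: "i < length as" for g i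
  proof -
    have asi: "as ! i \<in> carrier B"
      using gen i by (auto simp: generators_def)
    show ?thesis
    proof (rule rho_lift[OF g])
      fix h assume h: "h \<in> ring_hom (rho K B) K" "\<And>c. c \<in> carrier K \<Longrightarrow> h (proj (scalar K B c)) = c"
        "\<And>b. b \<in> carrier B \<Longrightarrow> h (proj (\<delta> b)) = g b"
      then have "h \<in> rho.rational_homs"
        unfolding rho.rational_homs_def by simp
      then show ?thesis
        unfolding coordinate_values_def h(3)[OF asi, symmetric] by (rule imageI)
    qed
  qed
  then show "(\<lambda>g. \<lambda>i\<in>{..<length as}. g (as ! i)) ` band_Hom B (ring_band K) \<subseteq> PiE {..<length as} coordinate_values"
    unfolding image_subset_iff restrict_PiE_iff by simp
  show "inj_on (\<lambda>g. \<lambda>i\<in>{..<length as}. g (as ! i)) (band_Hom B (ring_band K))"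
  proof (rule inj_onI)
    fix g g' assume g: "g \<in> band_Hom B (ring_band K)" "g' \<in> band_Hom B (ring_band K)"
      and eq: "(\<lambda>i\<in>{..<length as}. g (as ! i)) = (\<lambda>i\<in>{..<length as}. g' (as ! i))"
    have "g (as ! i) = g' (as ! i)" if "i < length as" for i
      using fun_cong[OF eq, of i] that by simp
    then show "g = g'"
      by (rule band_Hom_eqI[OF band_axioms gen g])
  qed
qed

end

end

theorem theorem2p1:
  fixes B :: "('a, 'm) band_scheme" and K :: "('k, 'n) ring_scheme"
  assumes "band B" and "finitely_generated B" and "field K"
  shows "(\<forall>as. generators B as \<longrightarrow>
            krull_dim (Spec (rho K B)) \<le> covering_dim (Sigma_space B as)) \<and>
         (is_singleton (band_Hom B tropical) \<longrightarrow>
            (\<forall>as. generators B as \<longrightarrow> covering_dim (Sigma_space B as) = 0) \<and>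
            finite (rational_points K B) \<and>
            finite (band_Hom B (ring_band K)))"
proof -
  interpret band_algebra B K
    using assms(1,3) by (rule band_algebra.intro)
  obtain as where as: "generators B as"
    using assms(2) unfolding finitely_generated_def by blast
  have point: "\<exists>x. topspace (Sigma_space B as) = {x}"
    if "is_singleton (band_Hom B tropical)" "generators B as" for as
    using that(1) topspace_Sigma_space[OF assms(1) that(2)] by (auto elim: is_singletonE)
  then have "covering_dim_le (Sigma_space B as) 0" if "is_singleton (band_Hom B tropical)"
    using point[OF that as] by (elim exE) (simp add: covering_dim_le_singleton)
  moreover have "covering_dim (Sigma_space B as) = 0"
    if "is_singleton (band_Hom B tropical)" "generators B as" for as
    using point[OF that] by (elim exE) (rule covering_dim_singleton)
  ultimately show ?thesis
    by (intro conjI allI impI krull_dim_le_covering_dim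
        finite_rational_points[OF as] finite_band_Hom_ring_band[OF as])
qed

end
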